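(* Let $\mathsf{MV}_s$ be the category whose objects are MV-algebras and whose morphisms are states of MV-algebras, and let $\mathsf{A}_s$ be the category whose objects are unital Abelian $\ell$-groups and whose morphisms are states of unital Abelian $\ell$-groups. Let $\Gamma\colon \mathsf{A}_s\to\mathsf{MV}_s$ be the functor sending $G$ to $\Gamma(G,1)$ and a state $s\colon G\to H$ to its restriction $\Gamma(G,1)\to\Gamma(H,1)$. Let $\Xi\colon\mathsf{MV}_s\to\mathsf{A}_s$ be the functor sending $M$ to $\Xi M$ and a state $s\colon M\to N$ to its unique extension to a state $\Xi M\to \Xi N$. Then $\Gamma$ and $\Xi$ form an equivalence of categories.
   Context: A unital Abelian $\ell$-group is an Abelian lattice-ordered group $G$ together with a strong order unit $1$. Its unit interval is the MV-algebra $\Gamma(G,1)=\{a\in G\mid 0\le a\le 1\}$ with the operations $a\oplus b=(a+b)\wedge 1$, $\neg a=1-a$ and constant $0$. Given an MV-algebra $M$, $\Xi M$ denotes the unital Abelian $\ell$-group associated with $M$ by Mundici's equivalence (the group of formal differences of good sequences of $M$, with unit $[(1),(0)]$). We identify $M$ with $\Gamma(\Xi M,1)$ via the canonical isomorphism $a\mapsto[(a),(0)]$. In an MV-algebra, $a\odot b:=\neg(\neg a\oplus\neg b)$ and $1:=\neg 0$. A state of MV-algebras $s\colon M\to N$ is a function satisfying $s(1)=1$ and $s(a\oplus b)=s(a)+s(b)$ for all $a,b\in M$ with $a\odot b=0$, where $+$ is computed in $\Xi N$. A state of unital Abelian $\ell$-groups $s\colon G\to H$ is a positive group homomorphism with $s(1)=1$.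 The following facts are used to define the functors: restrictions of states of unital $\ell$-groups to unit intervals are states of MV-algebras, and every state of MV-algebras $M\to N$ extends uniquely to a state $\Xi M\to\Xi N$. *)

theory Defs
  imports "HOL-Algebra.Group" "HOL-Library.Infinite_Typeclass"
begin

section \<open>Categories, functors, equivalences\<close>

text \<open>
  Hom-sets are indexed by objects and need not be disjoint (the same function may be an arrow
  between different objects); hence composition and the arrow part of a functor take the
  objects involved as arguments.  \<open>Comp C A B D g f\<close> is the composite of
  \<open>f : A \<rightarrow> B\<close> and \<open>g : B \<rightarrow> D\<close>.
\<close>

record ('o, 'm) category =
  Ob :: "'o set"
  Hom :: "'o \<Rightarrow> 'o \<Rightarrow> 'm set"
  Id :: "'o \<Rightarrow> 'm"
  Comp :: "'o \<Rightarrow> 'o \<Rightarrow> 'o \<Rightarrow> 'm \<Rightarrow> 'm \<Rightarrow> 'm"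

definition is_category :: "('o, 'm) category \<Rightarrow> bool" where
  "is_category C \<longleftrightarrow>
     (\<forall>A\<in>Ob C. Id C A \<in> Hom C A A) \<and>
     (\<forall>A\<in>Ob C. \<forall>B\<in>Ob C. \<forall>D\<in>Ob C. \<forall>f\<in>Hom C A B. \<forall>g\<in>Hom C B D.
        Comp C A B D g f \<in> Hom C A D) \<and>
     (\<forall>A\<in>Ob C. \<forall>B\<in>Ob C. \<forall>f\<in>Hom C A B.
        Comp C A A B f (Id C A) = f \<and> Comp C A B B (Id C B) f = f) \<and>
     (\<forall>A\<in>Ob C. \<forall>B\<in>Ob C. \<forall>D\<in>Ob C. \<forall>E\<in>Ob C.
        \<forall>f\<in>Hom C A B. \<forall>g\<in>Hom C B D. \<forall>h\<in>Hom C D E.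
        Comp C A D E h (Comp C A B D g f) = Comp C A B E (Comp C B D E h g) f)"

record ('o, 'm, 'p, 'n) func =
  fob :: "'o \<Rightarrow> 'p"
  farr :: "'o \<Rightarrow> 'o \<Rightarrow> 'm \<Rightarrow> 'n"

definition is_functor ::
    "('o, 'm) category \<Rightarrow> ('p, 'n) category \<Rightarrow> ('o, 'm, 'p, 'n) func \<Rightarrow> bool" where
  "is_functor C D F \<longleftrightarrow>
     (\<forall>A\<in>Ob C. fob F A \<in> Ob D) \<and>
     (\<forall>A\<in>Ob C. \<forall>B\<in>Ob C. \<forall>f\<in>Hom C A B. farr F A B f \<in> Hom D (fob F A) (fob F B)) \<and>
     (\<forall>A\<in>Ob C. farr F A A (Id C A) = Id D (fob F A)) \<and>
     (\<forall>A\<in>Ob C. \<forall>B\<in>Ob C. \<forall>E\<in>Ob C. \<forall>f\<in>Hom C A B. \<forall>g\<in>Hom C B E.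
        farr F A E (Comp C A B E g f) =
          Comp D (fob F A) (fob F B) (fob F E) (farr F B E g) (farr F A B f))"

definition id_func :: "('o, 'm, 'o, 'm) func" where
  "id_func = \<lparr>fob = (\<lambda>A. A), farr = (\<lambda>A B f. f)\<rparr>"

definition comp_func ::
    "('p, 'n, 'q, 'k) func \<Rightarrow> ('o, 'm, 'p, 'n) func \<Rightarrow> ('o, 'm, 'q, 'k) func" where
  "comp_func G F =
     \<lparr>fob = (\<lambda>A. fob G (fob F A)),
      farr = (\<lambda>A B f. farr G (fob F A) (fob F B) (farr F A B f))\<rparr>"

definition is_iso :: "('o, 'm) category \<Rightarrow> 'o \<Rightarrow> 'o \<Rightarrow> 'm \<Rightarrow> bool" where
  "is_iso C A B f \<longleftrightarrow> f \<in> Hom C A B \<and>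
     (\<exists>g\<in>Hom C B A. Comp C A B A g f = Id C A \<and> Comp C B A B f g = Id C B)"

definition is_nat_iso ::
    "('o, 'm) category \<Rightarrow> ('p, 'n) category \<Rightarrow>
     ('o, 'm, 'p, 'n) func \<Rightarrow> ('o, 'm, 'p, 'n) func \<Rightarrow> ('o \<Rightarrow> 'n) \<Rightarrow> bool" where
  "is_nat_iso C D F G \<eta> \<longleftrightarrow>
     (\<forall>A\<in>Ob C. is_iso D (fob F A) (fob G A) (\<eta> A)) \<and>
     (\<forall>A\<in>Ob C. \<forall>B\<in>Ob C. \<forall>f\<in>Hom C A B.
        Comp D (fob F A) (fob F B) (fob G B) (\<eta> B) (farr F A B f) =
        Comp D (fob F A) (fob G A) (fob G B) (farr G A B f) (\<eta> A))"

definition equivalence_of_categories ::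
    "('o, 'm) category \<Rightarrow> ('p, 'n) category \<Rightarrow>
     ('o, 'm, 'p, 'n) func \<Rightarrow> ('p, 'n, 'o, 'm) func \<Rightarrow> bool" where
  "equivalence_of_categories C D F G \<longleftrightarrow>
     is_category C \<and> is_category D \<and> is_functor C D F \<and> is_functor D C G \<and>
     (\<exists>\<eta>. is_nat_iso C C id_func (comp_func G F) \<eta>) \<and>
     (\<exists>\<epsilon>. is_nat_iso D D (comp_func F G) id_func \<epsilon>)"


section \<open>MV-algebras\<close>

record 'a mv = "'a partial_object" +
  mv_plus :: "'a \<Rightarrow> 'a \<Rightarrow> 'a"
  mv_neg :: "'a \<Rightarrow> 'a"
  mv_zero :: 'a

definition mv_one :: "'a mv \<Rightarrow> 'a" where
  "mv_one M = mv_neg M (mv_zero M)"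

definition mv_times :: "'a mv \<Rightarrow> 'a \<Rightarrow> 'a \<Rightarrow> 'a" where
  "mv_times M a b = mv_neg M (mv_plus M (mv_neg M a) (mv_neg M b))"

definition mv_le :: "'a mv \<Rightarrow> 'a \<Rightarrow> 'a \<Rightarrow> bool" where
  "mv_le M a b \<longleftrightarrow> mv_plus M (mv_neg M a) b = mv_one M"

locale mv_algebra =
  fixes M :: "'a mv"
  assumes zero_closed: "mv_zero M \<in> carrier M"
    and neg_closed: "a \<in> carrier M \<Longrightarrow> mv_neg M a \<in> carrier M"
    and plus_closed: "\<lbrakk>a \<in> carrier M; b \<in> carrier M\<rbrakk> \<Longrightarrow> mv_plus M a b \<in> carrier M"
    and plus_assoc: "\<lbrakk>a \<in> carrier M; b \<in> carrier M; c \<in> carrier M\<rbrakk> \<Longrightarrow>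
      mv_plus M (mv_plus M a b) c = mv_plus M a (mv_plus M b c)"
    and plus_commute: "\<lbrakk>a \<in> carrier M; b \<in> carrier M\<rbrakk> \<Longrightarrow> mv_plus M a b = mv_plus M b a"
    and plus_zero: "a \<in> carrier M \<Longrightarrow> mv_plus M a (mv_zero M) = a"
    and neg_neg: "a \<in> carrier M \<Longrightarrow> mv_neg M (mv_neg M a) = a"
    and plus_one: "a \<in> carrier M \<Longrightarrow> mv_plus M a (mv_one M) = mv_one M"
    and lukasiewicz: "\<lbrakk>a \<in> carrier M; b \<in> carrier M\<rbrakk> \<Longrightarrow>
      mv_plus M (mv_neg M (mv_plus M (mv_neg M a) b)) b =
      mv_plus M (mv_neg M (mv_plus M (mv_neg M b) a)) a"


section \<open>Unital Abelian l-groups\<close>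

text \<open>
  The group is additive in the mathematics but uses the (multiplicative) library record: the
  field \<^const>\<open>mult\<close> is the addition and the field \<^const>\<open>one\<close> is the neutral element 0.
  The order unit 1 is the field \<open>ounit\<close>.
\<close>

record 'a ulgroup = "'a monoid" +
  lg_le :: "'a \<Rightarrow> 'a \<Rightarrow> bool"
  ounit :: 'a

definition lg_order :: "'a ulgroup \<Rightarrow> 'a gorder" where
  "lg_order G = \<lparr>carrier = carrier G, eq = (=), le = lg_le G\<rparr>"

locale unital_l_group =
  fixes G :: "'a ulgroup"
  assumes comm_group: "comm_group G"
    and lattice: "lattice (lg_order G)"
    and translation_invariant:
      "\<lbrakk>x \<in> carrier G; y \<in> carrier G; z \<in> carrier G; lg_le G x y\<rbrakk> \<Longrightarrow>
        lg_le G (x \<otimes>\<^bsub>G\<^esub> z) (y \<otimes>\<^bsub>G\<^esub> z)"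
    and unit_closed: "ounit G \<in> carrier G"
    and unit_nonneg: "lg_le G \<one>\<^bsub>G\<^esub> (ounit G)"
    and strong_unit: "x \<in> carrier G \<Longrightarrow> \<exists>n::nat. lg_le G x (ounit G [^]\<^bsub>G\<^esub> n)"

definition lg_state :: "'a ulgroup \<Rightarrow> 'b ulgroup \<Rightarrow> ('a \<Rightarrow> 'b) \<Rightarrow> bool" where
  "lg_state G H s \<longleftrightarrow> s \<in> hom G H \<and>
     (\<forall>x\<in>carrier G. lg_le G \<one>\<^bsub>G\<^esub> x \<longrightarrow> lg_le H \<one>\<^bsub>H\<^esub> (s x)) \<and>
     s (ounit G) = ounit H"

definition Gamma :: "'a ulgroup \<Rightarrow> 'a mv" where
  "Gamma G =
     \<lparr>carrier = {a \<in> carrier G. lg_le G \<one>\<^bsub>G\<^esub> a \<and> lg_le G a (ounit G)},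
      mv_plus = (\<lambda>a b. (a \<otimes>\<^bsub>G\<^esub> b) \<sqinter>\<^bsub>lg_order G\<^esub> ounit G),
      mv_neg = (\<lambda>a. ounit G \<otimes>\<^bsub>G\<^esub> inv\<^bsub>G\<^esub> a),
      mv_zero = \<one>\<^bsub>G\<^esub>\<rparr>"


section \<open>The group of formal differences of good sequences\<close>

definition good_seqs :: "'a mv \<Rightarrow> (nat \<Rightarrow> 'a) set" where
  "good_seqs M = {a. (\<forall>i. a i \<in> carrier M) \<and>
     (\<forall>i. mv_plus M (a i) (a (Suc i)) = a i) \<and>
     (\<exists>n. \<forall>i\<ge>n. a i = mv_zero M)}"

definition gs_const :: "'a mv \<Rightarrow> 'a \<Rightarrow> nat \<Rightarrow> 'a" where
  "gs_const M a = (\<lambda>i. if i = 0 then a else mv_zero M)"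

text \<open>
  With entries numbered from 1, the sum of good sequences is
  \<open>c\<^sub>i = a\<^sub>i \<oplus> (a\<^sub>i\<^sub>-\<^sub>1 \<odot> b\<^sub>1) \<oplus> \<dots> \<oplus> (a\<^sub>1 \<odot> b\<^sub>i\<^sub>-\<^sub>1) \<oplus> b\<^sub>i\<close>; below entries are numbered from 0.
\<close>

definition gs_plus :: "'a mv \<Rightarrow> (nat \<Rightarrow> 'a) \<Rightarrow> (nat \<Rightarrow> 'a) \<Rightarrow> nat \<Rightarrow> 'a" where
  "gs_plus M a b = (\<lambda>i. mv_plus M (a i)
     (foldr (mv_plus M) (map (\<lambda>j. mv_times M (a (i - 1 - j)) (b j)) [0..<i]) (b i)))"

definition gs_le :: "'a mv \<Rightarrow> (nat \<Rightarrow> 'a) \<Rightarrow> (nat \<Rightarrow> 'a) \<Rightarrow> bool" where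
  "gs_le M a b \<longleftrightarrow> (\<forall>i. mv_le M (a i) (b i))"

type_synonym 'a gdiff = "((nat \<Rightarrow> 'a) \<times> (nat \<Rightarrow> 'a)) set"

definition gdiff_rel :: "'a mv \<Rightarrow> ((nat \<Rightarrow> 'a) \<times> (nat \<Rightarrow> 'a)) rel" where
  "gdiff_rel M = {((a, b), (c, d)). a \<in> good_seqs M \<and> b \<in> good_seqs M \<and>
     c \<in> good_seqs M \<and> d \<in> good_seqs M \<and> gs_plus M a d = gs_plus M c b}"

definition gdiff :: "'a mv \<Rightarrow> (nat \<Rightarrow> 'a) \<Rightarrow> (nat \<Rightarrow> 'a) \<Rightarrow> 'a gdiff" where
  "gdiff M a b = gdiff_rel M `` {(a, b)}"

definition Xi :: "'a mv \<Rightarrow> 'a gdiff ulgroup" where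
  "Xi M =
     \<lparr>carrier = (good_seqs M \<times> good_seqs M) // gdiff_rel M,
      mult = (\<lambda>X Y. \<Union>(a, b)\<in>X. \<Union>(c, d)\<in>Y. gdiff M (gs_plus M a c) (gs_plus M b d)),
      one = gdiff M (gs_const M (mv_zero M)) (gs_const M (mv_zero M)),
      lg_le = (\<lambda>X Y. \<exists>(a, b)\<in>X. \<exists>(c, d)\<in>Y. gs_le M (gs_plus M a d) (gs_plus M c b)),
      ounit = gdiff M (gs_const M (mv_one M)) (gs_const M (mv_zero M))\<rparr>"

definition Xi_embed :: "'a mv \<Rightarrow> 'a \<Rightarrow> 'a gdiff" where
  "Xi_embed M a = gdiff M (gs_const M a) (gs_const M (mv_zero M))"

definition mv_state :: "'a mv \<Rightarrow> 'b mv \<Rightarrow> ('a \<Rightarrow> 'b) \<Rightarrow> bool" where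
  "mv_state M N s \<longleftrightarrow> s \<in> carrier M \<rightarrow> carrier N \<and>
     s (mv_one M) = mv_one N \<and>
     (\<forall>a\<in>carrier M. \<forall>b\<in>carrier M. mv_times M a b = mv_zero M \<longrightarrow>
        Xi_embed N (s (mv_plus M a b)) = Xi_embed N (s a) \<otimes>\<^bsub>Xi N\<^esub> Xi_embed N (s b))"


section \<open>The two categories\<close>

text \<open>
  The objects are the structures whose carrier is a subset of a type \<open>'u\<close> that plays the role
  of the universe of sets.  Arrows are functions made \<^const>\<open>undefined\<close> outside the domain
  carrier, so that equality of arrows is equality on that carrier.
\<close>

definition MVs :: "('u mv, 'u \<Rightarrow> 'u) category" where
  "MVs =
     \<lparr>Ob = {M. mv_algebra M},
      Hom = (\<lambda>M N. {s. mv_state M N s} \<inter> extensional (carrier M)),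
      Id = (\<lambda>M. \<lambda>a\<in>carrier M. a),
      Comp = (\<lambda>M N P t s. compose (carrier M) t s)\<rparr>"

definition As :: "('u ulgroup, 'u \<Rightarrow> 'u) category" where
  "As =
     \<lparr>Ob = {G. unital_l_group G},
      Hom = (\<lambda>G H. {s. lg_state G H s} \<inter> extensional (carrier G)),
      Id = (\<lambda>G. \<lambda>x\<in>carrier G. x),
      Comp = (\<lambda>G H K t s. compose (carrier G) t s)\<rparr>"


section \<open>The two functors\<close>

definition Gamma_functor :: "('u ulgroup, 'u \<Rightarrow> 'u, 'u mv, 'u \<Rightarrow> 'u) func" where
  "Gamma_functor =
     \<lparr>fob = Gamma, farr = (\<lambda>G H s. restrict s (carrier (Gamma G)))\<rparr>"

text \<open>
  The elements of \<open>Xi M\<close> are sets of pairs of sequences over \<open>'u\<close>, not elements of \<open>'u\<close>.  To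
  make it an object over the universe \<open>'u\<close>, its underlying set is replaced by a copy inside
  \<open>'u\<close>, along an arbitrary injection \<open>Xi_code M\<close>; for infinite \<open>'u\<close> there is one, since
  good sequences are finitely supported (\<open>Xi_code_inj\<close> below).
\<close>

definition lg_image :: "('a \<Rightarrow> 'b) \<Rightarrow> 'a ulgroup \<Rightarrow> 'b ulgroup" where
  "lg_image f G = (let g = inv_into (carrier G) f in
     \<lparr>carrier = f ` carrier G,
      mult = (\<lambda>x y. f (g x \<otimes>\<^bsub>G\<^esub> g y)),
      one = f \<one>\<^bsub>G\<^esub>,
      lg_le = (\<lambda>x y. lg_le G (g x) (g y)),
      ounit = f (ounit G)\<rparr>)"

definition Xi_code :: "'u mv \<Rightarrow> 'u gdiff \<Rightarrow> 'u" where
  "Xi_code M = (SOME f. inj_on f (carrier (Xi M)))"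

definition Xi_ob :: "'u mv \<Rightarrow> 'u ulgroup" where
  "Xi_ob M = lg_image (Xi_code M) (Xi M)"

definition Xi_ob_embed :: "'u mv \<Rightarrow> 'u \<Rightarrow> 'u" where
  "Xi_ob_embed M a = Xi_code M (Xi_embed M a)"

definition Xi_arr :: "'u mv \<Rightarrow> 'u mv \<Rightarrow> ('u \<Rightarrow> 'u) \<Rightarrow> 'u \<Rightarrow> 'u" where
  "Xi_arr M N s = (THE t. t \<in> Hom As (Xi_ob M) (Xi_ob N) \<and>
     (\<forall>a\<in>carrier M. t (Xi_ob_embed M a) = Xi_ob_embed N (s a)))"

definition Xi_functor :: "('u mv, 'u \<Rightarrow> 'u, 'u ulgroup, 'u \<Rightarrow> 'u) func" where
  "Xi_functor = \<lparr>fob = Xi_ob, farr = Xi_arr\<rparr>"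

lemma infinite_list_code:
  "\<exists>F :: 'u::infinite list \<Rightarrow> 'u. inj F"
proof -
  have inf: "infinite (UNIV :: 'u set)"
    by (rule infinite_UNIV)
  obtain e0 :: "'u \<times> 'u \<Rightarrow> 'u" where "bij_betw e0 (UNIV \<times> UNIV) UNIV"
    using card_of_Times_same_infinite[OF inf] card_of_ordIso by blast
  then obtain e :: "'u \<times> 'u \<Rightarrow> 'u" where e: "inj e"
    by (auto simp: bij_betw_def)
  obtain h :: "nat \<Rightarrow> 'u" where h: "inj h"
    using infinite_countable_subset[OF inf] by blast
  define enc :: "'u list \<Rightarrow> 'u" where "enc xs = foldr (\<lambda>x y. e (x, y)) xs (h 0)" for xs
  have enc: "xs = ys" if "length xs = length ys" "enc xs = enc ys" for xs ys
    using that by (induction rule: list_induct2) (auto simp: enc_def dest: injD[OF e])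
  have "inj (\<lambda>xs. e (h (length xs), enc xs))"
    by (rule injI) (auto dest!: injD[OF e] injD[OF h] intro: enc)
  then show ?thesis by blast
qed

lemma Xi_code_inj: "inj_on (Xi_code M) (carrier (Xi (M :: 'u::infinite mv)))"
proof -
  obtain F :: "'u list \<Rightarrow> 'u" where F: "inj F"
    using infinite_list_code by blast
  let ?P = "good_seqs M \<times> good_seqs M"
  have "\<exists>n. \<forall>i\<ge>n. fst p i = mv_zero M \<and> snd p i = mv_zero M" if p: "p \<in> ?P" for p
  proof -
    obtain m n where "\<forall>i\<ge>m. fst p i = mv_zero M" "\<forall>i\<ge>n. snd p i = mv_zero M"
      using p unfolding good_seqs_def mem_Times_iff by blast
    then have "\<forall>i\<ge>max m n. fst p i = mv_zero M \<and> snd p i = mv_zero M" by simp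
    then show ?thesis by blast
  qed
  then obtain N where N: "\<And>p i. p \<in> ?P \<Longrightarrow> N p \<le> i \<Longrightarrow> fst p i = mv_zero M \<and> snd p i = mv_zero M"
    by metis
  define c where "c p = map (fst p) [0..<N p] @ map (snd p) [0..<N p]" for p
  have "inj_on c ?P"
  proof (rule inj_onI)
    fix p q assume pq: "p \<in> ?P" "q \<in> ?P" "c p = c q"
    have len: "length (c p) = 2 * N p" for p by (simp add: c_def)
    have "N p = N q"
      using len[of p] len[of q] pq(3) by simp
    then have "\<forall>i<N p. fst p i = fst q i \<and> snd p i = snd q i"
      using pq(3) by (simp add: c_def)
    then have "fst p i = fst q i \<and> snd p i = snd q i" for i
      using N[OF pq(1)] N[OF pq(2)] \<open>N p = N q\<close> by (metis not_less)
    then show "p = q" by (auto simp: prod_eq_iff)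
  qed
  moreover have "\<exists>r\<in>?P. X = gdiff_rel M `` {r}" if "X \<in> carrier (Xi M)" for X
    using that by (auto simp: Xi_def quotient_def)
  then obtain r where "\<And>X. X \<in> carrier (Xi M) \<Longrightarrow> r X \<in> ?P \<and> X = gdiff_rel M `` {r X}"
    by metis
  ultimately have "inj_on (\<lambda>X. F (c (r X))) (carrier (Xi M))"
    by (intro inj_onI) (metis F injD inj_onD)
  then show ?thesis
    unfolding Xi_code_def by (rule someI[where P = "\<lambda>f. inj_on f (carrier (Xi M))"])
qed

end

theory Submission
  imports Defs
begin

text \<open>
  Write \<open>x + b\<close> for the sequence with entries \<open>x\<^sub>i \<oplus> (x\<^sub>i\<^sub>-\<^sub>1 \<odot> b)\<close>, where \<open>x\<^sub>-\<^sub>1 = 1\<close>.  On good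
  sequences these operations commute, are order embeddings (since \<open>(x + b) + \<not> b\<close> is the sequence
  \<open>(1, x\<^sub>0, x\<^sub>1, \<dots>)\<close>), and the sum of good sequences \<open>a\<close> and \<open>b\<close> arises by adding the entries
  of \<open>b\<close> to \<open>a\<close> one after the other.  All of this is derived equationally, without representing the
  MV-algebra by chains, and it makes the good sequences a cancellative lattice-ordered monoid,
  whose group of differences is \<open>\<Xi> M\<close>.

  For an additive map \<open>v\<close> on \<open>M\<close> the identity \<open>v (x \<oplus> y) + v (x \<odot> y) = v x + v y\<close> makes
  \<open>a \<mapsto> v a\<^sub>0 + v a\<^sub>1 + \<dots>\<close> additive on good sequences by telescoping.  This extends states to
  \<open>\<Xi> M\<close>, and for the inclusion of the unit interval of \<open>G\<close> it yields the isomorphism from the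
  group of that interval to \<open>G\<close>.
\<close>

section \<open>MV-algebras\<close>

text \<open>States need not preserve meets and joins, and a bijective state need not have a positive
  inverse. The map from the group of the unit interval back to \<open>G\<close> must therefore be
  shown to reflect the order, for which the entries of a good sequence are recovered from their sum.
  Functoriality and naturality rest on generation: each element of the group is a difference of sums
  of elements of \<open>M\<close>. Homomorphisms are thus determined on \<open>M\<close>, and
  equations between arrows out of the group are checked on the unit interval only. Additivity of a
  state is defined in the group of the target. It becomes a statement about MV-algebras because the
  one-entry sequences of \<open>a\<close> and \<open>b\<close> add up to
  \<open>(a \<oplus> b, a \<odot> b)\<close>, which has a single entry only if the carry
  \<open>a \<odot> b\<close> vanishes. The object over the universe is a copy of the group along an
  arbitrary injection, of which only injectivity is used: the work is done on good sequences and
  then transported.\<close>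

context mv_algebra
begin

abbreviation zero_mv ("\<O>") where "\<O> \<equiv> mv_zero M"
abbreviation one_mv ("\<I>") where "\<I> \<equiv> mv_one M"
abbreviation neg_mv ("\<sim> _" [81] 80) where "\<sim> a \<equiv> mv_neg M a"
abbreviation plus_mv (infixl "\<oplus>" 65) where "a \<oplus> b \<equiv> mv_plus M a b"
abbreviation times_mv (infixl "\<odot>" 70) where "a \<odot> b \<equiv> mv_times M a b"
abbreviation le_mv (infix "\<preceq>" 50) where "a \<preceq> b \<equiv> mv_le M a b"

text \<open>Truncated difference plus \<open>b\<close>. The axiom \<open>lukasiewicz\<close> says
  that this term is symmetric, and the symmetry is what makes it a supremum.\<close>

definition join (infixl "\<^bold>\<or>" 60) where "a \<^bold>\<or> b = (a \<odot> \<sim> b) \<oplus> b"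
definition meet (infixl "\<^bold>\<and>" 61) where "a \<^bold>\<and> b = \<sim> (\<sim> a \<^bold>\<or> \<sim> b)"

declare zero_closed [simp] neg_closed [simp] plus_closed [simp] plus_zero [simp] neg_neg [simp]
  plus_one [simp]

lemma one_closed [simp]: "\<I> \<in> carrier M"
  by (simp add: mv_one_def)

lemma times_closed [simp]: "a \<in> carrier M \<Longrightarrow> b \<in> carrier M \<Longrightarrow> a \<odot> b \<in> carrier M"
  by (simp add: mv_times_def)

lemma join_closed [simp]: "a \<in> carrier M \<Longrightarrow> b \<in> carrier M \<Longrightarrow> a \<^bold>\<or> b \<in> carrier M"
  by (simp add: join_def)

lemma meet_closed [simp]: "a \<in> carrier M \<Longrightarrow> b \<in> carrier M \<Longrightarrow> a \<^bold>\<and> b \<in> carrier M"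
  by (simp add: meet_def)

lemma neg_zero [simp]: "\<sim> \<O> = \<I>"
  by (simp add: mv_one_def)

lemma neg_one [simp]: "\<sim> \<I> = \<O>"
  using neg_neg[of \<O>] by simp

lemma zero_plus [simp]: "a \<in> carrier M \<Longrightarrow> \<O> \<oplus> a = a"
  using plus_commute[of a \<O>] by simp

lemma one_plus [simp]: "a \<in> carrier M \<Longrightarrow> \<I> \<oplus> a = \<I>"
  using plus_commute[of a \<I>] by simp

lemma plus_left_commute:
  "a \<in> carrier M \<Longrightarrow> b \<in> carrier M \<Longrightarrow> c \<in> carrier M \<Longrightarrow> a \<oplus> (b \<oplus> c) = b \<oplus> (a \<oplus> c)"
  by (metis plus_assoc plus_commute)

lemmas plus_ac = plus_assoc plus_commute plus_left_commute

text \<open>For \<open>b = 1\<close> the left side of \<open>lukasiewicz\<close> is 1 and its right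
  side is \<open>\<sim> a \<oplus> a\<close>.\<close>

lemma neg_plus_self [simp]: "a \<in> carrier M \<Longrightarrow> \<sim> a \<oplus> a = \<I>"
  using lukasiewicz[of a \<I>] by simp

lemma plus_neg_self [simp]: "a \<in> carrier M \<Longrightarrow> a \<oplus> \<sim> a = \<I>"
  using plus_commute[of a "\<sim> a"] by simp

lemma neg_plus: "a \<in> carrier M \<Longrightarrow> b \<in> carrier M \<Longrightarrow> \<sim> (a \<oplus> b) = \<sim> a \<odot> \<sim> b"
  by (simp add: mv_times_def)

lemma neg_times: "a \<in> carrier M \<Longrightarrow> b \<in> carrier M \<Longrightarrow> \<sim> (a \<odot> b) = \<sim> a \<oplus> \<sim> b"
  by (simp add: mv_times_def)

lemma neg_inject: "a \<in> carrier M \<Longrightarrow> b \<in> carrier M \<Longrightarrow> \<sim> a = \<sim> b \<longleftrightarrow> a = b"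
  by (metis neg_neg)

lemma times_commute: "a \<in> carrier M \<Longrightarrow> b \<in> carrier M \<Longrightarrow> a \<odot> b = b \<odot> a"
  by (simp add: mv_times_def plus_commute)

lemma times_assoc:
  "a \<in> carrier M \<Longrightarrow> b \<in> carrier M \<Longrightarrow> c \<in> carrier M \<Longrightarrow> a \<odot> b \<odot> c = a \<odot> (b \<odot> c)"
  by (simp add: mv_times_def plus_assoc)

lemma times_left_commute:
  "a \<in> carrier M \<Longrightarrow> b \<in> carrier M \<Longrightarrow> c \<in> carrier M \<Longrightarrow> a \<odot> (b \<odot> c) = b \<odot> (a \<odot> c)"
  by (metis times_assoc times_commute)

lemmas times_ac = times_assoc times_commute times_left_commute

lemma times_one [simp]: "a \<in> carrier M \<Longrightarrow> a \<odot> \<I> = a"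
  and one_times [simp]: "a \<in> carrier M \<Longrightarrow> \<I> \<odot> a = a"
  and times_zero [simp]: "a \<in> carrier M \<Longrightarrow> a \<odot> \<O> = \<O>"
  and zero_times [simp]: "a \<in> carrier M \<Longrightarrow> \<O> \<odot> a = \<O>"
  and times_neg_self [simp]: "a \<in> carrier M \<Longrightarrow> a \<odot> \<sim> a = \<O>"
  and neg_times_self [simp]: "a \<in> carrier M \<Longrightarrow> \<sim> a \<odot> a = \<O>"
  by (simp_all add: mv_times_def)

section \<open>Order, truncated difference and residuation\<close>

lemma le_iff_times: "a \<in> carrier M \<Longrightarrow> b \<in> carrier M \<Longrightarrow> a \<preceq> b \<longleftrightarrow> a \<odot> \<sim> b = \<O>"
  using neg_inject[of "\<sim> a \<oplus> b" \<I>] by (simp add: mv_le_def mv_times_def)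

text \<open>If \<open>a \<preceq> b\<close>, the left side of \<open>lukasiewicz\<close> collapses
  to \<open>b\<close> and the right side is \<open>a\<close> plus the difference. The order is thus
  divisibility for \<open>\<oplus>\<close>, whence transitivity and monotonicity.\<close>

lemma le_plus_diff: "a \<in> carrier M \<Longrightarrow> b \<in> carrier M \<Longrightarrow> a \<preceq> b \<Longrightarrow> a \<oplus> (b \<odot> \<sim> a) = b"
  using lukasiewicz[of a b] by (simp add: mv_le_def mv_times_def plus_ac)

lemma le_plus1 [simp]: "a \<in> carrier M \<Longrightarrow> b \<in> carrier M \<Longrightarrow> a \<preceq> a \<oplus> b"
  by (simp add: mv_le_def plus_assoc[symmetric])

lemma le_plus2 [simp]: "a \<in> carrier M \<Longrightarrow> b \<in> carrier M \<Longrightarrow> b \<preceq> a \<oplus> b"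
  by (metis le_plus1 plus_commute)

lemma le_refl [simp]: "a \<in> carrier M \<Longrightarrow> a \<preceq> a"
  by (simp add: mv_le_def)

lemma zero_le [simp]: "a \<in> carrier M \<Longrightarrow> \<O> \<preceq> a"
  by (simp add: mv_le_def)

lemma le_one [simp]: "a \<in> carrier M \<Longrightarrow> a \<preceq> \<I>"
  by (simp add: mv_le_def)

lemma le_trans:
  assumes "a \<in> carrier M" "b \<in> carrier M" "c \<in> carrier M" "a \<preceq> b" "b \<preceq> c"
  shows "a \<preceq> c"
proof -
  have "c = a \<oplus> ((b \<odot> \<sim> a) \<oplus> (c \<odot> \<sim> b))"
    using assms by (simp add: plus_assoc[symmetric] le_plus_diff)
  then show ?thesis
    using assms by (metis le_plus1 neg_closed plus_closed times_closed)
qed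

lemma le_antisym:
  "a \<in> carrier M \<Longrightarrow> b \<in> carrier M \<Longrightarrow> a \<preceq> b \<Longrightarrow> b \<preceq> a \<Longrightarrow> a = b"
  by (metis le_iff_times le_plus_diff plus_zero)

lemma le_zero: "a \<in> carrier M \<Longrightarrow> a \<preceq> \<O> \<longleftrightarrow> a = \<O>"
  using le_antisym by auto

lemma one_le: "a \<in> carrier M \<Longrightarrow> \<I> \<preceq> a \<longleftrightarrow> a = \<I>"
  using le_antisym by auto

lemma neg_le: "a \<in> carrier M \<Longrightarrow> b \<in> carrier M \<Longrightarrow> \<sim> a \<preceq> \<sim> b \<longleftrightarrow> b \<preceq> a"
  by (simp add: mv_le_def plus_commute)

text \<open>Both sides unfold to \<open>\<sim> a \<oplus> \<sim> b \<oplus> c = 1\<close>. As an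
  adjunction this makes \<open>\<odot>\<close> distribute over joins, and later it moves summands
  across inequalities.\<close>

lemma times_le_iff:
  "a \<in> carrier M \<Longrightarrow> b \<in> carrier M \<Longrightarrow> c \<in> carrier M \<Longrightarrow> a \<odot> b \<preceq> c \<longleftrightarrow> a \<preceq> \<sim> b \<oplus> c"
  by (simp add: mv_le_def neg_times plus_assoc)

lemma plus_mono_right:
  assumes "a \<in> carrier M" "b \<in> carrier M" "c \<in> carrier M" "a \<preceq> b"
  shows "c \<oplus> a \<preceq> c \<oplus> b"
proof -
  have "c \<oplus> b = (c \<oplus> a) \<oplus> (b \<odot> \<sim> a)"
    using assms by (simp add: plus_assoc le_plus_diff)
  then show ?thesis using assms by simp
qed

lemma plus_mono:
  assumes "a \<in> carrier M" "b \<in> carrier M" "c \<in> carrier M" "d \<in> carrier M" "a \<preceq> b" "c \<preceq> d"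
  shows "a \<oplus> c \<preceq> b \<oplus> d"
proof (rule le_trans[of _ "a \<oplus> d"])
  show "a \<oplus> d \<preceq> b \<oplus> d"
    using plus_mono_right[of a b d] assms by (simp add: plus_commute)
qed (use assms plus_mono_right in auto)

lemma times_mono:
  assumes "a \<in> carrier M" "b \<in> carrier M" "c \<in> carrier M" "d \<in> carrier M" "a \<preceq> b" "c \<preceq> d"
  shows "a \<odot> c \<preceq> b \<odot> d"
  unfolding mv_times_def using assms by (simp add: neg_le plus_mono)

lemma times_le1 [simp]: "a \<in> carrier M \<Longrightarrow> b \<in> carrier M \<Longrightarrow> a \<odot> b \<preceq> a"
  using times_mono[of a a b \<I>] by simp

lemma times_le2 [simp]: "a \<in> carrier M \<Longrightarrow> b \<in> carrier M \<Longrightarrow> a \<odot> b \<preceq> b"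
  using times_mono[of a \<I> b b] by simp

section \<open>Lattice operations and distributive laws\<close>

lemma join_commute: "a \<in> carrier M \<Longrightarrow> b \<in> carrier M \<Longrightarrow> a \<^bold>\<or> b = b \<^bold>\<or> a"
  using lukasiewicz[of a b] by (simp add: join_def mv_times_def)

lemma join_ge1 [simp]: "a \<in> carrier M \<Longrightarrow> b \<in> carrier M \<Longrightarrow> a \<preceq> a \<^bold>\<or> b"
  by (subst join_commute) (simp_all add: join_def)

lemma join_ge2 [simp]: "a \<in> carrier M \<Longrightarrow> b \<in> carrier M \<Longrightarrow> b \<preceq> a \<^bold>\<or> b"
  by (simp add: join_def)

lemma join_least:
  assumes "a \<in> carrier M" "b \<in> carrier M" "c \<in> carrier M" "a \<preceq> c" "b \<preceq> c"
  shows "a \<^bold>\<or> b \<preceq> c"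
proof -
  have "a \<^bold>\<or> b \<preceq> (c \<odot> \<sim> b) \<oplus> b"
    unfolding join_def using assms by (simp add: plus_mono times_mono)
  then show ?thesis using assms by (simp add: plus_commute le_plus_diff)
qed

lemma join_le_iff:
  "a \<in> carrier M \<Longrightarrow> b \<in> carrier M \<Longrightarrow> c \<in> carrier M \<Longrightarrow> a \<^bold>\<or> b \<preceq> c \<longleftrightarrow> a \<preceq> c \<and> b \<preceq> c"
  by (meson join_closed join_ge1 join_ge2 join_least le_trans)

lemma le_joinI1:
  "a \<in> carrier M \<Longrightarrow> b \<in> carrier M \<Longrightarrow> c \<in> carrier M \<Longrightarrow> a \<preceq> b \<Longrightarrow> a \<preceq> b \<^bold>\<or> c"
  by (rule le_trans[of a b]) auto

lemma le_joinI2: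
  "a \<in> carrier M \<Longrightarrow> b \<in> carrier M \<Longrightarrow> c \<in> carrier M \<Longrightarrow> a \<preceq> c \<Longrightarrow> a \<preceq> b \<^bold>\<or> c"
  by (rule le_trans[of a c]) auto

lemma le_meet_iff:
  "a \<in> carrier M \<Longrightarrow> b \<in> carrier M \<Longrightarrow> c \<in> carrier M \<Longrightarrow> c \<preceq> a \<^bold>\<and> b \<longleftrightarrow> c \<preceq> a \<and> c \<preceq> b"
  using neg_le[of "\<sim> c" "\<sim> a \<^bold>\<or> \<sim> b"] join_le_iff[of "\<sim> a" "\<sim> b" "\<sim> c"]
  by (simp add: meet_def neg_le)

lemma meet_commute: "a \<in> carrier M \<Longrightarrow> b \<in> carrier M \<Longrightarrow> a \<^bold>\<and> b = b \<^bold>\<and> a"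
  by (simp add: meet_def join_commute)

lemma meet_le1 [simp]: "a \<in> carrier M \<Longrightarrow> b \<in> carrier M \<Longrightarrow> a \<^bold>\<and> b \<preceq> a"
  and meet_le2 [simp]: "a \<in> carrier M \<Longrightarrow> b \<in> carrier M \<Longrightarrow> a \<^bold>\<and> b \<preceq> b"
  using le_meet_iff[of a b "a \<^bold>\<and> b"] by simp_all

lemma meet_absorb: "a \<in> carrier M \<Longrightarrow> b \<in> carrier M \<Longrightarrow> a \<preceq> b \<Longrightarrow> b \<^bold>\<and> a = a"
  by (rule le_antisym) (simp_all add: le_meet_iff)

lemma times_residual: "a \<in> carrier M \<Longrightarrow> b \<in> carrier M \<Longrightarrow> a \<odot> (\<sim> a \<oplus> b) = a \<^bold>\<and> b"
  by (subst meet_commute) (simp_all add: meet_def join_def neg_plus neg_times times_commute plus_commute)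

lemma plus_times_neg: "a \<in> carrier M \<Longrightarrow> b \<in> carrier M \<Longrightarrow> (a \<oplus> b) \<odot> \<sim> a = b \<^bold>\<and> \<sim> a"
  using times_residual[of "\<sim> a" b] by (simp add: times_commute meet_commute)

lemma neg_plus_times: "a \<in> carrier M \<Longrightarrow> b \<in> carrier M \<Longrightarrow> \<sim> a \<oplus> (a \<odot> b) = \<sim> a \<^bold>\<or> b"
  by (subst join_commute) (simp_all add: join_def plus_commute times_commute)

lemma plus_diff: "a \<in> carrier M \<Longrightarrow> b \<in> carrier M \<Longrightarrow> a \<oplus> (b \<odot> \<sim> a) = a \<^bold>\<or> b"
  by (subst join_commute) (simp_all add: join_def plus_commute)

text \<open>In a lattice-ordered group with unit \<open>u\<close>, \<open>a \<odot> b\<close> is the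
  positive part of \<open>a - (u - b)\<close>, the excess of \<open>a\<close> over
  \<open>\<sim> b\<close>. The later carry computations split elements in this way into a part that
  fits and an overflow.\<close>

lemma meet_plus_times:
  assumes "a \<in> carrier M" "b \<in> carrier M"
  shows "(a \<^bold>\<and> \<sim> b) \<oplus> (a \<odot> b) = a"
proof -
  have "\<sim> (a \<^bold>\<and> \<sim> b) = \<sim> a \<oplus> (a \<odot> b)"
    using assms neg_plus_times[of a b] by (simp add: meet_def)
  then have "a \<odot> \<sim> (a \<^bold>\<and> \<sim> b) = a \<odot> b"
    using assms times_residual[of a "a \<odot> b"] by (simp add: meet_absorb)
  then have "a \<odot> b = a \<odot> \<sim> (a \<^bold>\<and> \<sim> b)" ..
  then show ?thesis
    using assms by (simp add: le_plus_diff)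
qed

lemma plus_meet_neg: "a \<in> carrier M \<Longrightarrow> b \<in> carrier M \<Longrightarrow> a \<oplus> (b \<^bold>\<and> \<sim> a) = a \<oplus> b"
  by (metis le_plus1 le_plus_diff plus_closed plus_times_neg)

lemma times_join_distrib:
  assumes "a \<in> carrier M" "b \<in> carrier M" "c \<in> carrier M"
  shows "a \<odot> (b \<^bold>\<or> c) = (a \<odot> b) \<^bold>\<or> (a \<odot> c)"
proof (rule le_antisym)
  have "b \<preceq> \<sim> a \<oplus> ((a \<odot> b) \<^bold>\<or> (a \<odot> c))" "c \<preceq> \<sim> a \<oplus> ((a \<odot> b) \<^bold>\<or> (a \<odot> c))"
    using assms by (simp_all add: times_le_iff[symmetric] times_commute[of _ a])
  then show "a \<odot> (b \<^bold>\<or> c) \<preceq> (a \<odot> b) \<^bold>\<or> (a \<odot> c)"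
    using assms by (simp add: times_commute[of a "b \<^bold>\<or> c"] times_le_iff join_le_iff)
qed (use assms in \<open>simp_all add: join_le_iff times_mono\<close>)

lemma plus_meet_distrib:
  assumes "a \<in> carrier M" "b \<in> carrier M" "c \<in> carrier M"
  shows "a \<oplus> (b \<^bold>\<and> c) = (a \<oplus> b) \<^bold>\<and> (a \<oplus> c)"
  using arg_cong[OF times_join_distrib[of "\<sim> a" "\<sim> b" "\<sim> c"], of "mv_neg M"] assms
  by (simp add: meet_def mv_times_def)

text \<open>By \<open>times_residual\<close> a meet is a product with a residual, and products
  distribute over joins. The residual \<open>?d\<close> of the join lies below those of
  \<open>a\<close> and \<open>b\<close>, so each product stays below the corresponding meet.\<close>

lemma meet_join_le:
  assumes "a \<in> carrier M" "b \<in> carrier M" "c \<in> carrier M"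
  shows "(a \<^bold>\<or> b) \<^bold>\<and> c \<preceq> (a \<^bold>\<and> c) \<^bold>\<or> (b \<^bold>\<and> c)"
proof -
  let ?d = "\<sim> (a \<^bold>\<or> b) \<oplus> c"
  have *: "a \<odot> ?d \<preceq> a \<^bold>\<and> c" "b \<odot> ?d \<preceq> b \<^bold>\<and> c"
    using assms by (simp_all add: times_residual[symmetric] times_mono plus_mono neg_le)
  have "(a \<^bold>\<or> b) \<^bold>\<and> c = (a \<odot> ?d) \<^bold>\<or> (b \<odot> ?d)"
    using assms by (simp add: times_residual[symmetric] times_commute[of _ ?d] times_join_distrib)
  moreover have "a \<odot> ?d \<preceq> (a \<^bold>\<and> c) \<^bold>\<or> (b \<^bold>\<and> c)" "b \<odot> ?d \<preceq> (a \<^bold>\<and> c) \<^bold>\<or> (b \<^bold>\<and> c)"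
    using assms * by (simp_all add: le_joinI1 le_joinI2)
  ultimately show ?thesis using assms by (simp add: join_le_iff)
qed

text \<open>Adjointness handles \<open>\<oplus>\<close> and meets only. For joins,
  \<open>a \<oplus> x\<close> depends just on the part \<open>x \<and> \<sim> a\<close> that fits on
  top of \<open>a\<close>, and the claim reduces to distributivity of the lattice.\<close>

lemma plus_join_distrib:
  assumes "a \<in> carrier M" "b \<in> carrier M" "c \<in> carrier M"
  shows "a \<oplus> (b \<^bold>\<or> c) = (a \<oplus> b) \<^bold>\<or> (a \<oplus> c)"
proof (rule le_antisym)
  let ?w = "(a \<oplus> b) \<^bold>\<or> (a \<oplus> c)"
  have "a \<preceq> ?w"
    using assms by (simp add: le_joinI1)
  then have "?w = a \<oplus> (?w \<odot> \<sim> a)"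
    using assms by (simp add: le_plus_diff)
  also have "?w \<odot> \<sim> a = (b \<^bold>\<and> \<sim> a) \<^bold>\<or> (c \<^bold>\<and> \<sim> a)"
    using assms by (simp add: times_commute[of _ "\<sim> a"] times_join_distrib)
      (simp add: times_commute[of "\<sim> a"] plus_times_neg)
  finally have w: "?w = a \<oplus> ((b \<^bold>\<and> \<sim> a) \<^bold>\<or> (c \<^bold>\<and> \<sim> a))" .
  have "a \<oplus> (b \<^bold>\<or> c) = a \<oplus> ((b \<^bold>\<or> c) \<^bold>\<and> \<sim> a)"
    using assms by (simp add: plus_meet_neg)
  also have "\<dots> \<preceq> ?w"
    unfolding w using assms by (intro plus_mono_right meet_join_le) auto
  finally show "a \<oplus> (b \<^bold>\<or> c) \<preceq> ?w" .
qed (use assms in \<open>simp_all add: join_le_iff plus_mono_right\<close>)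

text \<open>The counterpart of disjoint positive and negative parts in a group. Since
  \<open>a \<and> b\<close> plus the one difference is \<open>a\<close> and plus the other is
  \<open>b\<close>, adding the meet \<open>t\<close> of the differences to \<open>a \<and> b\<close>
  changes nothing; as \<open>t\<close> lies below \<open>\<sim> (a \<and> b)\<close>, nothing was
  truncated and \<open>t\<close> vanishes.\<close>

lemma diff_meet_diff:
  assumes "a \<in> carrier M" "b \<in> carrier M"
  shows "(a \<odot> \<sim> b) \<^bold>\<and> (b \<odot> \<sim> a) = \<O>"
proof -
  define m where "m = a \<^bold>\<and> b"
  define t where "t = (a \<odot> \<sim> b) \<^bold>\<and> (b \<odot> \<sim> a)"
  have cl: "m \<in> carrier M" "t \<in> carrier M"
    using assms by (auto simp: m_def t_def)
  have "m \<oplus> t = (m \<oplus> (a \<odot> \<sim> b)) \<^bold>\<and> (m \<oplus> (b \<odot> \<sim> a))"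
    using assms cl by (simp add: t_def plus_meet_distrib)
  also have "m \<oplus> (a \<odot> \<sim> b) = a"
    using assms meet_plus_times[of a "\<sim> b"] by (simp add: m_def)
  also have "m \<oplus> (b \<odot> \<sim> a) = b"
    using assms meet_plus_times[of b "\<sim> a"] by (simp add: m_def meet_commute)
  finally have mt: "m \<oplus> t = m" by (simp add: m_def)
  have "t \<preceq> a \<odot> \<sim> b" "a \<odot> \<sim> b \<preceq> \<sim> b" "\<sim> b \<preceq> \<sim> m"
    using assms by (simp_all add: t_def m_def neg_le)
  then have "t \<preceq> \<sim> m"
    using assms cl by (meson le_trans neg_closed times_closed)
  then have "t = t \<^bold>\<and> \<sim> m"
    using cl meet_absorb[of t "\<sim> m"] meet_commute[of t "\<sim> m"] by simp
  also have "\<dots> = \<O>"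
    using cl mt by (simp add: plus_times_neg[symmetric])
  finally show ?thesis by (simp add: t_def)
qed

section \<open>Good pairs and the carry of a sum\<close>

text \<open>A pair with \<open>p \<oplus> q = p\<close> is called good; in an MV-chain it means \<open>p = 1\<close> or \<open>q = 0\<close>.\<close>

lemma good_iff_meet:
  "p \<in> carrier M \<Longrightarrow> q \<in> carrier M \<Longrightarrow> p \<oplus> q = p \<longleftrightarrow> q \<^bold>\<and> \<sim> p = \<O>"
  by (metis plus_meet_neg plus_times_neg plus_zero times_neg_self)

text \<open>Goodness is the condition \<open>q \<and> \<sim> p = 0\<close>, which is unchanged when
  \<open>(p, q)\<close> becomes \<open>(\<sim> q, \<sim> p)\<close>. This duality exchanges the two
  equations.\<close>

lemma good_iff_times:
  assumes "p \<in> carrier M" "q \<in> carrier M"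
  shows "p \<oplus> q = p \<longleftrightarrow> p \<odot> q = q"
proof -
  have "p \<odot> q = q \<longleftrightarrow> \<sim> (p \<odot> q) = \<sim> q"
    using assms by (simp add: neg_inject)
  also have "\<dots> \<longleftrightarrow> \<sim> q \<oplus> \<sim> p = \<sim> q"
    using assms by (simp add: neg_times plus_commute)
  also have "\<dots> \<longleftrightarrow> \<sim> p \<^bold>\<and> q = \<O>"
    using assms by (simp add: good_iff_meet)
  finally show ?thesis using assms by (simp add: good_iff_meet meet_commute)
qed

text \<open>This is \<open>diff_meet_diff\<close> for \<open>a\<close> and \<open>\<sim> b\<close>.
  The pair \<open>(a \<oplus> b, a \<odot> b)\<close> represents the sum of \<open>a\<close> and
  \<open>b\<close> in the group.\<close>

lemma plus_times_good:
  assumes "a \<in> carrier M" "b \<in> carrier M"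
  shows "a \<oplus> b \<oplus> (a \<odot> b) = a \<oplus> b"
  using assms diff_meet_diff[of a "\<sim> b"]
  by (simp add: good_iff_meet neg_plus times_commute[of "\<sim> b"])

text \<open>In a chain both sides are \<open>q \<oplus> b\<close> if \<open>p = 1\<close>, and
  \<open>p \<odot> b\<close> if \<open>q = 0\<close>. The law writes an entry of
  \<open>x + b\<close> as a product, so that its factors can be regrouped.\<close>

lemma good_exchange:
  assumes "p \<in> carrier M" "q \<in> carrier M" "b \<in> carrier M" and good: "p \<oplus> q = p"
  shows "q \<oplus> (p \<odot> b) = p \<odot> (q \<oplus> b)"
proof (rule le_antisym)
  let ?x = "q \<oplus> (p \<odot> b)"
  have pq: "p \<odot> q = q"
    using assms by (simp add: good_iff_times)
  have "?x \<preceq> q \<oplus> p"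
    using assms by (simp add: plus_mono)
  then have "?x \<preceq> p"
    using assms by (simp add: plus_commute)
  \<comment> \<open>An element below \<open>p\<close> is \<open>p\<close> times its residual.
    Expanding the residual as a join leaves two products, both below the right side.\<close>
  then have "?x = p \<odot> (\<sim> p \<oplus> ?x)"
    using assms by (simp add: times_residual meet_absorb)
  also have "\<sim> p \<oplus> ?x = q \<oplus> (\<sim> p \<^bold>\<or> b)"
    using assms by (simp add: plus_left_commute neg_plus_times)
  also have "p \<odot> \<dots> = (p \<odot> (\<sim> p \<oplus> q)) \<^bold>\<or> (p \<odot> (q \<oplus> b))"
    using assms by (simp add: plus_join_distrib times_join_distrib plus_commute[of q "\<sim> p"])
  also have "p \<odot> (\<sim> p \<oplus> q) = p \<odot> q"
    using assms le_antisym[of "p \<^bold>\<and> q" q] by (metis le_meet_iff le_refl meet_le2 meet_closed pq times_le1 times_residual)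
  also have "(p \<odot> q) \<^bold>\<or> (p \<odot> (q \<oplus> b)) \<preceq> p \<odot> (q \<oplus> b)"
    using assms by (simp add: join_le_iff times_mono)
  finally show "?x \<preceq> p \<odot> (q \<oplus> b)" .
  have "p \<odot> (q \<oplus> b) \<odot> \<sim> q = p \<odot> (b \<^bold>\<and> \<sim> q)"
    using assms by (simp add: times_assoc plus_times_neg)
  also have "\<dots> \<preceq> p \<odot> b"
    using assms by (simp add: times_mono)
  finally show "p \<odot> (q \<oplus> b) \<preceq> ?x"
    using assms by (simp add: times_le_iff)
qed (use assms in auto)

text \<open>Since \<open>c \<preceq> \<sim> p\<close>, adding \<open>c\<close> to \<open>p\<close>
  does not overflow, and the carry of \<open>p + c + b\<close> arises only from adding
  \<open>b\<close>. The left side is the carry obtained when \<open>b\<close> is added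
  first.\<close>

lemma carry_le_of_orthogonal:
  assumes cl: "p \<in> carrier M" "b \<in> carrier M" "c \<in> carrier M" and cp: "c \<preceq> \<sim> p"
  shows "(p \<odot> b) \<oplus> ((p \<oplus> b) \<odot> c) \<preceq> (p \<oplus> c) \<odot> b"
proof -
  define x where "x = (p \<odot> b) \<oplus> ((p \<oplus> b) \<odot> c)"
  have xc: "x \<in> carrier M" using cl by (simp add: x_def)
  have x: "x = (p \<oplus> b) \<odot> ((p \<odot> b) \<oplus> c)"
    unfolding x_def using cl by (simp add: good_exchange plus_times_good)
  \<comment> \<open>The hypothesis on \<open>c\<close> enters here: replacing \<open>c\<close> by
    \<open>\<sim> p\<close> shows \<open>x \<preceq> b\<close>, so that \<open>x\<close> is
    \<open>b\<close> times its residual.\<close>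
  have "(p \<odot> b) \<oplus> c \<preceq> (p \<odot> b) \<oplus> \<sim> p"
    using cl cp by (simp add: plus_mono)
  also have "\<dots> = b \<oplus> (\<sim> p \<odot> \<sim> b)"
    using cl by (simp add: plus_commute[of "p \<odot> b"] neg_plus_times plus_diff join_commute)
  finally have "x \<preceq> b"
    unfolding x using cl
    by (simp add: times_commute[of "p \<oplus> b"] times_le_iff neg_plus plus_commute[of b])
  then have "x = b \<odot> (\<sim> b \<oplus> x)"
    using cl xc by (simp add: times_residual meet_absorb)
  also have "\<sim> b \<oplus> x = (\<sim> b \<^bold>\<or> p) \<oplus> ((p \<oplus> b) \<odot> c)"
    using cl by (simp add: x_def plus_assoc[symmetric] times_commute[of p b] neg_plus_times)
  also have "\<dots> = (\<sim> b \<oplus> ((p \<oplus> b) \<odot> c)) \<^bold>\<or> (p \<oplus> ((p \<oplus> b) \<odot> c))"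
    using cl by (simp add: plus_commute[of _ "(p \<oplus> b) \<odot> c"] plus_join_distrib)
  finally have x2: "x = b \<odot> ((\<sim> b \<oplus> ((p \<oplus> b) \<odot> c)) \<^bold>\<or> (p \<oplus> ((p \<oplus> b) \<odot> c)))" .
  \<comment> \<open>\<open>r\<close> is the negation of \<open>p \<oplus> b\<close>, so multiplying
    \<open>c\<close> by \<open>p \<oplus> b\<close> subtracts \<open>r\<close>. As \<open>n\<close>
    splits into \<open>n \<and> p\<close> and \<open>r\<close>, adding that difference turns
    \<open>r\<close> into the join of \<open>r\<close> and \<open>c\<close>.\<close>
  define n where "n = \<sim> b"
  define r where "r = n \<odot> \<sim> p"
  have nr: "n \<in> carrier M" "r \<in> carrier M" using cl by (auto simp: n_def r_def)
  have "(p \<oplus> b) \<odot> c = c \<odot> \<sim> r"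
    using cl by (simp add: n_def r_def neg_times times_commute plus_commute)
  then have "\<sim> b \<oplus> ((p \<oplus> b) \<odot> c) = (n \<^bold>\<and> p) \<oplus> (r \<oplus> (c \<odot> \<sim> r))"
    using cl nr meet_plus_times[of n "\<sim> p"]
    by (simp add: plus_assoc[symmetric] r_def[symmetric] n_def[symmetric])
  also have "\<dots> = ((n \<^bold>\<and> p) \<oplus> r) \<^bold>\<or> ((n \<^bold>\<and> p) \<oplus> c)"
    using cl nr by (simp add: plus_diff plus_join_distrib)
  also have "(n \<^bold>\<and> p) \<oplus> r = n"
    using cl nr meet_plus_times[of n "\<sim> p"] by (simp add: r_def)
  also have "n \<^bold>\<or> ((n \<^bold>\<and> p) \<oplus> c) \<preceq> n \<^bold>\<or> (p \<oplus> c)"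
  proof -
    have "(n \<^bold>\<and> p) \<oplus> c \<preceq> p \<oplus> c"
      using cl nr by (simp add: plus_mono)
    then have "(n \<^bold>\<and> p) \<oplus> c \<preceq> n \<^bold>\<or> (p \<oplus> c)"
      using cl nr by (simp add: le_joinI2)
    then show ?thesis using cl nr by (simp add: join_le_iff)
  qed
  finally have 1: "\<sim> b \<oplus> ((p \<oplus> b) \<odot> c) \<preceq> n \<^bold>\<or> (p \<oplus> c)" .
  have "p \<oplus> ((p \<oplus> b) \<odot> c) \<preceq> p \<oplus> c"
    using cl by (simp add: plus_mono)
  then have 2: "p \<oplus> ((p \<oplus> b) \<odot> c) \<preceq> n \<^bold>\<or> (p \<oplus> c)"
    using cl nr by (simp add: le_joinI2)
  \<comment> \<open>The joinand \<open>n = \<sim> b\<close> is annihilated by \<open>b\<close>,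
    which leaves the wanted product.\<close>
  have "x \<preceq> b \<odot> (n \<^bold>\<or> (p \<oplus> c))"
    unfolding x2 using cl nr 1 2 by (simp add: times_mono join_le_iff)
  also have "\<dots> = \<O> \<^bold>\<or> b \<odot> (p \<oplus> c)"
    using cl nr by (simp add: times_join_distrib) (simp add: n_def)
  also have "\<dots> = (p \<oplus> c) \<odot> b"
    using cl by (simp add: join_def times_commute)
  finally show ?thesis by (simp add: x_def)
qed

text \<open>
  In a lattice-ordered group, \<open>(p \<odot> b) \<oplus> ((p \<oplus> b) \<odot> c)\<close> is the second entry of the good
  sequence of \<open>p + b + c\<close>.
\<close>

lemma carry_le:
  assumes cl: "p \<in> carrier M" "b \<in> carrier M" "c \<in> carrier M"
  shows "(p \<odot> b) \<oplus> ((p \<oplus> b) \<odot> c) \<preceq> (p \<odot> c) \<oplus> ((p \<oplus> c) \<odot> b)"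
proof -
  \<comment> \<open>Only the part \<open>c1\<close> of \<open>c\<close> fits on top of
    \<open>p\<close>. It falls under the orthogonal case and leaves \<open>p \<oplus> c\<close>
    unchanged, while the rest \<open>p \<odot> c\<close> is already a summand of
    \<open>w\<close>.\<close>
  define c1 where "c1 = c \<^bold>\<and> \<sim> p"
  define r where "r = \<sim> (p \<oplus> b)"
  define w where "w = (p \<odot> c) \<oplus> ((p \<oplus> c) \<odot> b)"
  have cl': "c1 \<in> carrier M" "r \<in> carrier M" "w \<in> carrier M"
    using cl by (auto simp: c1_def r_def w_def)
  have pc: "p \<oplus> c1 = p \<oplus> c"
    using cl by (simp add: c1_def plus_meet_neg)
  have c: "c1 \<oplus> (p \<odot> c) = c"
    using cl meet_plus_times[of c p] by (simp add: c1_def times_commute)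
  have "(p \<odot> b) \<oplus> ((p \<oplus> b) \<odot> c1) \<preceq> (p \<oplus> c) \<odot> b"
    using carry_le_of_orthogonal[of p b c1] cl cl' by (simp add: pc) (simp add: c1_def)
  then have "(p \<odot> c) \<oplus> ((p \<odot> b) \<oplus> (c1 \<odot> \<sim> r)) \<preceq> w"
    using cl cl' by (simp add: w_def r_def plus_mono times_commute)
  \<comment> \<open>Adding \<open>r\<close> completes the truncated difference to the join of
    \<open>c1\<close> and \<open>r\<close>, which is above \<open>c1\<close>;
    \<open>times_le_iff\<close> then turns the \<open>r\<close> on the right into the factor
    \<open>p \<oplus> b\<close> on the left.\<close>
  then have "(p \<odot> c) \<oplus> ((p \<odot> b) \<oplus> (c1 \<odot> \<sim> r)) \<oplus> r \<preceq> w \<oplus> r"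
    using cl cl' by (simp add: plus_mono)
  also have "(p \<odot> c) \<oplus> ((p \<odot> b) \<oplus> (c1 \<odot> \<sim> r)) \<oplus> r = (p \<odot> c) \<oplus> (p \<odot> b) \<oplus> (c1 \<^bold>\<or> r)"
    using cl cl' by (simp add: plus_assoc join_def)
  finally have 1: "(p \<odot> c) \<oplus> (p \<odot> b) \<oplus> (c1 \<^bold>\<or> r) \<preceq> w \<oplus> r" .
  have "(p \<odot> b) \<oplus> c = (p \<odot> c) \<oplus> (p \<odot> b) \<oplus> c1"
    using cl cl' by (subst c[symmetric]) (simp add: plus_ac)
  also have "\<dots> \<preceq> (p \<odot> c) \<oplus> (p \<odot> b) \<oplus> (c1 \<^bold>\<or> r)"
    using cl cl' by (simp add: plus_mono)
  finally have "(p \<odot> b) \<oplus> c \<preceq> w \<oplus> r"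
    using 1 cl cl' by (auto elim: le_trans[rotated 4])
  then have "((p \<odot> b) \<oplus> c) \<odot> (p \<oplus> b) \<preceq> w"
    using cl cl' by (simp add: times_le_iff r_def plus_commute)
  moreover have "(p \<odot> b) \<oplus> ((p \<oplus> b) \<odot> c) = (p \<oplus> b) \<odot> ((p \<odot> b) \<oplus> c)"
    using cl by (simp add: good_exchange plus_times_good)
  ultimately show ?thesis
    using cl by (simp add: w_def times_commute[of "(p \<odot> b) \<oplus> c"])
qed

lemma carry_commute:
  assumes "p \<in> carrier M" "b \<in> carrier M" "c \<in> carrier M"
  shows "(p \<odot> b) \<oplus> ((p \<oplus> b) \<odot> c) = (p \<odot> c) \<oplus> ((p \<oplus> c) \<odot> b)"
  using assms by (intro le_antisym carry_le) auto

end

section \<open>The monoid of good sequences\<close>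

context mv_algebra
begin

section \<open>Adding one element to a good sequence\<close>

definition shift :: "(nat \<Rightarrow> 'a) \<Rightarrow> nat \<Rightarrow> 'a" where
  "shift x i = (case i of 0 \<Rightarrow> \<I> | Suc j \<Rightarrow> x j)"

definition add_elt :: "'a \<Rightarrow> (nat \<Rightarrow> 'a) \<Rightarrow> nat \<Rightarrow> 'a" where
  "add_elt b x i = x i \<oplus> (shift x i \<odot> b)"

primrec add_elts :: "(nat \<Rightarrow> 'a) \<Rightarrow> (nat \<Rightarrow> 'a) \<Rightarrow> nat \<Rightarrow> nat \<Rightarrow> 'a" where
  "add_elts a b 0 = a"
| "add_elts a b (Suc k) = add_elt (b k) (add_elts a b k)"

lemma shift_0 [simp]: "shift x 0 = \<I>"
  and shift_Suc [simp]: "shift x (Suc i) = x i"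
  by (simp_all add: shift_def)

lemma good_seqs_closed [simp]: "x \<in> good_seqs M \<Longrightarrow> x i \<in> carrier M"
  unfolding good_seqs_def by blast

lemma good_seqs_good: "x \<in> good_seqs M \<Longrightarrow> x i \<oplus> x (Suc i) = x i"
  unfolding good_seqs_def by blast

lemma good_seqs_support: "x \<in> good_seqs M \<Longrightarrow> \<exists>n. \<forall>i\<ge>n. x i = \<O>"
  unfolding good_seqs_def by blast

lemma good_seqsI:
  "(\<And>i. x i \<in> carrier M) \<Longrightarrow> (\<And>i. x i \<oplus> x (Suc i) = x i) \<Longrightarrow> \<forall>i\<ge>n. x i = \<O> \<Longrightarrow> x \<in> good_seqs M"
  unfolding good_seqs_def by blast

lemma shift_closed [simp]: "x \<in> good_seqs M \<Longrightarrow> shift x i \<in> carrier M"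
  by (cases i) auto

lemma shift_plus [simp]: "x \<in> good_seqs M \<Longrightarrow> shift x i \<oplus> x i = shift x i"
  by (cases i) (auto simp: good_seqs_good)

lemma shift_good [simp]:
  assumes "x \<in> good_seqs M"
  shows "shift x \<in> good_seqs M"
proof -
  obtain n where "\<forall>i\<ge>n. x i = \<O>"
    using good_seqs_support[OF assms] by blast
  then have "\<forall>i\<ge>Suc n. shift x i = \<O>"
    by (auto simp: shift_def split: nat.split)
  then show ?thesis
    by (rule good_seqsI[rotated 2]) (use assms in auto)
qed

lemma add_elt_good [simp]:
  assumes x: "x \<in> good_seqs M" and b: "b \<in> carrier M"
  shows "add_elt b x \<in> good_seqs M"
proof -
  have "add_elt b x i \<oplus> add_elt b x (Suc i) = add_elt b x i" for i
  proof -
    let ?p = "shift x i" and ?q = "x i" and ?r = "x (Suc i)"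
    have cl: "?p \<in> carrier M" "?q \<in> carrier M" "?r \<in> carrier M"
      using x by auto
    \<comment> \<open>\<open>?p\<close> can be inserted because \<open>(?p, ?q)\<close> is good. The
      outgoing carry is then the product of the summands \<open>?q\<close> and
      \<open>?p \<odot> b\<close>, and their sum absorbs it.\<close>
    have qb: "?q \<odot> b = ?q \<odot> (?p \<odot> b)"
      using x b cl good_iff_times[of ?p ?q]
      by (simp add: times_assoc[symmetric] times_commute[of ?q ?p])
    have "add_elt b x i \<oplus> add_elt b x (Suc i) = (?q \<oplus> ?r) \<oplus> (?p \<odot> b) \<oplus> (?q \<odot> b)"
      using cl b by (simp add: add_elt_def plus_ac)
    also have "\<dots> = ?q \<oplus> (?p \<odot> b)"
      using x cl b by (simp add: good_seqs_good qb plus_times_good)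
    finally show ?thesis by (simp add: add_elt_def)
  qed
  moreover obtain n where "\<forall>i\<ge>n. x i = \<O>"
    using good_seqs_support[OF x] by blast
  \<comment> \<open>Entry \<open>n\<close> may still receive a carry from entry
    \<open>n - 1\<close>, so the bound grows by one.\<close>
  then have "\<forall>i\<ge>Suc n. add_elt b x i = \<O>"
    using b by (auto simp: add_elt_def shift_def split: nat.split)
  ultimately show ?thesis
    by (intro good_seqsI[of _ "Suc n"]) (use x b in \<open>auto simp: add_elt_def[of b x]\<close>)
qed

lemma shift_add_elt:
  "x \<in> good_seqs M \<Longrightarrow> b \<in> carrier M \<Longrightarrow> shift (add_elt b x) = add_elt b (shift x)"
  by (rule ext, rename_tac i, case_tac i) (auto simp: add_elt_def)

lemma add_elt_commute:
  assumes x: "x \<in> good_seqs M" and b: "b \<in> carrier M" and c: "c \<in> carrier M"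
  shows "add_elt b (add_elt c x) = add_elt c (add_elt b x)"
proof
  fix i
  let ?o = "shift (shift x) i" and ?p = "shift x i" and ?q = "x i"
  have cl: "?o \<in> carrier M" "?p \<in> carrier M" "?q \<in> carrier M"
    using x by auto
  have po: "?p \<odot> (?o \<odot> d) = ?p \<odot> d" if "d \<in> carrier M" for d
    using x cl that good_iff_times[of ?o ?p]
    by (simp add: times_assoc[symmetric] times_commute[of ?p ?o])
  \<comment> \<open>\<open>good_exchange\<close> for \<open>(?o, ?p)\<close> moves the factor
    \<open>?o\<close> from \<open>b\<close> to \<open>c\<close>. The claim becomes
    \<open>carry_commute\<close> for \<open>b\<close> and \<open>?o \<odot> c\<close>, and
    \<open>po\<close> removes \<open>?o\<close> again.\<close>
  have sym: "(?p \<odot> b) \<oplus> ((?p \<oplus> (?o \<odot> b)) \<odot> c) = (?p \<odot> c) \<oplus> ((?p \<oplus> (?o \<odot> c)) \<odot> b)"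
  proof -
    have "(?p \<oplus> (?o \<odot> b)) \<odot> c = (?p \<oplus> b) \<odot> (?o \<odot> c)"
      using x cl b c by (simp add: good_exchange) (simp add: times_ac)
    then show ?thesis
      using carry_commute[of ?p b "?o \<odot> c"] cl b c by (simp add: po)
  qed
  have "add_elt b (add_elt c x) i = ?q \<oplus> ((?p \<odot> c) \<oplus> ((?p \<oplus> (?o \<odot> c)) \<odot> b))"
    using x b c cl by (simp add: add_elt_def[of b] shift_add_elt)
      (simp add: add_elt_def plus_assoc)
  also have "\<dots> = ?q \<oplus> ((?p \<odot> b) \<oplus> ((?p \<oplus> (?o \<odot> b)) \<odot> c))"
    by (simp add: sym)
  also have "\<dots> = add_elt c (add_elt b x) i"
    using x b c cl by (simp add: add_elt_def[of c] shift_add_elt)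
      (simp add: add_elt_def plus_assoc)
  finally show "add_elt b (add_elt c x) i = add_elt c (add_elt b x) i" .
qed

text \<open>If \<open>p\<close> is the preceding entry, adding \<open>b\<close> and then
  \<open>\<sim> b\<close> brings in the carries \<open>p \<odot> b\<close> and
  \<open>p \<and> \<sim> b\<close>. By \<open>meet_plus_times\<close> they add up to
  \<open>p\<close>, which absorbs the old entry.\<close>

lemma add_elt_neg:
  assumes x: "x \<in> good_seqs M" and b: "b \<in> carrier M"
  shows "add_elt (\<sim> b) (add_elt b x) = shift x"
proof
  fix i
  let ?o = "shift (shift x) i" and ?p = "shift x i" and ?q = "x i"
  have cl: "?o \<in> carrier M" "?p \<in> carrier M" "?q \<in> carrier M"
    using x by auto
  have op: "?o \<oplus> (?p \<^bold>\<and> \<sim> b) = ?o"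
  proof (rule le_antisym)
    have "?o \<oplus> (?p \<^bold>\<and> \<sim> b) \<preceq> ?o \<oplus> ?p"
      using cl b by (simp add: plus_mono)
    then show "?o \<oplus> (?p \<^bold>\<and> \<sim> b) \<preceq> ?o" using x by simp
  qed (use cl b in auto)
  have "(?p \<oplus> (?o \<odot> b)) \<odot> \<sim> b = ?o \<odot> ((?p \<oplus> b) \<odot> \<sim> b)"
    using x cl b by (simp add: good_exchange times_assoc)
  also have "(?p \<oplus> b) \<odot> \<sim> b = ?p \<^bold>\<and> \<sim> b"
    using cl b plus_times_neg[of b ?p] by (simp add: plus_commute)
  also have "?o \<odot> \<dots> = ?p \<^bold>\<and> \<sim> b"
    using op cl b by (simp add: good_iff_times)
  finally have *: "(?p \<oplus> (?o \<odot> b)) \<odot> \<sim> b = ?p \<^bold>\<and> \<sim> b" .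
  have "add_elt (\<sim> b) (add_elt b x) i = ?q \<oplus> (?p \<odot> b) \<oplus> ((?p \<oplus> (?o \<odot> b)) \<odot> \<sim> b)"
    using x b by (simp add: add_elt_def[of "\<sim> b"] shift_add_elt) (simp add: add_elt_def)
  also have "\<dots> = ?q \<oplus> ((?p \<^bold>\<and> \<sim> b) \<oplus> (?p \<odot> b))"
    using cl b by (simp add: * plus_ac)
  also have "\<dots> = ?p"
    using x cl b by (simp add: meet_plus_times plus_commute[of ?q])
  finally show "add_elt (\<sim> b) (add_elt b x) i = ?p" .
qed

lemma add_elt_mono:
  "x \<in> good_seqs M \<Longrightarrow> y \<in> good_seqs M \<Longrightarrow> b \<in> carrier M \<Longrightarrow> gs_le M x y \<Longrightarrow>
    gs_le M (add_elt b x) (add_elt b y)"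
  unfolding gs_le_def by (auto simp: add_elt_def shift_def split: nat.split intro!: plus_mono times_mono)

lemma add_elt_le_iff:
  assumes x: "x \<in> good_seqs M" and y: "y \<in> good_seqs M" and b: "b \<in> carrier M"
  shows "gs_le M (add_elt b x) (add_elt b y) \<longleftrightarrow> gs_le M x y"
proof
  assume "gs_le M (add_elt b x) (add_elt b y)"
  then have "gs_le M (shift x) (shift y)"
    using add_elt_mono[of "add_elt b x" "add_elt b y" "\<sim> b"] x y b by (simp add: add_elt_neg)
  then show "gs_le M x y"
    unfolding gs_le_def by (metis shift_Suc)
qed (use add_elt_mono x y b in blast)

lemma gs_le_refl: "x \<in> good_seqs M \<Longrightarrow> gs_le M x x"
  by (simp add: gs_le_def)

lemma gs_le_trans:
  "x \<in> good_seqs M \<Longrightarrow> y \<in> good_seqs M \<Longrightarrow> z \<in> good_seqs M \<Longrightarrow>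
    gs_le M x y \<Longrightarrow> gs_le M y z \<Longrightarrow> gs_le M x z"
  unfolding gs_le_def by (meson good_seqs_closed le_trans)

lemma gs_le_antisym:
  "x \<in> good_seqs M \<Longrightarrow> y \<in> good_seqs M \<Longrightarrow> gs_le M x y \<Longrightarrow> gs_le M y x \<Longrightarrow> x = y"
  unfolding gs_le_def by (meson ext good_seqs_closed le_antisym)

lemma add_elt_zero [simp]: "x \<in> good_seqs M \<Longrightarrow> add_elt \<O> x = x"
  by (auto simp: add_elt_def)

section \<open>Adding a sequence entry by entry, and the explicit sum\<close>

lemma add_elts_good [simp]:
  "a \<in> good_seqs M \<Longrightarrow> b \<in> good_seqs M \<Longrightarrow> add_elts a b k \<in> good_seqs M"
  by (induction k) auto

lemma shift_add_elts:
  "a \<in> good_seqs M \<Longrightarrow> b \<in> good_seqs M \<Longrightarrow> shift (add_elts a b k) = add_elts (shift a) b k"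
  by (induction k) (auto simp: shift_add_elt)

lemma add_elts_add_elt:
  "a \<in> good_seqs M \<Longrightarrow> b \<in> good_seqs M \<Longrightarrow> c \<in> carrier M \<Longrightarrow>
    add_elts (add_elt c a) b k = add_elt c (add_elts a b k)"
  by (induction k) (auto simp: add_elt_commute)

lemma add_elts_commute:
  "a \<in> good_seqs M \<Longrightarrow> b \<in> good_seqs M \<Longrightarrow> c \<in> good_seqs M \<Longrightarrow>
    add_elts (add_elts a b k) c l = add_elts (add_elts a c l) b k"
  by (induction k) (auto simp: add_elts_add_elt)

lemma add_elts_le_iff:
  "a \<in> good_seqs M \<Longrightarrow> b \<in> good_seqs M \<Longrightarrow> c \<in> good_seqs M \<Longrightarrow>
    gs_le M (add_elts a c k) (add_elts b c k) \<longleftrightarrow> gs_le M a b"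
  by (induction k) (auto simp: add_elt_le_iff)

lemma good_seqs_absorb:
  assumes b: "b \<in> good_seqs M" and "i < k"
  shows "b i \<oplus> b k = b i"
proof -
  have "b (Suc (i + d)) \<preceq> b (Suc i)" for d
  proof (induction d)
    case (Suc d)
    have "b (Suc (Suc (i + d))) \<preceq> b (Suc (i + d))"
      using b by (metis good_seqs_closed good_seqs_good le_plus2)
    with Suc show ?case
      using b le_trans[of "b (Suc (Suc (i + d)))" "b (Suc (i + d))" "b (Suc i)"] by simp
  qed (use b in simp)
  from this[of "k - Suc i"] have "b k \<preceq> b (Suc i)"
    using assms(2) by simp
  then have "b i \<oplus> b k \<preceq> b i \<oplus> b (Suc i)"
    using b by (simp add: plus_mono)
  then show ?thesis
    using b by (intro le_antisym) (auto simp: good_seqs_good)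
qed

text \<open>In a chain the hypothesis says that \<open>c = 0\<close> or that \<open>b j = 1\<close>
  for all \<open>j < k\<close>, and adding 1 is the shift. In general \<open>good_exchange\<close>
  writes entry \<open>i\<close> after a step as \<open>shift z i \<odot> (z i \<oplus> b k)\<close>,
  and the second factor is absorbed by \<open>c\<close>.\<close>

lemma add_elts_times:
  assumes "a \<in> good_seqs M" "b \<in> good_seqs M" "c \<in> carrier M" "\<forall>j<k. b j \<odot> c = c"
  shows "add_elts a b k i \<odot> c = (shift ^^ k) a i \<odot> c"
  using assms
proof (induction k arbitrary: a)
  case (Suc k)
  define z where "z = add_elts a b k"
  have z: "z \<in> good_seqs M" using Suc.prems by (simp add: z_def)
  have "(z i \<oplus> b k) \<odot> c = c"
  proof (rule le_antisym)
    have "b k \<odot> c \<preceq> (z i \<oplus> b k) \<odot> c"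
      using z Suc.prems(2,3) by (simp add: times_mono)
    then show "c \<preceq> (z i \<oplus> b k) \<odot> c" using Suc.prems by simp
  qed (use z Suc.prems in auto)
  then have "add_elts a b (Suc k) i \<odot> c = shift z i \<odot> c"
    using z Suc.prems by (simp add: z_def[symmetric] add_elt_def good_exchange times_assoc)
  also have "shift z i = add_elts (shift a) b k i"
    using Suc.prems by (simp add: z_def shift_add_elts)
  also have "\<dots> \<odot> c = (shift ^^ k) (shift a) i \<odot> c"
    using Suc.prems by (intro Suc.IH) auto
  finally show ?case
    by (simp add: funpow_swap1)
qed simp

lemma funpow_shift: "(shift ^^ k) a i = (if i < k then \<I> else a (i - k))"
  by (induction k arbitrary: i) (auto simp: shift_def split: nat.split)

text \<open>Since \<open>b j \<odot> b k = b k\<close> for \<open>j < k\<close>, the earlier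
  additions affect the new carry only as shifts. This produces the summands of
  \<open>gs_plus\<close>; the case \<open>i \<le> k\<close> stems from the ones that the shifts
  prepend.\<close>

lemma add_elts_Suc_nth:
  assumes a: "a \<in> good_seqs M" and b: "b \<in> good_seqs M"
  shows "add_elts a b (Suc k) i = add_elts a b k i \<oplus> (if i \<le> k then b k else a (i - Suc k) \<odot> b k)"
proof -
  have "\<forall>j<k. b j \<odot> b k = b k"
    using b good_seqs_absorb[OF b] by (simp add: good_iff_times)
  then have "shift (add_elts a b k) i \<odot> b k = (shift ^^ k) (shift a) i \<odot> b k"
    using a b by (simp add: shift_add_elts add_elts_times)
  also have "(shift ^^ k) (shift a) = (shift ^^ Suc k) a"
    by (simp add: funpow_swap1)
  finally show ?thesis
    using a b by (auto simp: add_elt_def funpow_shift simp del: funpow.simps)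
qed

text \<open>The free summand \<open>e\<close> makes the induction work: each step moves the last
  product of the list into the start value of the fold.\<close>

lemma add_elts_foldr:
  assumes a: "a \<in> good_seqs M" and b: "b \<in> good_seqs M" and "k \<le> i" "e \<in> carrier M"
  shows "add_elts a b k i \<oplus> e =
    a i \<oplus> foldr (mv_plus M) (map (\<lambda>j. a (i - 1 - j) \<odot> b j) [0..<k]) e"
  using assms(3,4)
proof (induction k arbitrary: e)
  case (Suc k)
  have "add_elts a b (Suc k) i \<oplus> e = add_elts a b k i \<oplus> ((a (i - 1 - k) \<odot> b k) \<oplus> e)"
    using Suc.prems a b by (simp add: add_elts_Suc_nth plus_assoc del: add_elts.simps)
  then show ?case
    using Suc a b by simp
qed simp

text \<open>Entry \<open>i\<close> is complete once \<open>b i\<close> has been added, at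
  \<open>k = Suc i\<close>; later entries of \<open>b\<close> are absorbed by
  \<open>b i\<close>.\<close>

lemma gs_plus_eq_add_elts_nth:
  assumes a: "a \<in> good_seqs M" and b: "b \<in> good_seqs M" and "i < k"
  shows "gs_plus M a b i = add_elts a b k i"
proof -
  have s: "gs_plus M a b i = add_elts a b i i \<oplus> b i"
    using add_elts_foldr[of a b i i "b i"] a b by (simp add: gs_plus_def)
  have "Suc i \<le> k" using assms(3) by simp
  then show ?thesis
  proof (induction k rule: dec_induct)
    case base
    then show ?case
      using a b s by (simp add: add_elts_Suc_nth del: add_elts.simps)
  next
    case (step k)
    have "add_elts a b (Suc k) i = (add_elts a b i i \<oplus> b i) \<oplus> b k"
      using a b step s by (simp add: add_elts_Suc_nth del: add_elts.simps)
    also have "\<dots> = add_elts a b i i \<oplus> b i"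
      using a b step by (simp add: plus_assoc good_seqs_absorb)
    finally show ?case using s by simp
  qed
qed

lemma gs_plus_eq_add_elts:
  assumes a: "a \<in> good_seqs M" and b: "b \<in> good_seqs M" and n: "\<forall>i\<ge>n. b i = \<O>"
  shows "gs_plus M a b = add_elts a b n"
proof
  fix i
  have eq: "add_elts a b m = add_elts a b n" if "n \<le> m" for m
    using that by (induction m rule: dec_induct) (use a b n in auto)
  show "gs_plus M a b i = add_elts a b n i"
    using gs_plus_eq_add_elts_nth[OF a b, of i "max n (Suc i)"] eq[of "max n (Suc i)"] by simp
qed

section \<open>The cancellative commutative monoid\<close>

lemma gs_const_good [simp]: "a \<in> carrier M \<Longrightarrow> gs_const M a \<in> good_seqs M"
  by (rule good_seqsI[of _ 1]) (auto simp: gs_const_def)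

lemma gs_plus_const: "x \<in> good_seqs M \<Longrightarrow> b \<in> carrier M \<Longrightarrow> gs_plus M x (gs_const M b) = add_elt b x"
  using gs_plus_eq_add_elts[OF _ gs_const_good[of b], of x 1] by (simp add: gs_const_def)

lemma gs_plus_zero: "x \<in> good_seqs M \<Longrightarrow> gs_plus M x (gs_const M \<O>) = x"
  by (simp add: gs_plus_const)

lemma foldr_plus_zero:
  "e \<in> carrier M \<Longrightarrow> foldr (mv_plus M) (map (\<lambda>j. \<O>) xs) e = e"
  by (induction xs) auto

lemma gs_zero_plus:
  assumes "x \<in> good_seqs M"
  shows "gs_plus M (gs_const M \<O>) x = x"
proof -
  have "gs_const M \<O> = (\<lambda>i. \<O>)" by (auto simp: gs_const_def)
  then show ?thesis
    using assms by (simp add: gs_plus_def foldr_plus_zero cong: map_cong)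
qed

lemma good_seqs_bound:
  assumes "x \<in> good_seqs M"
  obtains n where "\<forall>i\<ge>n. x i = \<O>"
  using good_seqs_support[OF assms] by blast

lemma add_elts_zero:
  assumes "b \<in> good_seqs M" "\<forall>i\<ge>n. b i = \<O>"
  shows "add_elts (gs_const M \<O>) b n = b"
  using assms gs_plus_eq_add_elts[of "gs_const M \<O>" b n] by (simp add: gs_zero_plus)

lemma gs_plus_good [simp]:
  assumes "a \<in> good_seqs M" "b \<in> good_seqs M"
  shows "gs_plus M a b \<in> good_seqs M"
  using good_seqs_bound[OF assms(2)] assms gs_plus_eq_add_elts by (metis add_elts_good)

text \<open>Inherited from \<open>add_elts_commute\<close>. Started at the zero sequence it becomes
  commutativity, and the two together give associativity, so no identity between explicit sums has
  to be checked.\<close>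

lemma gs_plus_right_commute:
  assumes a: "a \<in> good_seqs M" and b: "b \<in> good_seqs M" and c: "c \<in> good_seqs M"
  shows "gs_plus M (gs_plus M a b) c = gs_plus M (gs_plus M a c) b"
proof -
  obtain m n where "\<forall>i\<ge>m. b i = \<O>" "\<forall>i\<ge>n. c i = \<O>"
    using b c by (meson good_seqs_bound)
  then show ?thesis
    using a b c by (simp add: gs_plus_eq_add_elts add_elts_commute)
qed

lemma gs_plus_commute:
  assumes "a \<in> good_seqs M" "b \<in> good_seqs M"
  shows "gs_plus M a b = gs_plus M b a"
  using gs_plus_right_commute[of "gs_const M \<O>" a b] assms by (simp add: gs_zero_plus)

lemma gs_plus_assoc:
  assumes "a \<in> good_seqs M" "b \<in> good_seqs M" "c \<in> good_seqs M"
  shows "gs_plus M (gs_plus M a b) c = gs_plus M a (gs_plus M b c)"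
  using gs_plus_right_commute[of b a c] assms
  by (simp add: gs_plus_commute[of a b] gs_plus_commute[of a "gs_plus M b c"])

lemma gs_plus_left_commute:
  assumes "a \<in> good_seqs M" "b \<in> good_seqs M" "c \<in> good_seqs M"
  shows "gs_plus M a (gs_plus M b c) = gs_plus M b (gs_plus M a c)"
  by (metis assms gs_plus_assoc gs_plus_commute)

lemmas gs_plus_ac = gs_plus_assoc gs_plus_commute gs_plus_left_commute

lemma gs_plus_le_iff:
  assumes "a \<in> good_seqs M" "b \<in> good_seqs M" "c \<in> good_seqs M"
  shows "gs_le M (gs_plus M a c) (gs_plus M b c) \<longleftrightarrow> gs_le M a b"
  using good_seqs_bound[OF assms(3)] assms gs_plus_eq_add_elts by (metis add_elts_le_iff)

lemma gs_plus_cancel: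
  assumes "a \<in> good_seqs M" "b \<in> good_seqs M" "c \<in> good_seqs M"
  shows "gs_plus M a c = gs_plus M b c \<longleftrightarrow> a = b"
  using assms by (metis gs_le_antisym gs_le_refl gs_plus_good gs_plus_le_iff)

section \<open>Subtraction of good sequences\<close>

lemma add_elt_cancel:
  assumes "x \<in> good_seqs M" "y \<in> good_seqs M" "b \<in> carrier M"
  shows "add_elt b x = add_elt b y \<longleftrightarrow> x = y"
  using assms gs_plus_cancel[of x y "gs_const M b"] by (simp add: gs_plus_const)

text \<open>Adding \<open>\<sim> b\<close> to \<open>x\<close> gives a sequence above
  \<open>shift y\<close>, which hence starts with 1; dropping this entry subtracts the unit, so that
  in total \<open>b\<close> is subtracted. The bound \<open>gs_le M y c\<close> lets the subtraction
  continue with further entries.\<close>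

lemma le_add_elt_diff:
  assumes x: "x \<in> good_seqs M" and y: "y \<in> good_seqs M" and b: "b \<in> carrier M"
    and le: "gs_le M (add_elt b y) x"
  obtains c where "c \<in> good_seqs M" "x = add_elt b c" "gs_le M y c"
proof -
  define z where "z = add_elt (\<sim> b) x"
  have z: "z \<in> good_seqs M" using x b by (simp add: z_def)
  have yz: "gs_le M (shift y) z"
    using add_elt_mono[of "add_elt b y" x "\<sim> b"] x y b le by (simp add: add_elt_neg z_def)
  then have "mv_le M \<I> (z 0)" by (metis gs_le_def shift_0)
  then have z0: "z 0 = \<I>" using z by (simp add: one_le)
  define c where "c i = z (Suc i)" for i
  obtain n where n: "\<forall>i\<ge>n. z i = \<O>" using good_seqs_bound[OF z] .
  have c: "c \<in> good_seqs M"
    using z n by (intro good_seqsI[of _ n]) (auto simp: c_def good_seqs_good)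
  have zc: "z = shift c"
    by (rule ext, rename_tac i, case_tac i) (auto simp: c_def z0)
  have "add_elt (\<sim> b) x = add_elt (\<sim> b) (add_elt b c)"
    using b c zc by (simp add: add_elt_neg z_def)
  then have "x = add_elt b c"
    using x b c by (simp add: add_elt_cancel)
  moreover have "gs_le M y c"
    using yz by (simp add: zc gs_le_def) (metis shift_Suc)
  ultimately show ?thesis using c that by blast
qed

text \<open>The entries of \<open>b\<close> are subtracted one by one, the last first because
  \<open>add_elts\<close> adds it last. The order on good sequences is thus the divisibility order
  of the monoid.\<close>

lemma le_gs_diff:
  assumes a: "a \<in> good_seqs M" and b: "b \<in> good_seqs M" and le: "gs_le M b a"
  obtains c where "c \<in> good_seqs M" "a = gs_plus M c b"
proof -
  obtain n where n: "\<forall>i\<ge>n. b i = \<O>" using good_seqs_bound[OF b] .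
  have "\<exists>c\<in>good_seqs M. a = add_elts c b k" if "gs_le M (add_elts (gs_const M \<O>) b k) a" for k
    using a that
  proof (induction k arbitrary: a)
    case (Suc k)
    then obtain d where d: "d \<in> good_seqs M" "a = add_elt (b k) d"
      "gs_le M (add_elts (gs_const M \<O>) b k) d"
      using le_add_elt_diff[of a "add_elts (gs_const M \<O>) b k" "b k"] b by auto
    with Suc.IH show ?case by auto
  qed auto
  from this[of n] obtain c where "c \<in> good_seqs M" "a = add_elts c b n"
    using n b le by (auto simp: add_elts_zero)
  then show ?thesis
    using that b n gs_plus_eq_add_elts by metis
qed

section \<open>Entrywise joins and meets\<close>

definition gs_join where "gs_join a b = (\<lambda>i. a i \<^bold>\<or> b i)"
definition gs_meet where "gs_meet a b = (\<lambda>i. a i \<^bold>\<and> b i)"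

text \<open>Goodness of joins is checked in the form \<open>p \<odot> q = q\<close>, that of meets
  in the form \<open>p \<oplus> q = p\<close>; in either form the critical inequality is
  monotonicity.\<close>

lemma gs_join_good [simp]:
  assumes a: "a \<in> good_seqs M" and b: "b \<in> good_seqs M"
  shows "gs_join a b \<in> good_seqs M"
proof -
  have "(a i \<^bold>\<or> b i) \<oplus> (a (Suc i) \<^bold>\<or> b (Suc i)) = a i \<^bold>\<or> b i" for i
  proof -
    have "a i \<odot> a (Suc i) = a (Suc i)" "b i \<odot> b (Suc i) = b (Suc i)"
      using a b good_iff_times[of "a i" "a (Suc i)"] good_iff_times[of "b i" "b (Suc i)"]
      by (simp_all add: good_seqs_good)
    then have "a (Suc i) \<preceq> (a i \<^bold>\<or> b i) \<odot> (a (Suc i) \<^bold>\<or> b (Suc i))"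
      "b (Suc i) \<preceq> (a i \<^bold>\<or> b i) \<odot> (a (Suc i) \<^bold>\<or> b (Suc i))"
      using times_mono[of "a i" "a i \<^bold>\<or> b i" "a (Suc i)" "a (Suc i) \<^bold>\<or> b (Suc i)"]
        times_mono[of "b i" "a i \<^bold>\<or> b i" "b (Suc i)" "a (Suc i) \<^bold>\<or> b (Suc i)"] a b by simp_all
    then have "(a i \<^bold>\<or> b i) \<odot> (a (Suc i) \<^bold>\<or> b (Suc i)) = a (Suc i) \<^bold>\<or> b (Suc i)"
      using a b by (intro le_antisym) (auto simp: join_le_iff)
    then show ?thesis using a b by (simp add: good_iff_times)
  qed
  moreover obtain m n where "\<forall>i\<ge>m. a i = \<O>" "\<forall>i\<ge>n. b i = \<O>"
    using a b by (meson good_seqs_bound)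
  then have "\<forall>i\<ge>max m n. a i \<^bold>\<or> b i = \<O>"
    by (simp add: join_def)
  ultimately show ?thesis
    using a b by (intro good_seqsI[of _ "max m n"]) (auto simp: gs_join_def)
qed

lemma gs_meet_good [simp]:
  assumes a: "a \<in> good_seqs M" and b: "b \<in> good_seqs M"
  shows "gs_meet a b \<in> good_seqs M"
proof -
  have "(a i \<^bold>\<and> b i) \<oplus> (a (Suc i) \<^bold>\<and> b (Suc i)) = a i \<^bold>\<and> b i" for i
  proof (rule le_antisym)
    have "(a i \<^bold>\<and> b i) \<oplus> (a (Suc i) \<^bold>\<and> b (Suc i)) \<preceq> a i \<oplus> a (Suc i)"
      "(a i \<^bold>\<and> b i) \<oplus> (a (Suc i) \<^bold>\<and> b (Suc i)) \<preceq> b i \<oplus> b (Suc i)"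
      using a b by (simp_all add: plus_mono)
    then show "(a i \<^bold>\<and> b i) \<oplus> (a (Suc i) \<^bold>\<and> b (Suc i)) \<preceq> a i \<^bold>\<and> b i"
      using a b by (simp add: le_meet_iff good_seqs_good)
  qed (use a b in auto)
  moreover obtain m n where "\<forall>i\<ge>m. a i = \<O>" "\<forall>i\<ge>n. b i = \<O>"
    using a b by (meson good_seqs_bound)
  then have "\<forall>i\<ge>max m n. a i \<^bold>\<and> b i = \<O>"
    by (simp add: meet_def join_def)
  ultimately show ?thesis
    using a b by (intro good_seqsI[of _ "max m n"]) (auto simp: gs_meet_def)
qed

lemma gs_join_le_iff:
  "a \<in> good_seqs M \<Longrightarrow> b \<in> good_seqs M \<Longrightarrow> c \<in> good_seqs M \<Longrightarrow>
    gs_le M (gs_join a b) c \<longleftrightarrow> gs_le M a c \<and> gs_le M b c"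
  by (auto simp: gs_le_def gs_join_def join_le_iff)

lemma le_gs_meet_iff:
  "a \<in> good_seqs M \<Longrightarrow> b \<in> good_seqs M \<Longrightarrow> c \<in> good_seqs M \<Longrightarrow>
    gs_le M c (gs_meet a b) \<longleftrightarrow> gs_le M c a \<and> gs_le M c b"
  by (auto simp: gs_le_def gs_meet_def le_meet_iff)

end

section \<open>The group of differences of good sequences\<close>

text \<open>Suprema and infima are asked for by their universal property, so that witnesses can be
  given on representatives and transported along isomorphisms.\<close>

lemma lattice_lg_orderI:
  assumes refl: "\<And>x. x \<in> carrier G \<Longrightarrow> lg_le G x x"
    and antisym: "\<And>x y. x \<in> carrier G \<Longrightarrow> y \<in> carrier G \<Longrightarrow> lg_le G x y \<Longrightarrow> lg_le G y x \<Longrightarrow> x = y"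
    and trans: "\<And>x y z. x \<in> carrier G \<Longrightarrow> y \<in> carrier G \<Longrightarrow> z \<in> carrier G \<Longrightarrow>
      lg_le G x y \<Longrightarrow> lg_le G y z \<Longrightarrow> lg_le G x z"
    and sup: "\<And>x y. x \<in> carrier G \<Longrightarrow> y \<in> carrier G \<Longrightarrow>
      \<exists>s\<in>carrier G. \<forall>z\<in>carrier G. lg_le G s z \<longleftrightarrow> lg_le G x z \<and> lg_le G y z"
    and inf: "\<And>x y. x \<in> carrier G \<Longrightarrow> y \<in> carrier G \<Longrightarrow>
      \<exists>s\<in>carrier G. \<forall>z\<in>carrier G. lg_le G z s \<longleftrightarrow> lg_le G z x \<and> lg_le G z y"
  shows "lattice (lg_order G)"
proof -
  have [simp]: "carrier (lg_order G) = carrier G" "le (lg_order G) = lg_le G" "eq (lg_order G) = (=)"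
    by (simp_all add: lg_order_def)
  show ?thesis
  proof
    fix x y assume xy: "x \<in> carrier (lg_order G)" "y \<in> carrier (lg_order G)"
    then have xy': "x \<in> carrier G" "y \<in> carrier G" by simp_all
    obtain s where s: "s \<in> carrier G" "\<forall>z\<in>carrier G. lg_le G s z \<longleftrightarrow> lg_le G x z \<and> lg_le G y z"
      using sup[OF xy'] by blast
    then have "lg_le G x s \<and> lg_le G y s" using refl by blast
    with s xy' have "least (lg_order G) s (Upper (lg_order G) {x, y})"
      unfolding least_def Upper_def by auto
    then show "\<exists>s. least (lg_order G) s (Upper (lg_order G) {x, y})" ..
    obtain i where i: "i \<in> carrier G" "\<forall>z\<in>carrier G. lg_le G z i \<longleftrightarrow> lg_le G z x \<and> lg_le G z y"
      using inf[OF xy'] by blast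
    then have "lg_le G i x \<and> lg_le G i y" using refl by blast
    with i xy' have "greatest (lg_order G) i (Lower (lg_order G) {x, y})"
      unfolding greatest_def Lower_def by auto
    then show "\<exists>i. greatest (lg_order G) i (Lower (lg_order G) {x, y})" ..
  qed (simp_all add: refl antisym, blast intro: trans)
qed

context mv_algebra
begin

abbreviation gs_add (infixl "\<^bold>+" 65) where "a \<^bold>+ b \<equiv> gs_plus M a b"
abbreviation gs_zero ("\<^bold>0") where "\<^bold>0 \<equiv> gs_const M \<O>"

lemma gdiff_rel_iff:
  "((a, b), (c, d)) \<in> gdiff_rel M \<longleftrightarrow> a \<in> good_seqs M \<and> b \<in> good_seqs M \<and>
    c \<in> good_seqs M \<and> d \<in> good_seqs M \<and> a \<^bold>+ d = c \<^bold>+ b"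
  by (simp add: gdiff_rel_def)

lemma equiv_gdiff_rel: "equiv (good_seqs M \<times> good_seqs M) (gdiff_rel M)"
proof (rule equivI)
  show "gdiff_rel M \<subseteq> (good_seqs M \<times> good_seqs M) \<times> (good_seqs M \<times> good_seqs M)"
    by (auto simp: gdiff_rel_def)
  show "refl_on (good_seqs M \<times> good_seqs M) (gdiff_rel M)"
    by (auto simp: refl_on_def gdiff_rel_def)
  show "sym (gdiff_rel M)"
    by (auto simp: sym_def gdiff_rel_def)
  show "trans (gdiff_rel M)"
  proof (rule transI, clarify)
    fix a b c d e f
    assume "((a, b), (c, d)) \<in> gdiff_rel M" "((c, d), (e, f)) \<in> gdiff_rel M"
    then have S: "a \<in> good_seqs M" "b \<in> good_seqs M" "c \<in> good_seqs M" "d \<in> good_seqs M"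
      "e \<in> good_seqs M" "f \<in> good_seqs M" and eq: "a \<^bold>+ d = c \<^bold>+ b" "c \<^bold>+ f = e \<^bold>+ d"
      by (auto simp: gdiff_rel_iff)
    have "(a \<^bold>+ f) \<^bold>+ d = (a \<^bold>+ d) \<^bold>+ f"
      using S by (simp add: gs_plus_ac)
    also have "\<dots> = (c \<^bold>+ f) \<^bold>+ b"
      unfolding eq(1) using S by (simp add: gs_plus_ac)
    also have "\<dots> = (e \<^bold>+ b) \<^bold>+ d"
      unfolding eq(2) using S by (simp add: gs_plus_ac)
    finally have "a \<^bold>+ f = e \<^bold>+ b"
      using S by (simp add: gs_plus_cancel)
    then show "((a, b), (e, f)) \<in> gdiff_rel M"
      using S by (simp add: gdiff_rel_iff)
  qed
qed

lemma in_gdiff_iff: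
  "(c, d) \<in> gdiff M a b \<longleftrightarrow> a \<in> good_seqs M \<and> b \<in> good_seqs M \<and>
    c \<in> good_seqs M \<and> d \<in> good_seqs M \<and> a \<^bold>+ d = c \<^bold>+ b"
  by (simp add: gdiff_def gdiff_rel_iff)

lemma gdiff_eq_iff:
  "a \<in> good_seqs M \<Longrightarrow> b \<in> good_seqs M \<Longrightarrow> c \<in> good_seqs M \<Longrightarrow> d \<in> good_seqs M \<Longrightarrow>
    gdiff M a b = gdiff M c d \<longleftrightarrow> a \<^bold>+ d = c \<^bold>+ b"
  unfolding gdiff_def by (subst eq_equiv_class_iff[OF equiv_gdiff_rel]) (auto simp: gdiff_rel_iff)

lemma Xi_carrier: "carrier (Xi M) = {gdiff M a b |a b. a \<in> good_seqs M \<and> b \<in> good_seqs M}"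
  by (auto simp: Xi_def quotient_def gdiff_def)

lemma gdiff_closed [simp]:
  "a \<in> good_seqs M \<Longrightarrow> b \<in> good_seqs M \<Longrightarrow> gdiff M a b \<in> carrier (Xi M)"
  by (auto simp: Xi_carrier)

lemma XiE:
  assumes "X \<in> carrier (Xi M)"
  obtains a b where "a \<in> good_seqs M" "b \<in> good_seqs M" "X = gdiff M a b"
  using assms by (auto simp: Xi_carrier)

lemma Xi_mult:
  assumes S: "a \<in> good_seqs M" "b \<in> good_seqs M" "c \<in> good_seqs M" "d \<in> good_seqs M"
  shows "gdiff M a b \<otimes>\<^bsub>Xi M\<^esub> gdiff M c d = gdiff M (a \<^bold>+ c) (b \<^bold>+ d)"
proof -
  have eq: "gdiff M (a' \<^bold>+ c') (b' \<^bold>+ d') = gdiff M (a \<^bold>+ c) (b \<^bold>+ d)"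
    if "(a', b') \<in> gdiff M a b" "(c', d') \<in> gdiff M c d" for a' b' c' d'
  proof -
    from that have S': "a' \<in> good_seqs M" "b' \<in> good_seqs M" "c' \<in> good_seqs M" "d' \<in> good_seqs M"
      and eq: "a \<^bold>+ b' = a' \<^bold>+ b" "c \<^bold>+ d' = c' \<^bold>+ d"
      by (auto simp: in_gdiff_iff)
    have "(a' \<^bold>+ c') \<^bold>+ (b \<^bold>+ d) = (a' \<^bold>+ b) \<^bold>+ (c' \<^bold>+ d)"
      using S S' by (simp add: gs_plus_ac)
    also have "\<dots> = (a \<^bold>+ c) \<^bold>+ (b' \<^bold>+ d')"
      unfolding eq[symmetric] using S S' by (simp add: gs_plus_ac)
    finally show ?thesis using S S' by (simp add: gdiff_eq_iff)
  qed
  have in1: "(a, b) \<in> gdiff M a b" and in2: "(c, d) \<in> gdiff M c d"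
    using S by (auto simp: in_gdiff_iff)
  have "gdiff M a b \<otimes>\<^bsub>Xi M\<^esub> gdiff M c d =
    (\<Union>p\<in>gdiff M a b. \<Union>q\<in>gdiff M c d. gdiff M (fst p \<^bold>+ fst q) (snd p \<^bold>+ snd q))"
    by (simp add: Xi_def case_prod_beta)
  also have "\<dots> = (\<Union>p\<in>gdiff M a b. \<Union>q\<in>gdiff M c d. gdiff M (a \<^bold>+ c) (b \<^bold>+ d))"
    by (intro SUP_cong refl eq) auto
  also have "\<dots> = gdiff M (a \<^bold>+ c) (b \<^bold>+ d)"
    using in1 in2 by auto
  finally show ?thesis .
qed

lemma Xi_le:
  assumes S: "a \<in> good_seqs M" "b \<in> good_seqs M" "c \<in> good_seqs M" "d \<in> good_seqs M"
  shows "lg_le (Xi M) (gdiff M a b) (gdiff M c d) \<longleftrightarrow> gs_le M (a \<^bold>+ d) (c \<^bold>+ b)"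
proof
  assume "lg_le (Xi M) (gdiff M a b) (gdiff M c d)"
  then obtain a' b' c' d' where "(a', b') \<in> gdiff M a b" "(c', d') \<in> gdiff M c d"
    and le: "gs_le M (a' \<^bold>+ d') (c' \<^bold>+ b')"
    by (auto simp: Xi_def)
  then have S': "a' \<in> good_seqs M" "b' \<in> good_seqs M" "c' \<in> good_seqs M" "d' \<in> good_seqs M"
    and eq: "a \<^bold>+ b' = a' \<^bold>+ b" "c \<^bold>+ d' = c' \<^bold>+ d"
    by (auto simp: in_gdiff_iff)
  \<comment> \<open>Adding \<open>b\<close> and \<open>d\<close> makes it possible to cancel
    \<open>b'\<close> and \<open>d'\<close>, which passes from the given representatives to
    \<open>(a, b)\<close> and \<open>(c, d)\<close>.\<close>
  have "gs_le M ((a' \<^bold>+ d') \<^bold>+ (b \<^bold>+ d)) ((c' \<^bold>+ b') \<^bold>+ (b \<^bold>+ d))"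
    using le S S' by (simp add: gs_plus_le_iff)
  also have "(a' \<^bold>+ d') \<^bold>+ (b \<^bold>+ d) = (a' \<^bold>+ b) \<^bold>+ (d \<^bold>+ d')"
    using S S' by (simp add: gs_plus_ac)
  also have "\<dots> = (a \<^bold>+ d) \<^bold>+ (b' \<^bold>+ d')"
    unfolding eq[symmetric] using S S' by (simp add: gs_plus_ac)
  also have "(c' \<^bold>+ b') \<^bold>+ (b \<^bold>+ d) = (c' \<^bold>+ d) \<^bold>+ (b \<^bold>+ b')"
    using S S' by (simp add: gs_plus_ac)
  also have "\<dots> = (c \<^bold>+ b) \<^bold>+ (b' \<^bold>+ d')"
    unfolding eq[symmetric] using S S' by (simp add: gs_plus_ac)
  finally show "gs_le M (a \<^bold>+ d) (c \<^bold>+ b)"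
    using S S' by (simp add: gs_plus_le_iff)
next
  assume "gs_le M (a \<^bold>+ d) (c \<^bold>+ b)"
  moreover have "(a, b) \<in> gdiff M a b" "(c, d) \<in> gdiff M c d"
    using S by (auto simp: in_gdiff_iff)
  ultimately show "lg_le (Xi M) (gdiff M a b) (gdiff M c d)"
    by (auto simp: Xi_def)
qed

lemma Xi_one: "\<one>\<^bsub>Xi M\<^esub> = gdiff M \<^bold>0 \<^bold>0"
  and Xi_ounit: "ounit (Xi M) = gdiff M (gs_const M \<I>) \<^bold>0"
  by (simp_all add: Xi_def)

lemma comm_group_Xi: "comm_group (Xi M)"
proof (rule comm_groupI)
  fix X assume "X \<in> carrier (Xi M)"
  then obtain a b where X: "a \<in> good_seqs M" "b \<in> good_seqs M" "X = gdiff M a b"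
    by (rule XiE)
  then have "gdiff M b a \<otimes>\<^bsub>Xi M\<^esub> X = \<one>\<^bsub>Xi M\<^esub>"
    by (simp add: Xi_mult Xi_one gdiff_eq_iff gs_plus_commute gs_plus_zero gs_zero_plus)
  then show "\<exists>Y\<in>carrier (Xi M). Y \<otimes>\<^bsub>Xi M\<^esub> X = \<one>\<^bsub>Xi M\<^esub>"
    using X by (intro bexI[of _ "gdiff M b a"]) auto
qed (auto elim!: XiE simp: Xi_mult gs_plus_ac Xi_one gs_zero_plus gs_plus_zero)

text \<open>Over a common denominator, comparisons, joins and meets concern the numerators
  alone.\<close>

lemma Xi_common_denominator:
  assumes "X \<in> carrier (Xi M)" "Y \<in> carrier (Xi M)"
  obtains a c b where "a \<in> good_seqs M" "c \<in> good_seqs M" "b \<in> good_seqs M"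
    "X = gdiff M a b" "Y = gdiff M c b"
proof -
  obtain a b c d where S: "a \<in> good_seqs M" "b \<in> good_seqs M" "X = gdiff M a b"
    "c \<in> good_seqs M" "d \<in> good_seqs M" "Y = gdiff M c d"
    using assms by (metis XiE)
  then have "X = gdiff M (a \<^bold>+ d) (b \<^bold>+ d)" "Y = gdiff M (c \<^bold>+ b) (b \<^bold>+ d)"
    by (simp_all add: gdiff_eq_iff gs_plus_ac)
  then show ?thesis
    using S by (intro that[of "a \<^bold>+ d" "c \<^bold>+ b" "b \<^bold>+ d"]) simp_all
qed

lemma add_elt_one: "x \<in> good_seqs M \<Longrightarrow> add_elt \<I> x = shift x"
  by (auto simp: add_elt_def plus_commute[of "x _"])

lemma funpow_shift_good: "x \<in> good_seqs M \<Longrightarrow> (shift ^^ n) x \<in> good_seqs M"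
  by (induction n) auto

text \<open>Adding the unit is the shift, so the numerator is the sequence of \<open>n\<close> ones,
  which bounds every good sequence supported below \<open>n\<close>.\<close>

lemma Xi_ounit_pow: "ounit (Xi M) [^]\<^bsub>Xi M\<^esub> n = gdiff M ((shift ^^ n) \<^bold>0) \<^bold>0"
proof -
  interpret comm_group "Xi M" by (rule comm_group_Xi)
  show ?thesis
  proof (induction n)
    case (Suc n)
    then show ?case
      by (simp add: nat_pow_Suc Xi_mult Xi_ounit funpow_shift_good gs_plus_const add_elt_one)
  qed (simp add: Xi_one)
qed

lemma le_gs_plus: "a \<in> good_seqs M \<Longrightarrow> b \<in> good_seqs M \<Longrightarrow> gs_le M b (a \<^bold>+ b)"
  using gs_plus_le_iff[of "\<^bold>0" a b] by (simp add: gs_zero_plus) (simp add: gs_le_def gs_const_def)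

text \<open>Not every good sequence is a translate by \<open>c\<close>, but the join of the two
  translates lies above \<open>c\<close> and hence is \<open>c\<close> plus some \<open>g\<close>;
  cancelling \<open>c\<close> makes \<open>g\<close> an upper bound of \<open>a\<close> and
  \<open>b\<close>.\<close>

lemma gs_join_plus:
  assumes S: "a \<in> good_seqs M" "b \<in> good_seqs M" "c \<in> good_seqs M"
  shows "gs_join a b \<^bold>+ c = gs_join (a \<^bold>+ c) (b \<^bold>+ c)"
proof (rule gs_le_antisym)
  let ?j = "gs_join (a \<^bold>+ c) (b \<^bold>+ c)"
  have j: "gs_le M (a \<^bold>+ c) ?j" "gs_le M (b \<^bold>+ c) ?j"
    using S gs_join_le_iff[of "a \<^bold>+ c" "b \<^bold>+ c" ?j] by (auto simp: gs_le_refl)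
  then have "gs_le M c ?j"
    using S gs_le_trans[of c "a \<^bold>+ c" ?j] by (simp add: le_gs_plus)
  then obtain g where g: "g \<in> good_seqs M" "?j = g \<^bold>+ c"
    using S le_gs_diff[of ?j c] by auto
  then show "gs_le M (gs_join a b \<^bold>+ c) ?j"
    using S j by (simp add: gs_plus_le_iff gs_join_le_iff)
  have "gs_le M a (gs_join a b)" "gs_le M b (gs_join a b)"
    using S gs_join_le_iff[of a b "gs_join a b"] by (auto simp: gs_le_refl)
  then show "gs_le M ?j (gs_join a b \<^bold>+ c)"
    using S by (simp add: gs_plus_le_iff gs_join_le_iff)
qed (use S in auto)

lemma gs_meet_plus:
  assumes S: "a \<in> good_seqs M" "b \<in> good_seqs M" "c \<in> good_seqs M"
  shows "gs_meet a b \<^bold>+ c = gs_meet (a \<^bold>+ c) (b \<^bold>+ c)"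
proof (rule gs_le_antisym)
  let ?m = "gs_meet (a \<^bold>+ c) (b \<^bold>+ c)"
  have m: "gs_le M ?m (a \<^bold>+ c)" "gs_le M ?m (b \<^bold>+ c)"
    using S le_gs_meet_iff[of "a \<^bold>+ c" "b \<^bold>+ c" ?m] by (auto simp: gs_le_refl)
  have "gs_le M c ?m"
    using S by (simp add: le_gs_meet_iff le_gs_plus)
  then obtain g where g: "g \<in> good_seqs M" "?m = g \<^bold>+ c"
    using S le_gs_diff[of ?m c] by auto
  then show "gs_le M ?m (gs_meet a b \<^bold>+ c)"
    using S m by (simp add: gs_plus_le_iff le_gs_meet_iff)
  have "gs_le M (gs_meet a b) a" "gs_le M (gs_meet a b) b"
    using S le_gs_meet_iff[of a b "gs_meet a b"] by (auto simp: gs_le_refl)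
  then show "gs_le M (gs_meet a b \<^bold>+ c) ?m"
    using S by (simp add: gs_plus_le_iff le_gs_meet_iff)
qed (use S in auto)

lemma Xi_trans:
  assumes "X \<in> carrier (Xi M)" "Y \<in> carrier (Xi M)" "Z \<in> carrier (Xi M)"
    and XY: "lg_le (Xi M) X Y" and YZ: "lg_le (Xi M) Y Z"
  shows "lg_le (Xi M) X Z"
proof -
  obtain a b where X: "a \<in> good_seqs M" "b \<in> good_seqs M" "X = gdiff M a b"
    using assms(1) by (rule XiE)
  obtain c d where Y: "c \<in> good_seqs M" "d \<in> good_seqs M" "Y = gdiff M c d"
    using assms(2) by (rule XiE)
  obtain e f where Z: "e \<in> good_seqs M" "f \<in> good_seqs M" "Z = gdiff M e f"
    using assms(3) by (rule XiE)
  have "gs_le M ((a \<^bold>+ d) \<^bold>+ f) ((c \<^bold>+ b) \<^bold>+ f)" "gs_le M ((c \<^bold>+ f) \<^bold>+ b) ((e \<^bold>+ d) \<^bold>+ b)"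
    using X Y Z XY YZ by (simp_all add: Xi_le gs_plus_le_iff)
  moreover have "(a \<^bold>+ d) \<^bold>+ f = (a \<^bold>+ f) \<^bold>+ d" "(c \<^bold>+ b) \<^bold>+ f = (c \<^bold>+ f) \<^bold>+ b"
    "(e \<^bold>+ d) \<^bold>+ b = (e \<^bold>+ b) \<^bold>+ d"
    using X Y Z by (simp_all add: gs_plus_ac)
  ultimately have "gs_le M ((a \<^bold>+ f) \<^bold>+ d) ((e \<^bold>+ b) \<^bold>+ d)"
    using X Y Z gs_le_trans[of "(a \<^bold>+ f) \<^bold>+ d" "(c \<^bold>+ f) \<^bold>+ b" "(e \<^bold>+ b) \<^bold>+ d"] by simp
  then show ?thesis
    using X Y Z by (simp add: Xi_le gs_plus_le_iff)
qed

lemma lattice_Xi: "lattice (lg_order (Xi M))"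
proof (rule lattice_lg_orderI)
  fix X Y assume XY: "X \<in> carrier (Xi M)" "Y \<in> carrier (Xi M)"
  obtain a c b where S: "a \<in> good_seqs M" "c \<in> good_seqs M" "b \<in> good_seqs M"
    and X: "X = gdiff M a b" and Y: "Y = gdiff M c b"
    using Xi_common_denominator[OF XY] .
  show "\<exists>s\<in>carrier (Xi M). \<forall>z\<in>carrier (Xi M).
      lg_le (Xi M) s z \<longleftrightarrow> lg_le (Xi M) X z \<and> lg_le (Xi M) Y z"
    using S unfolding X Y
    by (intro bexI[of _ "gdiff M (gs_join a c) b"])
      (auto elim!: XiE simp: Xi_le gs_join_plus gs_join_le_iff)
  show "\<exists>s\<in>carrier (Xi M). \<forall>z\<in>carrier (Xi M).
      lg_le (Xi M) z s \<longleftrightarrow> lg_le (Xi M) z X \<and> lg_le (Xi M) z Y"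
    using S unfolding X Y
    by (intro bexI[of _ "gdiff M (gs_meet a c) b"])
      (auto elim!: XiE simp: Xi_le gs_meet_plus le_gs_meet_iff)
next
  fix X Y Z assume "X \<in> carrier (Xi M)" "Y \<in> carrier (Xi M)" "Z \<in> carrier (Xi M)"
    "lg_le (Xi M) X Y" "lg_le (Xi M) Y Z"
  then show "lg_le (Xi M) X Z" by (rule Xi_trans)
next
  fix X Y assume "X \<in> carrier (Xi M)" "Y \<in> carrier (Xi M)" "lg_le (Xi M) X Y" "lg_le (Xi M) Y X"
  then show "X = Y"
    by (elim XiE) (simp add: Xi_le gdiff_eq_iff gs_le_antisym)
qed (auto elim!: XiE simp: Xi_le gs_le_refl)

theorem unital_l_group_Xi: "unital_l_group (Xi M)"
proof (rule unital_l_group.intro)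
  fix X Y Z assume "X \<in> carrier (Xi M)" "Y \<in> carrier (Xi M)" "Z \<in> carrier (Xi M)" "lg_le (Xi M) X Y"
  then obtain a b c d e f where S: "a \<in> good_seqs M" "b \<in> good_seqs M" "c \<in> good_seqs M"
    "d \<in> good_seqs M" "e \<in> good_seqs M" "f \<in> good_seqs M"
    and eq: "X = gdiff M a b" "Y = gdiff M c d" "Z = gdiff M e f" and le: "gs_le M (a \<^bold>+ d) (c \<^bold>+ b)"
    by (auto elim!: XiE simp: Xi_le)
  have "gs_le M ((a \<^bold>+ d) \<^bold>+ (e \<^bold>+ f)) ((c \<^bold>+ b) \<^bold>+ (e \<^bold>+ f))"
    using S le by (simp add: gs_plus_le_iff)
  also have "(a \<^bold>+ d) \<^bold>+ (e \<^bold>+ f) = (a \<^bold>+ e) \<^bold>+ (d \<^bold>+ f)"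
    using S by (simp add: gs_plus_ac)
  also have "(c \<^bold>+ b) \<^bold>+ (e \<^bold>+ f) = (c \<^bold>+ e) \<^bold>+ (b \<^bold>+ f)"
    using S by (simp add: gs_plus_ac)
  finally show "lg_le (Xi M) (X \<otimes>\<^bsub>Xi M\<^esub> Z) (Y \<otimes>\<^bsub>Xi M\<^esub> Z)"
    using S by (simp add: eq Xi_mult Xi_le)
next
  fix X assume "X \<in> carrier (Xi M)"
  then obtain a b where S: "a \<in> good_seqs M" "b \<in> good_seqs M" and X: "X = gdiff M a b"
    by (rule XiE)
  obtain n where n: "\<forall>i\<ge>n. a i = \<O>"
    using good_seqs_bound[OF S(1)] .
  let ?u = "(shift ^^ n) \<^bold>0"
  have u: "?u \<in> good_seqs M" by (simp add: funpow_shift_good)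
  have "gs_le M a ?u"
    unfolding gs_le_def using S n by (auto simp: funpow_shift gs_const_def)
  moreover have "gs_le M ?u (b \<^bold>+ ?u)"
    using S u by (simp add: le_gs_plus)
  ultimately have "gs_le M a (?u \<^bold>+ b)"
    using S u gs_le_trans[of a ?u "b \<^bold>+ ?u"] by (simp add: gs_plus_commute[of ?u])
  then have "lg_le (Xi M) X (ounit (Xi M) [^]\<^bsub>Xi M\<^esub> n)"
    using S u by (simp add: X Xi_ounit_pow Xi_le gs_plus_zero)
  then show "\<exists>n::nat. lg_le (Xi M) X (ounit (Xi M) [^]\<^bsub>Xi M\<^esub> n)" ..
next
  show "lg_le (Xi M) \<one>\<^bsub>Xi M\<^esub> (ounit (Xi M))"
    by (simp add: Xi_one Xi_ounit Xi_le gs_plus_zero) (simp add: gs_le_def gs_const_def)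
qed (simp_all add: comm_group_Xi lattice_Xi Xi_ounit)

section \<open>The MV-algebra as unit interval of its group\<close>

lemma Xi_embed_closed [simp]: "a \<in> carrier M \<Longrightarrow> Xi_embed M a \<in> carrier (Xi M)"
  by (simp add: Xi_embed_def)

lemma Xi_embed_one: "Xi_embed M \<I> = ounit (Xi M)"
  by (simp add: Xi_embed_def Xi_ounit)

lemma gs_const_inject: "gs_const M a = gs_const M b \<longleftrightarrow> a = b"
  by (metis gs_const_def)

lemma Xi_embed_inject:
  "a \<in> carrier M \<Longrightarrow> b \<in> carrier M \<Longrightarrow> Xi_embed M a = Xi_embed M b \<longleftrightarrow> a = b"
  by (simp add: Xi_embed_def gdiff_eq_iff gs_plus_zero gs_const_inject)

lemma gs_const_plus:
  assumes "a \<in> carrier M" "b \<in> carrier M"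
  shows "gs_const M a \<^bold>+ gs_const M b = (\<lambda>i. if i = 0 then a \<oplus> b else if i = 1 then a \<odot> b else \<O>)"
proof -
  have "gs_const M a \<^bold>+ gs_const M b = add_elt b (gs_const M a)"
    using assms by (simp add: gs_plus_const)
  then show ?thesis
    using assms by (auto simp: add_elt_def gs_const_def shift_def fun_eq_iff split: nat.split)
qed

text \<open>One-entry sequences add up to \<open>a \<oplus> b\<close> followed by
  \<open>a \<odot> b\<close>, and this has a single entry exactly if the carry vanishes. A sum
  formed in the group thus becomes a condition inside \<open>M\<close>.\<close>

lemma Xi_embed_mult_eq_iff:
  assumes "a \<in> carrier M" "b \<in> carrier M" "c \<in> carrier M"
  shows "Xi_embed M c = Xi_embed M a \<otimes>\<^bsub>Xi M\<^esub> Xi_embed M b \<longleftrightarrow> a \<odot> b = \<O> \<and> c = a \<oplus> b"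
proof -
  have "Xi_embed M c = Xi_embed M a \<otimes>\<^bsub>Xi M\<^esub> Xi_embed M b \<longleftrightarrow>
      gs_const M c = gs_const M a \<^bold>+ gs_const M b"
    using assms by (simp add: Xi_embed_def Xi_mult gdiff_eq_iff gs_plus_zero)
  also have "\<dots> \<longleftrightarrow> a \<odot> b = \<O> \<and> c = a \<oplus> b"
    unfolding gs_const_plus[OF assms(1,2)] unfolding gs_const_def
    by (auto dest: fun_cong[of _ _ "0::nat"] fun_cong[of _ _ "1::nat"])
  finally show ?thesis .
qed

text \<open>By \<open>le_gs_diff\<close> a nonnegative class is represented by a good sequence over
  zero; lying below the unit forces its entries after the first to vanish.\<close>

lemma Xi_embed_image:
  "Xi_embed M ` carrier M = {X \<in> carrier (Xi M). lg_le (Xi M) \<one>\<^bsub>Xi M\<^esub> X \<and> lg_le (Xi M) X (ounit (Xi M))}"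
proof (intro equalityI subsetI; clarify?)
  fix a assume "a \<in> carrier M"
  then show "Xi_embed M a \<in> carrier (Xi M) \<and>
      lg_le (Xi M) \<one>\<^bsub>Xi M\<^esub> (Xi_embed M a) \<and> lg_le (Xi M) (Xi_embed M a) (ounit (Xi M))"
    by (simp add: Xi_embed_def Xi_one Xi_ounit Xi_le gs_plus_zero) (simp add: gs_le_def gs_const_def)
next
  fix X assume "X \<in> carrier (Xi M)" and pos: "lg_le (Xi M) \<one>\<^bsub>Xi M\<^esub> X"
    and le: "lg_le (Xi M) X (ounit (Xi M))"
  then obtain a b where S: "a \<in> good_seqs M" "b \<in> good_seqs M" and X: "X = gdiff M a b"
    by (metis XiE)
  have "gs_le M b a"
    using S pos by (simp add: X Xi_one Xi_le gs_zero_plus gs_plus_zero)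
  then obtain c where c: "c \<in> good_seqs M" "a = c \<^bold>+ b"
    using S by (auto elim: le_gs_diff)
  then have X': "X = gdiff M c \<^bold>0"
    using S by (simp add: X gdiff_eq_iff gs_plus_zero)
  have "gs_le M c (gs_const M \<I>)"
    using c le by (simp add: X' Xi_ounit Xi_le gs_plus_zero)
  then have "c (Suc i) \<preceq> \<O>" for i
    by (metis gs_le_def gs_const_def nat.simps(3))
  then have cS: "c (Suc i) = \<O>" for i
    using c by (simp add: le_zero)
  have c0: "c = gs_const M (c 0)"
    by (rule ext, rename_tac i, case_tac i) (simp_all add: gs_const_def cS)
  have "X = Xi_embed M (c 0)"
    unfolding Xi_embed_def c0[symmetric] by (rule X')
  then show "X \<in> Xi_embed M ` carrier M"
    using c by simp
qed

text \<open>A good sequence is the sum of its entries, by \<open>add_elts_zero\<close>, so a class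
  with zero denominator is reached from the neutral element by adding embedded elements. This is the
  generation property behind \<open>Xi_hom_unique\<close>.\<close>

lemma gdiff_zero_induct:
  assumes a: "a \<in> good_seqs M"
    and zero: "P \<one>\<^bsub>Xi M\<^esub>"
    and step: "\<And>X b. X \<in> carrier (Xi M) \<Longrightarrow> b \<in> carrier M \<Longrightarrow> P X \<Longrightarrow> P (X \<otimes>\<^bsub>Xi M\<^esub> Xi_embed M b)"
  shows "P (gdiff M a \<^bold>0)"
proof -
  have "P (gdiff M (add_elts \<^bold>0 a k) \<^bold>0)" for k
  proof (induction k)
    case (Suc k)
    then show ?case
      using step[of "gdiff M (add_elts \<^bold>0 a k) \<^bold>0" "a k"] a
      by (simp add: Xi_embed_def Xi_mult gs_plus_const)
  qed (use zero in \<open>simp add: Xi_one\<close>)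
  then show ?thesis
    using good_seqs_bound[OF a] add_elts_zero[OF a] by metis
qed

lemma Xi_hom_unique:
  assumes "comm_group H" and f: "f \<in> hom (Xi M) H" and g: "g \<in> hom (Xi M) H"
    and eq: "\<And>a. a \<in> carrier M \<Longrightarrow> f (Xi_embed M a) = g (Xi_embed M a)" and X: "X \<in> carrier (Xi M)"
  shows "f X = g X"
proof -
  interpret H: comm_group H by fact
  interpret Xi: comm_group "Xi M" by (rule comm_group_Xi)
  have one: "h \<one>\<^bsub>Xi M\<^esub> = \<one>\<^bsub>H\<^esub>" if "h \<in> hom (Xi M) H" for h
    using that by (simp add: hom_one[OF _ Xi.is_group H.is_group])
  have pos: "f (gdiff M a \<^bold>0) = g (gdiff M a \<^bold>0)" if "a \<in> good_seqs M" for a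
    using that by (rule gdiff_zero_induct) (use f g eq in \<open>auto simp: one hom_mult\<close>)
  obtain a b where S: "a \<in> good_seqs M" "b \<in> good_seqs M" "X = gdiff M a b"
    using X by (rule XiE)
  have "X \<otimes>\<^bsub>Xi M\<^esub> gdiff M b \<^bold>0 = gdiff M a \<^bold>0"
    using S by (simp add: Xi_mult gdiff_eq_iff gs_plus_zero)
  then have "f X \<otimes>\<^bsub>H\<^esub> f (gdiff M b \<^bold>0) = g X \<otimes>\<^bsub>H\<^esub> g (gdiff M b \<^bold>0)"
    using f g S X pos[of a] hom_mult[OF f, of X "gdiff M b \<^bold>0"] hom_mult[OF g, of X "gdiff M b \<^bold>0"]
    by simp
  then show ?thesis
    using f g X S pos[of b] by (simp add: hom_in_carrier[of _ "Xi M"])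
qed

end

text \<open>States are defined by sums in the group of the target;
  \<open>Xi_embed_mult_eq_iff\<close> moves this condition into \<open>N\<close>. It then shows that
  orthogonal pairs go to orthogonal pairs, which is what composition of states requires.\<close>

lemma mv_state_iff:
  assumes "mv_algebra M" "mv_algebra N"
  shows "mv_state M N s \<longleftrightarrow> s \<in> carrier M \<rightarrow> carrier N \<and> s (mv_one M) = mv_one N \<and>
    (\<forall>a\<in>carrier M. \<forall>b\<in>carrier M. mv_times M a b = mv_zero M \<longrightarrow>
       mv_times N (s a) (s b) = mv_zero N \<and> s (mv_plus M a b) = mv_plus N (s a) (s b))"
proof -
  interpret M: mv_algebra M by fact
  interpret N: mv_algebra N by fact
  show ?thesis
    unfolding mv_state_def by (simp add: Pi_iff N.Xi_embed_mult_eq_iff cong: conj_cong)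
qed

section \<open>Unital lattice-ordered groups and their unit intervals\<close>

sublocale unital_l_group \<subseteq> comm_group G
  by (rule comm_group)

context unital_l_group
begin

abbreviation le_lg (infix "\<preceq>" 50) where "x \<preceq> y \<equiv> lg_le G x y"
abbreviation unit_lg ("\<u>") where "\<u> \<equiv> ounit G"
abbreviation plus_lg (infixl "\<^bold>+" 65) where "x \<^bold>+ y \<equiv> x \<otimes>\<^bsub>G\<^esub> y"
abbreviation minus_lg ("\<^bold>- _" [81] 80) where "\<^bold>- x \<equiv> inv\<^bsub>G\<^esub> x"
abbreviation zero_lg ("\<^bold>0") where "\<^bold>0 \<equiv> \<one>\<^bsub>G\<^esub>"
abbreviation meet_lg (infixl "\<^bold>\<and>" 61) where "x \<^bold>\<and> y \<equiv> x \<sqinter>\<^bsub>lg_order G\<^esub> y"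

lemma lg_order_simps [simp]:
  "carrier (lg_order G) = carrier G" "le (lg_order G) = lg_le G" "eq (lg_order G) = (=)"
  by (simp_all add: lg_order_def)

declare unit_closed [simp] unit_nonneg [simp]

section \<open>Order, meets and translations\<close>

lemma le_refl [simp]: "x \<in> carrier G \<Longrightarrow> x \<preceq> x"
proof -
  interpret L: lattice "lg_order G" by (rule lattice)
  show "x \<in> carrier G \<Longrightarrow> x \<preceq> x" using L.le_refl by simp
qed

lemma le_antisym: "x \<preceq> y \<Longrightarrow> y \<preceq> x \<Longrightarrow> x \<in> carrier G \<Longrightarrow> y \<in> carrier G \<Longrightarrow> x = y"
proof -
  interpret L: lattice "lg_order G" by (rule lattice)
  show "x \<preceq> y \<Longrightarrow> y \<preceq> x \<Longrightarrow> x \<in> carrier G \<Longrightarrow> y \<in> carrier G \<Longrightarrow> x = y"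
    using L.le_antisym by simp
qed

lemma le_trans:
  "x \<preceq> y \<Longrightarrow> y \<preceq> z \<Longrightarrow> x \<in> carrier G \<Longrightarrow> y \<in> carrier G \<Longrightarrow> z \<in> carrier G \<Longrightarrow> x \<preceq> z"
proof -
  interpret L: lattice "lg_order G" by (rule lattice)
  show "x \<preceq> y \<Longrightarrow> y \<preceq> z \<Longrightarrow> x \<in> carrier G \<Longrightarrow> y \<in> carrier G \<Longrightarrow> z \<in> carrier G \<Longrightarrow> x \<preceq> z"
    using L.le_trans[of x y z] by simp
qed

lemma meet_closed [simp]: "x \<in> carrier G \<Longrightarrow> y \<in> carrier G \<Longrightarrow> x \<^bold>\<and> y \<in> carrier G"
proof -
  interpret L: lattice "lg_order G" by (rule lattice)
  show "x \<in> carrier G \<Longrightarrow> y \<in> carrier G \<Longrightarrow> x \<^bold>\<and> y \<in> carrier G"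
    using L.meet_closed[of x y] by simp
qed

lemma le_meet_iff:
  assumes "x \<in> carrier G" "y \<in> carrier G" "z \<in> carrier G"
  shows "z \<preceq> x \<^bold>\<and> y \<longleftrightarrow> z \<preceq> x \<and> z \<preceq> y"
proof -
  interpret L: lattice "lg_order G" by (rule lattice)
  have "x \<^bold>\<and> y \<preceq> x" "x \<^bold>\<and> y \<preceq> y"
    using L.meet_left[of x y] L.meet_right[of x y] assms by simp_all
  then show ?thesis
    using L.meet_le[of z x y] assms by (auto intro: le_trans)
qed

lemma meet_le1 [simp]: "x \<in> carrier G \<Longrightarrow> y \<in> carrier G \<Longrightarrow> x \<^bold>\<and> y \<preceq> x"
  and meet_le2 [simp]: "x \<in> carrier G \<Longrightarrow> y \<in> carrier G \<Longrightarrow> x \<^bold>\<and> y \<preceq> y"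
  using le_meet_iff[of x y "x \<^bold>\<and> y"] by simp_all

text \<open>Meets are compared through their lower bounds, so that \<open>le_meet_iff\<close> and
  translation invariance suffice for the identities below.\<close>

lemma lower_eqI:
  assumes "x \<in> carrier G" "y \<in> carrier G" "\<And>z. z \<in> carrier G \<Longrightarrow> z \<preceq> x \<longleftrightarrow> z \<preceq> y"
  shows "x = y"
  using assms by (meson le_antisym le_refl)

lemma meet_absorb: "x \<in> carrier G \<Longrightarrow> y \<in> carrier G \<Longrightarrow> x \<preceq> y \<Longrightarrow> x \<^bold>\<and> y = x"
  by (rule lower_eqI) (auto simp: le_meet_iff intro: le_trans)

lemma mult_le_cancel [simp]:
  assumes "x \<in> carrier G" "y \<in> carrier G" "z \<in> carrier G"
  shows "x \<^bold>+ z \<preceq> y \<^bold>+ z \<longleftrightarrow> x \<preceq> y"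
proof
  assume "x \<^bold>+ z \<preceq> y \<^bold>+ z"
  then have "x \<^bold>+ z \<^bold>+ \<^bold>- z \<preceq> y \<^bold>+ z \<^bold>+ \<^bold>- z"
    using assms by (simp add: translation_invariant)
  then show "x \<preceq> y" using assms by (simp add: m_assoc)
qed (use assms translation_invariant in auto)

lemma diff_le_iff:
  assumes "x \<in> carrier G" "y \<in> carrier G" "z \<in> carrier G"
  shows "x \<^bold>+ \<^bold>- y \<preceq> z \<longleftrightarrow> x \<preceq> z \<^bold>+ y"
  using mult_le_cancel[of "x \<^bold>+ \<^bold>- y" z y] assms by (simp add: m_assoc)

lemma le_diff_iff:
  assumes "x \<in> carrier G" "y \<in> carrier G" "z \<in> carrier G"
  shows "x \<preceq> z \<^bold>+ \<^bold>- y \<longleftrightarrow> x \<^bold>+ y \<preceq> z"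
  using mult_le_cancel[of x "z \<^bold>+ \<^bold>- y" y] assms by (simp add: m_assoc)

lemma mult_mono:
  assumes "x \<in> carrier G" "y \<in> carrier G" "z \<in> carrier G" "w \<in> carrier G" "x \<preceq> y" "z \<preceq> w"
  shows "x \<^bold>+ z \<preceq> y \<^bold>+ w"
proof (rule le_trans)
  show "x \<^bold>+ z \<preceq> y \<^bold>+ z" using assms by simp
  show "y \<^bold>+ z \<preceq> y \<^bold>+ w" using assms by (simp add: m_comm[of y])
qed (use assms in auto)

lemma le_mult_nonneg: "x \<in> carrier G \<Longrightarrow> y \<in> carrier G \<Longrightarrow> \<^bold>0 \<preceq> y \<Longrightarrow> x \<preceq> x \<^bold>+ y"
  using mult_mono[of x x "\<^bold>0" y] by simp

lemma le_mult_meet_iff: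
  assumes "x \<in> carrier G" "y \<in> carrier G" "z \<in> carrier G" "w \<in> carrier G"
  shows "w \<preceq> (x \<^bold>\<and> y) \<^bold>+ z \<longleftrightarrow> w \<preceq> x \<^bold>+ z \<and> w \<preceq> y \<^bold>+ z"
  using assms by (simp add: diff_le_iff[symmetric] le_meet_iff)

text \<open>As \<open>z\<close> is nonnegative, whatever is below the unit is below the unit plus
  \<open>z\<close>, so truncating early changes nothing. This gives associativity of truncated
  addition and is used again for sums of good sequences.\<close>

lemma meet_mult_meet_unit:
  assumes "x \<in> carrier G" "z \<in> carrier G" "\<^bold>0 \<preceq> z"
  shows "((x \<^bold>\<and> \<u>) \<^bold>+ z) \<^bold>\<and> \<u> = (x \<^bold>+ z) \<^bold>\<and> \<u>"
proof (rule lower_eqI)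
  fix w assume w: "w \<in> carrier G"
  have "w \<preceq> \<u> \<Longrightarrow> w \<preceq> \<u> \<^bold>+ z"
    using le_trans[of w \<u> "\<u> \<^bold>+ z"] le_mult_nonneg[of \<u> z] assms w by simp
  then show "w \<preceq> ((x \<^bold>\<and> \<u>) \<^bold>+ z) \<^bold>\<and> \<u> \<longleftrightarrow> w \<preceq> (x \<^bold>+ z) \<^bold>\<and> \<u>"
    using assms w by (auto simp: le_meet_iff le_mult_meet_iff)
qed (use assms in auto)

section \<open>The unit interval as an MV-algebra\<close>

lemma carrier_Gamma: "carrier (Gamma G) = {a \<in> carrier G. \<^bold>0 \<preceq> a \<and> a \<preceq> \<u>}"
  and Gamma_plus: "mv_plus (Gamma G) a b = (a \<^bold>+ b) \<^bold>\<and> \<u>"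
  and Gamma_neg: "mv_neg (Gamma G) a = \<u> \<^bold>+ \<^bold>- a"
  and Gamma_zero [simp]: "mv_zero (Gamma G) = \<^bold>0"
  by (simp_all add: Gamma_def)

lemma Gamma_one [simp]: "mv_one (Gamma G) = \<u>"
  by (simp add: mv_one_def Gamma_neg)

lemma mult_nonneg:
  "x \<in> carrier G \<Longrightarrow> y \<in> carrier G \<Longrightarrow> \<^bold>0 \<preceq> x \<Longrightarrow> \<^bold>0 \<preceq> y \<Longrightarrow> \<^bold>0 \<preceq> x \<^bold>+ y"
  using mult_mono[of "\<^bold>0" x "\<^bold>0" y] by simp

text \<open>The term is the positive part of \<open>a - b\<close> plus \<open>b\<close>, hence the
  join. Its description by upper bounds exhibits the symmetry that the axiom
  \<open>lukasiewicz\<close> demands.\<close>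

lemma Gamma_join:
  assumes "a \<in> carrier G" "b \<in> carrier G" "w \<in> carrier G"
  shows "\<u> \<^bold>+ \<^bold>- ((\<u> \<^bold>+ \<^bold>- a \<^bold>+ b) \<^bold>\<and> \<u>) \<^bold>+ b \<preceq> w \<longleftrightarrow> a \<preceq> w \<and> b \<preceq> w"
proof -
  let ?m = "(\<u> \<^bold>+ \<^bold>- a \<^bold>+ b) \<^bold>\<and> \<u>"
  have "\<u> \<^bold>+ \<^bold>- ?m \<^bold>+ b = \<u> \<^bold>+ b \<^bold>+ \<^bold>- ?m"
    using assms by (simp add: m_ac)
  then have "\<u> \<^bold>+ \<^bold>- ?m \<^bold>+ b \<preceq> w \<longleftrightarrow> \<u> \<^bold>+ b \<preceq> ?m \<^bold>+ w"
    using assms by (simp add: diff_le_iff m_comm[of w])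
  also have "\<dots> \<longleftrightarrow> \<u> \<^bold>+ b \<preceq> \<u> \<^bold>+ \<^bold>- a \<^bold>+ b \<^bold>+ w \<and> \<u> \<^bold>+ b \<preceq> \<u> \<^bold>+ w"
    using assms by (simp add: le_mult_meet_iff)
  also have "\<u> \<^bold>+ b \<preceq> \<u> \<^bold>+ \<^bold>- a \<^bold>+ b \<^bold>+ w \<longleftrightarrow> a \<preceq> w"
  proof -
    have "\<u> \<^bold>+ \<^bold>- a \<^bold>+ b \<^bold>+ w = (w \<^bold>+ \<u> \<^bold>+ b) \<^bold>+ \<^bold>- a"
      using assms by (simp add: m_ac)
    moreover have "\<u> \<^bold>+ b \<^bold>+ a = a \<^bold>+ (\<u> \<^bold>+ b)"
      using assms by (simp add: m_ac)
    ultimately show ?thesis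
      using assms by (simp add: le_diff_iff) (simp add: m_assoc)
  qed
  also have "\<u> \<^bold>+ b \<preceq> \<u> \<^bold>+ w \<longleftrightarrow> b \<preceq> w"
    using assms by (simp add: m_comm[of \<u>])
  finally show ?thesis .
qed

lemma Gamma_lukasiewicz:
  assumes a: "a \<in> carrier (Gamma G)" and b: "b \<in> carrier (Gamma G)"
  shows "mv_plus (Gamma G) (mv_neg (Gamma G) (mv_plus (Gamma G) (mv_neg (Gamma G) a) b)) b =
    mv_plus (Gamma G) (mv_neg (Gamma G) (mv_plus (Gamma G) (mv_neg (Gamma G) b) a)) a"
proof -
  define J where "J a b = \<u> \<^bold>+ \<^bold>- ((\<u> \<^bold>+ \<^bold>- a \<^bold>+ b) \<^bold>\<and> \<u>) \<^bold>+ b" for a b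
  have ab: "a \<in> carrier G" "b \<in> carrier G" "a \<preceq> \<u>" "b \<preceq> \<u>"
    using a b by (auto simp: carrier_Gamma)
  have cl: "J a b \<in> carrier G" "J b a \<in> carrier G"
    using ab by (auto simp: J_def)
  have J: "J a b \<preceq> w \<longleftrightarrow> a \<preceq> w \<and> b \<preceq> w" "J b a \<preceq> w \<longleftrightarrow> a \<preceq> w \<and> b \<preceq> w" if "w \<in> carrier G" for w
    using Gamma_join[of a b w] Gamma_join[of b a w] ab that by (auto simp: J_def)
  have "J a b = J b a"
    using J cl by (meson le_antisym le_refl)
  then show ?thesis
    by (simp add: Gamma_plus Gamma_neg J_def)
qed

theorem mv_algebra_Gamma: "mv_algebra (Gamma G)"
proof
  fix a b assume a: "a \<in> carrier (Gamma G)" and b: "b \<in> carrier (Gamma G)"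
  show "mv_plus (Gamma G) a b \<in> carrier (Gamma G)"
    using a b by (auto simp: carrier_Gamma Gamma_plus le_meet_iff mult_nonneg)
  show "mv_plus (Gamma G) a b = mv_plus (Gamma G) b a"
    using a b by (simp add: carrier_Gamma Gamma_plus m_comm)
  show "mv_plus (Gamma G) (mv_neg (Gamma G) (mv_plus (Gamma G) (mv_neg (Gamma G) a) b)) b =
    mv_plus (Gamma G) (mv_neg (Gamma G) (mv_plus (Gamma G) (mv_neg (Gamma G) b) a)) a"
    using a b by (rule Gamma_lukasiewicz)
  fix c assume c: "c \<in> carrier (Gamma G)"
  have "mv_plus (Gamma G) (mv_plus (Gamma G) a b) c = (a \<^bold>+ b \<^bold>+ c) \<^bold>\<and> \<u>"
    using a b c by (simp add: carrier_Gamma Gamma_plus meet_mult_meet_unit)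
  also have "\<dots> = ((b \<^bold>+ c) \<^bold>+ a) \<^bold>\<and> \<u>"
    using a b c by (simp add: carrier_Gamma m_ac)
  also have "\<dots> = mv_plus (Gamma G) a (mv_plus (Gamma G) b c)"
    using a b c by (simp add: carrier_Gamma Gamma_plus m_comm[of a] meet_mult_meet_unit)
  finally show "mv_plus (Gamma G) (mv_plus (Gamma G) a b) c =
    mv_plus (Gamma G) a (mv_plus (Gamma G) b c)" .
next
  fix a assume a: "a \<in> carrier (Gamma G)"
  then show "mv_neg (Gamma G) a \<in> carrier (Gamma G)"
    by (simp add: carrier_Gamma Gamma_neg le_diff_iff diff_le_iff le_mult_nonneg)
  show "mv_plus (Gamma G) a (mv_zero (Gamma G)) = a"
    using a by (simp add: carrier_Gamma Gamma_plus meet_absorb)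
  show "mv_neg (Gamma G) (mv_neg (Gamma G) a) = a"
    using a by (simp add: carrier_Gamma Gamma_neg inv_mult m_assoc[symmetric])
  show "mv_plus (Gamma G) a (mv_one (Gamma G)) = mv_one (Gamma G)"
  proof -
    have "\<u> \<preceq> a \<^bold>+ \<u>"
      using a le_mult_nonneg[of \<u> a] by (simp add: carrier_Gamma m_comm[of a])
    then show ?thesis
      using a by (intro le_antisym) (auto simp: carrier_Gamma Gamma_plus le_meet_iff)
  qed
qed (simp add: carrier_Gamma)

text \<open>The product vanishes when the negations add up to at least the unit, and in the group
  this rearranges to a bound on the sum of \<open>a\<close> and \<open>b\<close>. Orthogonal pairs
  are those whose sum is not truncated.\<close>

lemma Gamma_times_eq_zero_iff:
  assumes "a \<in> carrier (Gamma G)" "b \<in> carrier (Gamma G)"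
  shows "mv_times (Gamma G) a b = \<^bold>0 \<longleftrightarrow> a \<^bold>+ b \<preceq> \<u>"
proof -
  have cl: "a \<in> carrier G" "b \<in> carrier G" using assms by (auto simp: carrier_Gamma)
  let ?x = "(\<u> \<^bold>+ \<^bold>- a) \<^bold>+ (\<u> \<^bold>+ \<^bold>- b)"
  have "mv_times (Gamma G) a b = \<^bold>0 \<longleftrightarrow> \<u> \<^bold>+ \<^bold>- (?x \<^bold>\<and> \<u>) = \<^bold>0"
    by (simp add: mv_times_def Gamma_neg Gamma_plus)
  also have "\<dots> \<longleftrightarrow> ?x \<^bold>\<and> \<u> = \<u>"
    using cl by (metis inv_closed inv_inv inv_solve_right l_one m_closed meet_closed r_inv unit_closed)
  also have "\<dots> \<longleftrightarrow> \<u> \<preceq> ?x"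
  proof
    assume "?x \<^bold>\<and> \<u> = \<u>"
    then show "\<u> \<preceq> ?x" using meet_le1[of ?x \<u>] cl by simp
  next
    assume "\<u> \<preceq> ?x"
    then show "?x \<^bold>\<and> \<u> = \<u>"
      using cl by (intro le_antisym) (auto simp: le_meet_iff)
  qed
  also have "?x = (\<u> \<^bold>+ \<u>) \<^bold>+ \<^bold>- (a \<^bold>+ b)"
    using cl by (simp add: inv_mult m_ac)
  also have "\<u> \<preceq> \<dots> \<longleftrightarrow> (a \<^bold>+ b) \<^bold>+ \<u> \<preceq> \<u> \<^bold>+ \<u>"
    using cl by (simp add: le_diff_iff m_comm[of \<u> "a \<^bold>+ b"])
  also have "\<dots> \<longleftrightarrow> a \<^bold>+ b \<preceq> \<u>"
    using cl by simp
  finally show ?thesis .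
qed

end

text \<open>By definition additivity of \<open>s\<close> is tested in the group built from
  \<open>Gamma G\<close>. It can be tested in \<open>G\<close> itself, because orthogonality means
  that the sum in \<open>G\<close> stays below the unit.\<close>

lemma mv_state_into_Gamma_iff:
  assumes "mv_algebra M" "unital_l_group G"
  shows "mv_state M (Gamma G) s \<longleftrightarrow>
    s \<in> carrier M \<rightarrow> carrier (Gamma G) \<and> s (mv_one M) = ounit G \<and>
    (\<forall>a\<in>carrier M. \<forall>b\<in>carrier M. mv_times M a b = mv_zero M \<longrightarrow>
       s (mv_plus M a b) = s a \<otimes>\<^bsub>G\<^esub> s b)"
proof -
  interpret M: mv_algebra M by fact
  interpret G: unital_l_group G by fact
  have *: "mv_times (Gamma G) (s a) (s b) = \<one>\<^bsub>G\<^esub> \<and> s c = mv_plus (Gamma G) (s a) (s b) \<longleftrightarrow>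
      s c = s a \<otimes>\<^bsub>G\<^esub> s b"
    if "s a \<in> carrier (Gamma G)" "s b \<in> carrier (Gamma G)" "s c \<in> carrier (Gamma G)" for a b c
    using that by (auto simp: G.Gamma_times_eq_zero_iff G.Gamma_plus G.meet_absorb G.carrier_Gamma)
  show ?thesis
    unfolding mv_state_iff[OF assms(1) G.mv_algebra_Gamma]
    using * M.plus_closed by (simp add: Pi_iff cong: conj_cong)
qed

lemma mv_state_Gamma_iff:
  assumes "unital_l_group G" "unital_l_group H"
  shows "mv_state (Gamma G) (Gamma H) s \<longleftrightarrow>
    s \<in> carrier (Gamma G) \<rightarrow> carrier (Gamma H) \<and> s (ounit G) = ounit H \<and>
    (\<forall>a\<in>carrier (Gamma G). \<forall>b\<in>carrier (Gamma G). a \<otimes>\<^bsub>G\<^esub> b \<in> carrier (Gamma G) \<longrightarrow>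
       s (a \<otimes>\<^bsub>G\<^esub> b) = s a \<otimes>\<^bsub>H\<^esub> s b)"
proof -
  interpret G: unital_l_group G by fact
  have "a \<otimes>\<^bsub>G\<^esub> b \<in> carrier (Gamma G) \<longleftrightarrow> mv_times (Gamma G) a b = \<one>\<^bsub>G\<^esub>"
    if "a \<in> carrier (Gamma G)" "b \<in> carrier (Gamma G)" for a b
    using that by (auto simp: G.Gamma_times_eq_zero_iff G.carrier_Gamma G.mult_nonneg)
  moreover have "mv_plus (Gamma G) a b = a \<otimes>\<^bsub>G\<^esub> b"
    if "a \<otimes>\<^bsub>G\<^esub> b \<in> carrier (Gamma G)" for a b
    using that by (simp add: G.carrier_Gamma G.Gamma_plus G.meet_absorb)
  ultimately show ?thesis
    unfolding mv_state_into_Gamma_iff[OF G.mv_algebra_Gamma assms(2)] by (auto simp: Pi_iff)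
qed

section \<open>Extending additive maps from an MV-algebra to its group\<close>

locale positive_valuation =
  mv_algebra M + H: unital_l_group H for M :: "'a mv" and H :: "'b ulgroup" +
  fixes v :: "'a \<Rightarrow> 'b"
  assumes v_closed [simp]: "a \<in> carrier M \<Longrightarrow> v a \<in> carrier H"
    and v_nonneg [simp]: "a \<in> carrier M \<Longrightarrow> lg_le H \<one>\<^bsub>H\<^esub> (v a)"
    and v_plus: "a \<in> carrier M \<Longrightarrow> b \<in> carrier M \<Longrightarrow> a \<odot> b = \<O> \<Longrightarrow> v (a \<oplus> b) = v a \<otimes>\<^bsub>H\<^esub> v b"
begin

primrec vsum :: "(nat \<Rightarrow> 'a) \<Rightarrow> nat \<Rightarrow> 'b" where
  "vsum a 0 = \<one>\<^bsub>H\<^esub>"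
| "vsum a (Suc n) = vsum a n \<otimes>\<^bsub>H\<^esub> v (a n)"

definition vhat :: "(nat \<Rightarrow> 'a) \<Rightarrow> 'b" where
  "vhat a = vsum a (LEAST n. \<forall>i\<ge>n. a i = \<O>)"

definition extension :: "'a gdiff \<Rightarrow> 'b" where
  "extension X = (case SOME p. p \<in> X of (a, b) \<Rightarrow> vhat a \<otimes>\<^bsub>H\<^esub> inv\<^bsub>H\<^esub> vhat b)"

lemma v_zero [simp]: "v \<O> = \<one>\<^bsub>H\<^esub>"
  using v_plus[of \<O> \<O>] by simp

text \<open>Let \<open>?d\<close> be the part of \<open>y\<close> that fits on top of
  \<open>x\<close>. Then \<open>x \<oplus> y\<close> is \<open>x\<close> plus \<open>?d\<close>, and
  \<open>y\<close> is \<open>?d\<close> plus \<open>x \<odot> y\<close>; both decompositions are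
  orthogonal, so \<open>v\<close> is additive on them.\<close>

lemma v_plus_times:
  assumes x: "x \<in> carrier M" and y: "y \<in> carrier M"
  shows "v (x \<oplus> y) \<otimes>\<^bsub>H\<^esub> v (x \<odot> y) = v x \<otimes>\<^bsub>H\<^esub> v y"
proof -
  let ?d = "y \<^bold>\<and> \<sim> x"
  have "x \<odot> ?d \<preceq> x \<odot> \<sim> x"
    using x y by (intro times_mono) auto
  then have 1: "v (x \<oplus> y) = v x \<otimes>\<^bsub>H\<^esub> v ?d"
    using x y v_plus[of x ?d] by (simp add: le_zero plus_meet_neg)
  have "?d \<odot> (x \<odot> y) \<preceq> \<sim> x \<odot> x"
    using x y by (intro times_mono) auto
  then have "v y = v ?d \<otimes>\<^bsub>H\<^esub> v (x \<odot> y)"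
    using x y v_plus[of ?d "x \<odot> y"] meet_plus_times[of y x] by (simp add: le_zero times_commute[of y x])
  then show ?thesis
    using 1 x y by (simp add: H.m_assoc)
qed

lemma vsum_closed [simp]: "a \<in> good_seqs M \<Longrightarrow> vsum a n \<in> carrier H"
  by (induction n) auto

lemma vhat_eq:
  assumes a: "a \<in> good_seqs M" and n: "\<forall>i\<ge>n. a i = \<O>"
  shows "vhat a = vsum a n"
proof -
  define m where "m = (LEAST n. \<forall>i\<ge>n. a i = \<O>)"
  have m: "\<forall>i\<ge>m. a i = \<O>"
    unfolding m_def using n by (rule LeastI)
  have "m \<le> n"
    unfolding m_def using n by (rule Least_le)
  then have "vsum a n = vsum a m"
  proof (induction n rule: dec_induct)
    case (step k)
    then show ?case using a m by simp
  qed simp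
  then show ?thesis by (simp add: vhat_def m_def)
qed

lemma vhat_closed [simp]: "a \<in> good_seqs M \<Longrightarrow> vhat a \<in> carrier H"
  by (simp add: vhat_def)

text \<open>The extra term on the left is the carry about to enter entry \<open>n\<close>;
  \<open>v_plus_times\<close> trades it for the change of that entry and the next carry. At
  \<open>n = 0\<close> the carry is \<open>b\<close> itself, as \<open>shift a 0\<close> is
  1.\<close>

lemma vsum_add_elt:
  assumes a: "a \<in> good_seqs M" and b: "b \<in> carrier M"
  shows "vsum (add_elt b a) n \<otimes>\<^bsub>H\<^esub> v (shift a n \<odot> b) = vsum a n \<otimes>\<^bsub>H\<^esub> v b"
proof (induction n)
  case (Suc n)
  let ?k = "shift a n \<odot> b"
  have "a n \<odot> b = a n \<odot> ?k"
    using a b good_iff_times[of "shift a n" "a n"]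
    by (simp add: times_assoc[symmetric] times_commute[of "a n" "shift a n"])
  then have "vsum (add_elt b a) (Suc n) \<otimes>\<^bsub>H\<^esub> v (shift a (Suc n) \<odot> b) =
      vsum (add_elt b a) n \<otimes>\<^bsub>H\<^esub> (v (a n \<oplus> ?k) \<otimes>\<^bsub>H\<^esub> v (a n \<odot> ?k))"
    using a b by (simp add: add_elt_def[of b a n] H.m_assoc)
  also have "\<dots> = vsum (add_elt b a) n \<otimes>\<^bsub>H\<^esub> v ?k \<otimes>\<^bsub>H\<^esub> v (a n)"
    using a b by (simp add: v_plus_times H.m_ac)
  also have "\<dots> = vsum a (Suc n) \<otimes>\<^bsub>H\<^esub> v b"
    using a b by (simp add: Suc H.m_ac)
  finally show ?case .
qed (use b in simp)

lemma vhat_add_elt: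
  assumes a: "a \<in> good_seqs M" and b: "b \<in> carrier M"
  shows "vhat (add_elt b a) = vhat a \<otimes>\<^bsub>H\<^esub> v b"
proof -
  obtain n where n: "\<forall>i\<ge>n. a i = \<O>"
    using good_seqs_bound[OF a] .
  then have z: "\<forall>i\<ge>Suc n. a i = \<O>" "\<forall>i\<ge>Suc n. add_elt b a i = \<O>"
    using b by (auto simp: add_elt_def shift_def split: nat.split)
  \<comment> \<open>At \<open>Suc n\<close> the remaining carry is \<open>a n \<odot> b\<close>,
    which is zero.\<close>
  have "vsum (add_elt b a) (Suc n) = vsum a (Suc n) \<otimes>\<^bsub>H\<^esub> v b"
    using vsum_add_elt[OF a b, of "Suc n"] n a b by (simp del: vsum.simps)
  then show ?thesis
    using a b z by (simp add: vhat_eq[of _ "Suc n"] del: vsum.simps)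
qed

lemma vhat_plus:
  assumes a: "a \<in> good_seqs M" and b: "b \<in> good_seqs M"
  shows "vhat (gs_plus M a b) = vhat a \<otimes>\<^bsub>H\<^esub> vhat b"
proof -
  obtain n where n: "\<forall>i\<ge>n. b i = \<O>"
    using good_seqs_bound[OF b] .
  have "vhat (add_elts a b k) = vhat a \<otimes>\<^bsub>H\<^esub> vsum b k" for k
    by (induction k) (use a b in \<open>auto simp: vhat_add_elt H.m_assoc\<close>)
  then show ?thesis
    using a b n by (simp add: gs_plus_eq_add_elts[of a b n] vhat_eq[of b n])
qed

lemma v_mono:
  assumes "a \<in> carrier M" "b \<in> carrier M" "mv_le M a b"
  shows "lg_le H (v a) (v b)"
proof -
  have "a \<odot> (b \<odot> \<sim> a) = \<O>"
    using assms by (simp add: times_left_commute[of a b])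
  then have "v b = v a \<otimes>\<^bsub>H\<^esub> v (b \<odot> \<sim> a)"
    using assms v_plus[of a "b \<odot> \<sim> a"] by (simp add: le_plus_diff)
  then show ?thesis
    using assms by (simp add: H.le_mult_nonneg)
qed

lemma vhat_mono:
  assumes a: "a \<in> good_seqs M" and b: "b \<in> good_seqs M" and le: "gs_le M a b"
  shows "lg_le H (vhat a) (vhat b)"
proof -
  obtain m n where "\<forall>i\<ge>m. a i = \<O>" "\<forall>i\<ge>n. b i = \<O>"
    using a b by (meson good_seqs_bound)
  then have "vhat a = vsum a (max m n)" "vhat b = vsum b (max m n)"
    using a b by (auto intro: vhat_eq)
  moreover have "lg_le H (vsum a k) (vsum b k)" for k
    using a b le by (induction k) (auto simp: gs_le_def intro!: H.mult_mono v_mono)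
  ultimately show ?thesis by simp
qed

section \<open>Extension to formal differences\<close>

lemma extension_gdiff:
  assumes a: "a \<in> good_seqs M" and b: "b \<in> good_seqs M"
  shows "extension (gdiff M a b) = vhat a \<otimes>\<^bsub>H\<^esub> inv\<^bsub>H\<^esub> vhat b"
proof -
  let ?p = "SOME p. p \<in> gdiff M a b"
  have "(a, b) \<in> gdiff M a b"
    using a b by (simp add: in_gdiff_iff)
  then have "?p \<in> gdiff M a b" by (rule someI)
  moreover obtain c d where p: "?p = (c, d)" by (cases ?p)
  ultimately have cd: "c \<in> good_seqs M" "d \<in> good_seqs M" and eq: "gs_plus M a d = gs_plus M c b"
    by (auto simp: in_gdiff_iff)
  have eq': "vhat c \<otimes>\<^bsub>H\<^esub> vhat b = vhat a \<otimes>\<^bsub>H\<^esub> vhat d"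
    using a b cd arg_cong[OF eq, of vhat] by (simp add: vhat_plus)
  have "vhat c \<otimes>\<^bsub>H\<^esub> inv\<^bsub>H\<^esub> vhat d \<otimes>\<^bsub>H\<^esub> vhat b = vhat c \<otimes>\<^bsub>H\<^esub> vhat b \<otimes>\<^bsub>H\<^esub> inv\<^bsub>H\<^esub> vhat d"
    using a b cd by (simp add: H.m_ac)
  also have "\<dots> = vhat a"
    unfolding eq' using a cd by (simp add: H.m_assoc)
  finally have "vhat c \<otimes>\<^bsub>H\<^esub> inv\<^bsub>H\<^esub> vhat d = vhat a \<otimes>\<^bsub>H\<^esub> inv\<^bsub>H\<^esub> vhat b"
    using a b cd by (simp add: H.inv_solve_right)
  then show ?thesis by (simp add: extension_def p)
qed

lemma extension_hom: "extension \<in> hom (Xi M) H"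
proof (rule homI)
  fix X Y assume "X \<in> carrier (Xi M)" "Y \<in> carrier (Xi M)"
  then show "extension (X \<otimes>\<^bsub>Xi M\<^esub> Y) = extension X \<otimes>\<^bsub>H\<^esub> extension Y"
    by (elim XiE) (simp add: Xi_mult extension_gdiff vhat_plus H.inv_mult H.m_ac)
qed (auto elim!: XiE simp: extension_gdiff)

lemma vhat_const: "a \<in> carrier M \<Longrightarrow> vhat (gs_const M a) = v a"
  using vhat_eq[OF gs_const_good, of a 1] by (simp add: gs_const_def)

lemma extension_embed: "a \<in> carrier M \<Longrightarrow> extension (Xi_embed M a) = v a"
  by (simp add: Xi_embed_def extension_gdiff vhat_const)

lemma extension_nonneg:
  assumes "X \<in> carrier (Xi M)" "lg_le (Xi M) \<one>\<^bsub>Xi M\<^esub> X"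
  shows "lg_le H \<one>\<^bsub>H\<^esub> (extension X)"
proof -
  obtain a b where S: "a \<in> good_seqs M" "b \<in> good_seqs M" and X: "X = gdiff M a b"
    using assms(1) by (rule XiE)
  have "gs_le M b a"
    using S assms(2) by (simp add: X Xi_one Xi_le gs_zero_plus gs_plus_zero)
  then show ?thesis
    using S by (simp add: X extension_gdiff H.le_diff_iff vhat_mono)
qed

lemma extension_state: "v \<I> = ounit H \<Longrightarrow> lg_state (Xi M) H extension"
  by (auto simp: lg_state_def extension_hom extension_nonneg extension_embed
      simp flip: Xi_embed_one)

end

section \<open>The canonical map from the group of the unit interval\<close>

context unital_l_group
begin

interpretation Gam: mv_algebra "Gamma G"
  by (rule mv_algebra_Gamma)

interpretation Gam: positive_valuation "Gamma G" G "\<lambda>x. x"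
proof
  fix a b assume "a \<in> carrier (Gamma G)" "b \<in> carrier (Gamma G)" "mv_times (Gamma G) a b = mv_zero (Gamma G)"
  then show "mv_plus (Gamma G) a b = a \<otimes>\<^bsub>G\<^esub> b"
    by (simp add: Gamma_times_eq_zero_iff Gamma_plus meet_absorb carrier_Gamma)
qed (auto simp: carrier_Gamma)

declare Gam.v_closed [simp del] Gam.v_nonneg [simp del]

definition counit :: "'a gdiff \<Rightarrow> 'a" where
  "counit = Gam.extension"

lemma counit_state: "lg_state (Xi (Gamma G)) G counit"
  unfolding counit_def by (rule Gam.extension_state) simp

lemma counit_embed: "a \<in> carrier (Gamma G) \<Longrightarrow> counit (Xi_embed (Gamma G) a) = a"
  unfolding counit_def by (rule Gam.extension_embed)

section \<open>Recovering a good sequence from its sum\<close>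

lemma Gamma_le_iff:
  assumes "a \<in> carrier (Gamma G)" "b \<in> carrier (Gamma G)"
  shows "mv_le (Gamma G) a b \<longleftrightarrow> lg_le G a b"
proof -
  have cl: "a \<in> carrier G" "b \<in> carrier G" using assms by (auto simp: carrier_Gamma)
  have "mv_le (Gamma G) a b \<longleftrightarrow> lg_le G (a \<otimes>\<^bsub>G\<^esub> (\<u> \<otimes>\<^bsub>G\<^esub> inv\<^bsub>G\<^esub> b)) \<u>"
    using assms Gam.neg_closed[of b] by (simp add: Gam.le_iff_times Gamma_times_eq_zero_iff Gamma_neg)
  also have "a \<otimes>\<^bsub>G\<^esub> (\<u> \<otimes>\<^bsub>G\<^esub> inv\<^bsub>G\<^esub> b) = (a \<otimes>\<^bsub>G\<^esub> \<u>) \<otimes>\<^bsub>G\<^esub> inv\<^bsub>G\<^esub> b"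
    using cl by (simp add: m_assoc)
  also have "lg_le G \<dots> \<u> \<longleftrightarrow> lg_le G a b"
    using cl by (simp add: diff_le_iff m_comm[of \<u> b])
  finally show ?thesis .
qed

lemma good_seqs_Gamma_tail:
  assumes "a \<in> good_seqs (Gamma G)"
  shows "(\<lambda>i. a (Suc i)) \<in> good_seqs (Gamma G)"
proof -
  obtain n where "\<forall>i\<ge>n. a i = mv_zero (Gamma G)"
    using Gam.good_seqs_bound[OF assms] .
  then show ?thesis
    using assms by (intro Gam.good_seqsI[of _ n]) (auto simp: Gam.good_seqs_good)
qed

lemma good_seqs_Gamma_closed [simp]:
  assumes "a \<in> good_seqs (Gamma G)"
  shows "a i \<in> carrier G" "lg_le G \<one>\<^bsub>G\<^esub> (a i)" "lg_le G (a i) \<u>"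
  using Gam.good_seqs_closed[OF assms, of i] by (auto simp: carrier_Gamma)

lemma vsum_Suc_front:
  assumes a: "a \<in> good_seqs (Gamma G)"
  shows "Gam.vsum a (Suc n) = a 0 \<otimes>\<^bsub>G\<^esub> Gam.vsum (\<lambda>i. a (Suc i)) n"
proof (induction n)
  case (Suc n)
  then show ?case
    using a good_seqs_Gamma_tail[OF a] by (simp add: m_assoc)
qed (use a in simp)

text \<open>By \<open>meet_mult_meet_unit\<close> the partial sum may be truncated before the next
  entry is added, and \<open>a 0\<close> absorbs all later entries.\<close>

lemma vsum_meet_unit:
  assumes a: "a \<in> good_seqs (Gamma G)"
  shows "Gam.vsum a (Suc n) \<^bold>\<and> \<u> = a 0"
proof (induction n)
  case 0
  then show ?case using a by (simp add: meet_absorb)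
next
  case (Suc n)
  have "Gam.vsum a (Suc (Suc n)) \<^bold>\<and> \<u> = ((Gam.vsum a (Suc n) \<^bold>\<and> \<u>) \<otimes>\<^bsub>G\<^esub> a (Suc n)) \<^bold>\<and> \<u>"
    using a by (subst meet_mult_meet_unit) auto
  also have "\<dots> = mv_plus (Gamma G) (a 0) (a (Suc n))"
    by (simp only: Suc Gamma_plus)
  also have "\<dots> = a 0"
    using a by (simp add: Gam.good_seqs_absorb)
  finally show ?case .
qed

text \<open>
  The first entry of a good sequence with sum \<open>x\<close> is \<open>x \<and> u\<close>, and \<open>x - (x \<and> u)\<close> is monotone
  in \<open>x\<close>; hence the entries can be compared one after the other.
\<close>

lemma vsum_le_imp_le:
  assumes "a \<in> good_seqs (Gamma G)" "b \<in> good_seqs (Gamma G)"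
    and "lg_le G (Gam.vsum a n) (Gam.vsum b n)" and "i < n"
  shows "lg_le G (a i) (b i)"
  using assms
proof (induction n arbitrary: a b i)
  case (Suc n)
  note a = Suc.prems(1) and b = Suc.prems(2)
  define a' where "a' = (\<lambda>i. a (Suc i))"
  define b' where "b' = (\<lambda>i. b (Suc i))"
  define x where "x = Gam.vsum a (Suc n)"
  define y where "y = Gam.vsum b (Suc n)"
  have a': "a' \<in> good_seqs (Gamma G)" and b': "b' \<in> good_seqs (Gamma G)"
    using good_seqs_Gamma_tail a b by (auto simp: a'_def b'_def)
  have cl: "x \<in> carrier G" "y \<in> carrier G" "Gam.vsum a' n \<in> carrier G" "Gam.vsum b' n \<in> carrier G"
    "a 0 \<in> carrier G" "b 0 \<in> carrier G"
    using a b a' b' by (simp_all add: x_def y_def)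
  have xy: "lg_le G x y" using Suc.prems(3) by (simp only: x_def y_def)
  have a0: "x \<^bold>\<and> \<u> = a 0" and b0: "y \<^bold>\<and> \<u> = b 0"
    using vsum_meet_unit[OF a] vsum_meet_unit[OF b] by (simp_all only: x_def y_def)
  have x: "x = a 0 \<otimes>\<^bsub>G\<^esub> Gam.vsum a' n" and y: "y = b 0 \<otimes>\<^bsub>G\<^esub> Gam.vsum b' n"
    unfolding x_def y_def a'_def b'_def using a b by (simp_all only: vsum_Suc_front)
  have "lg_le G (x \<^bold>\<and> \<u>) (y \<^bold>\<and> \<u>)"
    using cl xy le_trans[of "x \<^bold>\<and> \<u>" x y] by (simp add: le_meet_iff)
  then have first: "lg_le G (a 0) (b 0)"
    by (simp add: a0 b0)
  \<comment> \<open>This is the monotonicity of \<open>x - (x \<and> u)\<close>, rearranged with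
    \<open>b 0\<close> for \<open>y \<and> u\<close>. Splitting the meet on the right leaves two
    inequalities, which follow from \<open>b 0\<close> being below \<open>y\<close> and from
    \<open>b 0\<close> being below the unit together with \<open>x\<close> below
    \<open>y\<close>.\<close>
  have "lg_le G (b 0 \<otimes>\<^bsub>G\<^esub> x) ((x \<^bold>\<and> \<u>) \<otimes>\<^bsub>G\<^esub> y)"
  proof -
    have "lg_le G (b 0) y" using meet_le1[of y \<u>] cl by (simp add: b0)
    then have "lg_le G (b 0 \<otimes>\<^bsub>G\<^esub> x) (x \<otimes>\<^bsub>G\<^esub> y)"
      using cl by (simp add: m_comm[of x y])
    moreover have "lg_le G (b 0 \<otimes>\<^bsub>G\<^esub> x) (\<u> \<otimes>\<^bsub>G\<^esub> y)"
      using cl b xy by (intro mult_mono) auto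
    ultimately show ?thesis
      using cl by (simp add: le_mult_meet_iff)
  qed
  then have "lg_le G (b 0 \<otimes>\<^bsub>G\<^esub> (a 0 \<otimes>\<^bsub>G\<^esub> Gam.vsum a' n)) (a 0 \<otimes>\<^bsub>G\<^esub> (b 0 \<otimes>\<^bsub>G\<^esub> Gam.vsum b' n))"
    by (simp only: a0 x[symmetric] y[symmetric])
  moreover have "b 0 \<otimes>\<^bsub>G\<^esub> (a 0 \<otimes>\<^bsub>G\<^esub> Gam.vsum a' n) = Gam.vsum a' n \<otimes>\<^bsub>G\<^esub> (a 0 \<otimes>\<^bsub>G\<^esub> b 0)"
    "a 0 \<otimes>\<^bsub>G\<^esub> (b 0 \<otimes>\<^bsub>G\<^esub> Gam.vsum b' n) = Gam.vsum b' n \<otimes>\<^bsub>G\<^esub> (a 0 \<otimes>\<^bsub>G\<^esub> b 0)"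
    using cl by (simp_all add: m_ac)
  ultimately have "lg_le G (Gam.vsum a' n) (Gam.vsum b' n)"
    using cl by simp
  then have "lg_le G (a' j) (b' j)" if "j < n" for j
    using Suc.IH[OF a' b' _ that] by simp
  then show ?case
    using first Suc.prems(4) by (cases i) (auto simp: a'_def b'_def)
qed simp

lemma vhat_le_iff:
  assumes a: "a \<in> good_seqs (Gamma G)" and b: "b \<in> good_seqs (Gamma G)"
  shows "lg_le G (Gam.vhat a) (Gam.vhat b) \<longleftrightarrow> gs_le (Gamma G) a b"
proof
  assume le: "lg_le G (Gam.vhat a) (Gam.vhat b)"
  obtain m n where mn: "\<forall>i\<ge>m. a i = mv_zero (Gamma G)" "\<forall>i\<ge>n. b i = mv_zero (Gamma G)"
    using a b by (meson Gam.good_seqs_bound)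
  have "lg_le G (a i) (b i)" for i
  proof (rule vsum_le_imp_le[OF a b])
    \<comment> \<open>\<open>Suc i\<close> is included so that entry \<open>i\<close> is covered
      even beyond both supports.\<close>
    let ?k = "max (max m n) (Suc i)"
    have "Gam.vhat a = Gam.vsum a ?k" "Gam.vhat b = Gam.vsum b ?k"
      using a b mn by (auto intro: Gam.vhat_eq)
    then show "lg_le G (Gam.vsum a ?k) (Gam.vsum b ?k)" using le by simp
    show "i < ?k" by simp
  qed
  then show "gs_le (Gamma G) a b"
    using a b by (simp add: gs_le_def Gamma_le_iff)
qed (rule Gam.vhat_mono[OF a b])

text \<open>Over a common denominator both orders are that of the numerators, by
  \<open>vhat_le_iff\<close>. Reflection of the order yields injectivity of \<open>counit\<close>
  and positivity of its inverse.\<close>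

lemma counit_le_iff:
  assumes "X \<in> carrier (Xi (Gamma G))" "Y \<in> carrier (Xi (Gamma G))"
  shows "lg_le G (counit X) (counit Y) \<longleftrightarrow> lg_le (Xi (Gamma G)) X Y"
proof -
  obtain a c b where S: "a \<in> good_seqs (Gamma G)" "c \<in> good_seqs (Gamma G)" "b \<in> good_seqs (Gamma G)"
    and XY: "X = gdiff (Gamma G) a b" "Y = gdiff (Gamma G) c b"
    using Gam.Xi_common_denominator[OF assms] .
  have "lg_le G (counit X) (counit Y) \<longleftrightarrow> lg_le G (Gam.vhat a) (Gam.vhat c)"
    using S by (simp add: XY counit_def Gam.extension_gdiff)
  also have "\<dots> \<longleftrightarrow> lg_le (Xi (Gamma G)) X Y"
    using S by (simp add: XY vhat_le_iff Gam.Xi_le Gam.gs_plus_le_iff)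
  finally show ?thesis .
qed

text \<open>From an \<open>x\<close> below \<open>n + 1\<close> units the meet \<open>?m\<close>
  with the unit is split off. The rest is nonnegative and below \<open>n\<close> units, since
  \<open>x\<close> is below \<open>x\<close> plus \<open>n\<close> units and below the unit plus
  \<open>n\<close> units.\<close>

lemma counit_surj_nonneg:
  assumes "x \<in> carrier G" "lg_le G \<one>\<^bsub>G\<^esub> x" "lg_le G x (\<u> [^]\<^bsub>G\<^esub> (n::nat))"
  shows "x \<in> counit ` carrier (Xi (Gamma G))"
  using assms
proof (induction n arbitrary: x)
  case 0
  then have "x = \<one>\<^bsub>G\<^esub>" by (intro le_antisym) auto
  then have "x = counit (Xi_embed (Gamma G) \<one>\<^bsub>G\<^esub>)"
    by (simp add: counit_embed carrier_Gamma)
  then show ?case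
    by (auto simp: carrier_Gamma)
next
  interpret Xi: comm_group "Xi (Gamma G)" by (rule Gam.comm_group_Xi)
  case (Suc n)
  let ?m = "x \<^bold>\<and> \<u>"
  let ?y = "x \<otimes>\<^bsub>G\<^esub> inv\<^bsub>G\<^esub> ?m"
  have m: "?m \<in> carrier (Gamma G)"
    using Suc.prems by (simp add: carrier_Gamma le_meet_iff)
  have "lg_le G x (?m \<otimes>\<^bsub>G\<^esub> \<u> [^]\<^bsub>G\<^esub> n)"
  proof -
    have "lg_le G \<one>\<^bsub>G\<^esub> (\<u> [^]\<^bsub>G\<^esub> n)"
      by (induction n) (auto intro: mult_nonneg)
    then show ?thesis
      using Suc.prems by (simp add: le_mult_meet_iff le_mult_nonneg m_comm[of _ \<u>])
  qed
  then have "?y \<in> counit ` carrier (Xi (Gamma G))"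
    using Suc.prems by (intro Suc.IH) (simp_all add: le_diff_iff diff_le_iff m_comm[of _ ?m])
  then obtain Y where Y: "Y \<in> carrier (Xi (Gamma G))" "?y = counit Y" by blast
  have "x = counit Y \<otimes>\<^bsub>G\<^esub> counit (Xi_embed (Gamma G) ?m)"
    using Suc.prems m by (simp add: counit_embed Y(2)[symmetric] m_assoc)
  also have "\<dots> = counit (Y \<otimes>\<^bsub>Xi (Gamma G)\<^esub> Xi_embed (Gamma G) ?m)"
    using counit_state Y m by (simp add: lg_state_def hom_mult[of counit _ G])
  finally show ?case
    using Y m Xi.m_closed[of Y "Xi_embed (Gamma G) ?m"] by simp
qed

lemma counit_bij: "bij_betw counit (carrier (Xi (Gamma G))) (carrier G)"
proof (rule bij_betw_imageI)
  interpret Xi: unital_l_group "Xi (Gamma G)" by (rule Gam.unital_l_group_Xi)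
  interpret hom: group_hom "Xi (Gamma G)" G counit
    using counit_state by unfold_locales (auto simp: lg_state_def)
  show "inj_on counit (carrier (Xi (Gamma G)))"
    by (rule inj_onI) (metis counit_le_iff Xi.le_antisym Xi.le_refl)
  have "x \<in> counit ` carrier (Xi (Gamma G))" if x: "x \<in> carrier G" for x
  proof -
    \<comment> \<open>\<open>m\<close> units outweigh the inverse of \<open>x\<close>, so
      \<open>x\<close> plus \<open>m\<close> units is nonnegative. That element and the
      \<open>m\<close> units are both in the image, hence so is their difference
      \<open>x\<close>.\<close>
    obtain m :: nat where m: "lg_le G (inv\<^bsub>G\<^esub> x) (\<u> [^]\<^bsub>G\<^esub> m)"
      using strong_unit[of "inv\<^bsub>G\<^esub> x"] x by auto
    let ?u = "\<u> [^]\<^bsub>G\<^esub> m"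
    obtain n :: nat where n: "lg_le G (x \<otimes>\<^bsub>G\<^esub> ?u) (\<u> [^]\<^bsub>G\<^esub> n)"
      using strong_unit[of "x \<otimes>\<^bsub>G\<^esub> ?u"] x by auto
    have "lg_le G \<one>\<^bsub>G\<^esub> (x \<otimes>\<^bsub>G\<^esub> ?u)"
      using m x diff_le_iff[of "\<one>\<^bsub>G\<^esub>" x ?u] by (simp add: m_comm)
    then obtain X where X: "X \<in> carrier (Xi (Gamma G))" "x \<otimes>\<^bsub>G\<^esub> ?u = counit X"
      using counit_surj_nonneg[OF _ _ n] x by auto
    have "lg_le G \<one>\<^bsub>G\<^esub> ?u"
      by (induction m) (auto intro: mult_nonneg)
    then obtain U where U: "U \<in> carrier (Xi (Gamma G))" "?u = counit U"
      using counit_surj_nonneg[of ?u m] by auto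
    have "counit (X \<otimes>\<^bsub>Xi (Gamma G)\<^esub> inv\<^bsub>Xi (Gamma G)\<^esub> U) = x"
      using X(1) U(1) x by (simp add: X(2)[symmetric] U(2)[symmetric] m_assoc)
    then show ?thesis
      using X U by (metis Xi.inv_closed Xi.m_closed image_eqI)
  qed
  then show "counit ` carrier (Xi (Gamma G)) = carrier G"
    by auto
qed

end

section \<open>Isomorphisms of unital lattice-ordered groups\<close>

text \<open>Nothing is assumed about \<open>H\<close>: the neutral element and both directions of
  the order are listed so that the structure of \<open>G\<close> can be transported to
  \<open>H\<close>.\<close>

definition lg_iso :: "'a ulgroup \<Rightarrow> 'b ulgroup \<Rightarrow> ('a \<Rightarrow> 'b) \<Rightarrow> bool" where
  "lg_iso G H f \<longleftrightarrow> bij_betw f (carrier G) (carrier H) \<and>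
     (\<forall>x\<in>carrier G. \<forall>y\<in>carrier G. f (x \<otimes>\<^bsub>G\<^esub> y) = f x \<otimes>\<^bsub>H\<^esub> f y) \<and>
     f \<one>\<^bsub>G\<^esub> = \<one>\<^bsub>H\<^esub> \<and> f (ounit G) = ounit H \<and>
     (\<forall>x\<in>carrier G. \<forall>y\<in>carrier G. lg_le H (f x) (f y) \<longleftrightarrow> lg_le G x y)"

lemma lg_iso_unital:
  assumes "unital_l_group G" and iso: "lg_iso G H f"
  shows "unital_l_group H"
proof -
  interpret G: unital_l_group G by fact
  have mult [simp]: "f x \<otimes>\<^bsub>H\<^esub> f y = f (x \<otimes>\<^bsub>G\<^esub> y)" if "x \<in> carrier G" "y \<in> carrier G" for x y
    using iso that by (simp add: lg_iso_def)
  have one [simp]: "\<one>\<^bsub>H\<^esub> = f \<one>\<^bsub>G\<^esub>" and unit [simp]: "ounit H = f (ounit G)"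
    using iso by (simp_all add: lg_iso_def)
  have le [simp]: "lg_le H (f x) (f y) \<longleftrightarrow> lg_le G x y" if "x \<in> carrier G" "y \<in> carrier G" for x y
    using iso that by (simp add: lg_iso_def)
  have H [simp]: "carrier H = f ` carrier G"
    using iso by (simp add: lg_iso_def bij_betw_def)
  have pow: "f (ounit G) [^]\<^bsub>H\<^esub> n = f (ounit G [^]\<^bsub>G\<^esub> n)" for n :: nat
  proof (induction n)
    case (Suc n)
    have "f (ounit G) [^]\<^bsub>H\<^esub> Suc n = f (ounit G) [^]\<^bsub>H\<^esub> n \<otimes>\<^bsub>H\<^esub> f (ounit G)"
      by (simp add: nat_pow_def)
    then show ?case by (simp add: Suc)
  qed (simp add: nat_pow_def)
  interpret L: lattice "lg_order G" by (rule G.lattice)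
  show ?thesis
  proof (rule unital_l_group.intro)
    show "comm_group H"
    proof (rule comm_groupI)
      fix x assume "x \<in> carrier H"
      then obtain z where "z \<in> carrier G" "x = f z" by auto
      then show "\<exists>y\<in>carrier H. y \<otimes>\<^bsub>H\<^esub> x = \<one>\<^bsub>H\<^esub>"
        by (auto intro!: bexI[of _ "inv\<^bsub>G\<^esub> z"])
    qed (auto simp: G.m_ac)
    show "lattice (lg_order H)"
    proof (rule lattice_lg_orderI)
      fix x y assume "x \<in> carrier H" "y \<in> carrier H"
      then obtain a b where ab: "a \<in> carrier G" "x = f a" "b \<in> carrier G" "y = f b" by auto
      show "\<exists>s\<in>carrier H. \<forall>z\<in>carrier H. lg_le H z s \<longleftrightarrow> lg_le H z x \<and> lg_le H z y"
        using ab by (intro bexI[of _ "f (a \<sqinter>\<^bsub>lg_order G\<^esub> b)"]) (auto simp: G.le_meet_iff)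
      have "lg_le G (a \<squnion>\<^bsub>lg_order G\<^esub> b) c \<longleftrightarrow> lg_le G a c \<and> lg_le G b c" if "c \<in> carrier G" for c
        using L.join_left[of a b] L.join_right[of a b] L.join_le[of a c b] L.join_closed[of a b] ab that
        by (auto intro: G.le_trans)
      then show "\<exists>s\<in>carrier H. \<forall>z\<in>carrier H. lg_le H s z \<longleftrightarrow> lg_le H x z \<and> lg_le H y z"
        using ab L.join_closed[of a b]
        by (intro bexI[of _ "f (a \<squnion>\<^bsub>lg_order G\<^esub> b)"]) auto
    qed (auto intro: G.le_trans dest: G.le_antisym)
  next
    fix x assume "x \<in> carrier H"
    then obtain z where z: "z \<in> carrier G" "x = f z" by auto
    then obtain n :: nat where "lg_le G z (ounit G [^]\<^bsub>G\<^esub> n)"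
      using G.strong_unit by blast
    then show "\<exists>n::nat. lg_le H x (ounit H [^]\<^bsub>H\<^esub> n)"
      using z by (auto simp: pow)
  qed auto
qed

lemma lg_iso_state: "unital_l_group G \<Longrightarrow> lg_iso G H f \<Longrightarrow> lg_state G H f"
proof -
  assume "unital_l_group G" and iso: "lg_iso G H f"
  then interpret G: unital_l_group G by simp
  have "lg_le H \<one>\<^bsub>H\<^esub> (f x)" if "x \<in> carrier G" "lg_le G \<one>\<^bsub>G\<^esub> x" for x
    using iso that G.one_closed unfolding lg_iso_def by metis
  then show "lg_state G H f"
    using iso by (auto simp: lg_state_def lg_iso_def hom_def dest: bij_betwE)
qed

lemma lg_iso_inv:
  assumes "unital_l_group G" and iso: "lg_iso G H f"
  shows "lg_iso H G (inv_into (carrier G) f)"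
proof -
  interpret G: unital_l_group G by fact
  have inj: "inj_on f (carrier G)" and H: "carrier H = f ` carrier G"
    using iso by (auto simp: lg_iso_def bij_betw_def)
  have inv [simp]: "inv_into (carrier G) f (f x) = x" if "x \<in> carrier G" for x
    using inj that by simp
  have "inv_into (carrier G) f (f x \<otimes>\<^bsub>H\<^esub> f y) = x \<otimes>\<^bsub>G\<^esub> y" if "x \<in> carrier G" "y \<in> carrier G" for x y
    using iso that inv[of "x \<otimes>\<^bsub>G\<^esub> y"] by (simp add: lg_iso_def)
  moreover have "inv_into (carrier G) f \<one>\<^bsub>H\<^esub> = \<one>\<^bsub>G\<^esub>" "inv_into (carrier G) f (ounit H) = ounit G"
    using iso inv[of "\<one>\<^bsub>G\<^esub>"] inv[of "ounit G"] by (simp_all add: lg_iso_def)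
  moreover have "bij_betw (inv_into (carrier G) f) (carrier H) (carrier G)"
    using iso by (simp add: lg_iso_def bij_betw_inv_into)
  ultimately show ?thesis
    using iso by (auto simp: lg_iso_def H)
qed

lemma lg_iso_comp: "lg_iso G H f \<Longrightarrow> lg_iso H K g \<Longrightarrow> lg_iso G K (g \<circ> f)"
  unfolding lg_iso_def by (auto intro: bij_betw_trans dest: bij_betwE)

lemma lg_state_cong:
  assumes "unital_l_group G" "\<And>x. x \<in> carrier G \<Longrightarrow> s x = t x"
  shows "lg_state G H s \<longleftrightarrow> lg_state G H t"
proof -
  interpret G: unital_l_group G by fact
  show ?thesis
    using assms(2) by (auto simp: lg_state_def hom_def Pi_iff)
qed

lemma lg_state_comp:
  assumes "lg_state G H s" "lg_state H K t"
  shows "lg_state G K (t \<circ> s)"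
  using assms by (auto simp: lg_state_def hom_def Pi_iff)

lemma lg_iso_image:
  assumes "inj_on f (carrier G)" "unital_l_group G"
  shows "lg_iso G (lg_image f G) f"
proof -
  interpret G: unital_l_group G by fact
  show ?thesis
    using assms(1) by (auto simp: lg_iso_def lg_image_def Let_def bij_betw_def)
qed

lemma (in unital_l_group) lg_iso_counit: "lg_iso (Xi (Gamma G)) G counit"
proof -
  interpret Gam: mv_algebra "Gamma G" by (rule mv_algebra_Gamma)
  interpret Xi: unital_l_group "Xi (Gamma G)" by (rule Gam.unital_l_group_Xi)
  have "counit \<one>\<^bsub>Xi (Gamma G)\<^esub> = \<one>\<^bsub>G\<^esub>"
    using counit_state by (simp add: lg_state_def hom_one[OF _ Xi.is_group is_group])
  then show ?thesis
    using counit_state by (auto simp: lg_iso_def lg_state_def hom_mult counit_bij counit_le_iff)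
qed

section \<open>The group inside the universe\<close>

context
  fixes M :: "'u::infinite mv"
  assumes M: "mv_algebra M"
begin

interpretation M: mv_algebra M by (rule M)

lemma lg_iso_Xi_code: "lg_iso (Xi M) (Xi_ob M) (Xi_code M)"
  unfolding Xi_ob_def by (rule lg_iso_image[OF Xi_code_inj M.unital_l_group_Xi])

lemma unital_l_group_Xi_ob: "unital_l_group (Xi_ob M)"
  by (rule lg_iso_unital[OF M.unital_l_group_Xi lg_iso_Xi_code])

lemma Xi_ob_embed_closed: "a \<in> carrier M \<Longrightarrow> Xi_ob_embed M a \<in> carrier (Xi_ob M)"
  using lg_iso_Xi_code by (auto simp: lg_iso_def Xi_ob_embed_def dest: bij_betwE)

lemma Xi_ob_embed_inject:
  assumes "a \<in> carrier M" "b \<in> carrier M"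
  shows "Xi_ob_embed M a = Xi_ob_embed M b \<longleftrightarrow> a = b"
proof -
  have "inj_on (Xi_code M) (carrier (Xi M))"
    by (rule Xi_code_inj)
  then show ?thesis
    using assms by (simp add: Xi_ob_embed_def inj_on_eq_iff M.Xi_embed_inject)
qed

lemma Xi_ob_embed_one: "Xi_ob_embed M (mv_one M) = ounit (Xi_ob M)"
  using lg_iso_Xi_code by (simp add: Xi_ob_embed_def M.Xi_embed_one lg_iso_def)

lemma Xi_ob_embed_image: "Xi_ob_embed M ` carrier M = carrier (Gamma (Xi_ob M))"
proof -
  interpret Xi: unital_l_group "Xi M" by (rule M.unital_l_group_Xi)
  interpret Xo: unital_l_group "Xi_ob M" by (rule unital_l_group_Xi_ob)
  have le: "lg_le (Xi_ob M) (Xi_code M x) (Xi_code M y) \<longleftrightarrow> lg_le (Xi M) x y"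
    if "x \<in> carrier (Xi M)" "y \<in> carrier (Xi M)" for x y
    using lg_iso_Xi_code that by (simp add: lg_iso_def)
  have "Xi_ob_embed M ` carrier M = Xi_code M ` Xi_embed M ` carrier M"
    by (auto simp: Xi_ob_embed_def)
  also have "\<dots> = {y \<in> Xi_code M ` carrier (Xi M). lg_le (Xi_ob M) (Xi_code M \<one>\<^bsub>Xi M\<^esub>) y \<and>
      lg_le (Xi_ob M) y (Xi_code M (ounit (Xi M)))}"
    by (auto simp: M.Xi_embed_image le)
  also have "\<dots> = carrier (Gamma (Xi_ob M))"
    using lg_iso_Xi_code by (simp add: Xo.carrier_Gamma lg_iso_def bij_betw_def)
  finally show ?thesis .
qed

text \<open>A sum in the unit interval is the image of some \<open>c\<close>; injectivity of the
  code pulls this back to \<open>Xi M\<close>, where the sum is embedded only if the carry vanishes.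
  The embedding thus reflects the partial addition, as its inverse needs for being a state.\<close>

lemma Xi_ob_embed_plus_closed_iff:
  assumes "a \<in> carrier M" "b \<in> carrier M"
  shows "Xi_ob_embed M a \<otimes>\<^bsub>Xi_ob M\<^esub> Xi_ob_embed M b \<in> carrier (Gamma (Xi_ob M)) \<longleftrightarrow>
    mv_times M a b = mv_zero M"
    and Xi_ob_embed_plus: "mv_times M a b = mv_zero M \<Longrightarrow>
      Xi_ob_embed M (mv_plus M a b) = Xi_ob_embed M a \<otimes>\<^bsub>Xi_ob M\<^esub> Xi_ob_embed M b"
proof -
  interpret Xi: unital_l_group "Xi M" by (rule M.unital_l_group_Xi)
  have mult: "Xi_ob_embed M a \<otimes>\<^bsub>Xi_ob M\<^esub> Xi_ob_embed M b =
      Xi_code M (Xi_embed M a \<otimes>\<^bsub>Xi M\<^esub> Xi_embed M b)"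
    using lg_iso_Xi_code assms by (simp add: lg_iso_def Xi_ob_embed_def)
  show plus: "Xi_ob_embed M (mv_plus M a b) = Xi_ob_embed M a \<otimes>\<^bsub>Xi_ob M\<^esub> Xi_ob_embed M b"
    if "mv_times M a b = mv_zero M"
    unfolding mult unfolding Xi_ob_embed_def
    using assms that M.Xi_embed_mult_eq_iff[of a b "mv_plus M a b"] by simp
  show "Xi_ob_embed M a \<otimes>\<^bsub>Xi_ob M\<^esub> Xi_ob_embed M b \<in> carrier (Gamma (Xi_ob M)) \<longleftrightarrow>
    mv_times M a b = mv_zero M"
  proof
    assume "Xi_ob_embed M a \<otimes>\<^bsub>Xi_ob M\<^esub> Xi_ob_embed M b \<in> carrier (Gamma (Xi_ob M))"
    then obtain c where c: "c \<in> carrier M" and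
      eq: "Xi_code M (Xi_embed M c) = Xi_code M (Xi_embed M a \<otimes>\<^bsub>Xi M\<^esub> Xi_embed M b)"
      unfolding mult by (auto simp: Xi_ob_embed_image[symmetric] Xi_ob_embed_def)
    have "Xi_embed M c = Xi_embed M a \<otimes>\<^bsub>Xi M\<^esub> Xi_embed M b"
      using inj_onD[OF Xi_code_inj eq] assms c by simp
    then show "mv_times M a b = mv_zero M"
      using assms c by (simp add: M.Xi_embed_mult_eq_iff)
  next
    assume "mv_times M a b = mv_zero M"
    then show "Xi_ob_embed M a \<otimes>\<^bsub>Xi_ob M\<^esub> Xi_ob_embed M b \<in> carrier (Gamma (Xi_ob M))"
      using assms plus by (simp flip: Xi_ob_embed_image plus)
  qed
qed

lemma Xi_ob_state_unique:
  assumes "comm_group H" and s: "s \<in> hom (Xi_ob M) H" and t: "t \<in> hom (Xi_ob M) H"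
    and eq: "\<And>a. a \<in> carrier M \<Longrightarrow> s (Xi_ob_embed M a) = t (Xi_ob_embed M a)"
    and x: "x \<in> carrier (Xi_ob M)"
  shows "s x = t x"
proof -
  have code: "Xi_code M \<in> hom (Xi M) (Xi_ob M)"
    using lg_iso_state[OF M.unital_l_group_Xi lg_iso_Xi_code] by (simp add: lg_state_def)
  obtain X where X: "X \<in> carrier (Xi M)" "x = Xi_code M X"
    using x lg_iso_Xi_code unfolding lg_iso_def bij_betw_def by blast
  have "(s \<circ> Xi_code M) X = (t \<circ> Xi_code M) X"
    using assms(1) hom_compose[OF code s] hom_compose[OF code t] _ X(1)
    by (rule M.Xi_hom_unique) (use eq in \<open>simp add: Xi_ob_embed_def\<close>)
  then show ?thesis by (simp add: X)
qed

text \<open>Decoding is a state by \<open>lg_iso_inv\<close>, and the extension of \<open>v\<close>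
  is composed with it. Restricting the composite makes it extensional, as arrows have to be.\<close>

lemma Xi_ob_state_exists:
  assumes "positive_valuation M H v" "v (mv_one M) = ounit H"
  obtains t where "lg_state (Xi_ob M) H t" "t \<in> extensional (carrier (Xi_ob M))"
    "\<And>a. a \<in> carrier M \<Longrightarrow> t (Xi_ob_embed M a) = v a"
proof -
  interpret v: positive_valuation M H v by fact
  let ?d = "inv_into (carrier (Xi M)) (Xi_code M)"
  let ?t = "restrict (v.extension \<circ> ?d) (carrier (Xi_ob M))"
  have "lg_state (Xi_ob M) (Xi M) ?d"
    by (rule lg_iso_state[OF unital_l_group_Xi_ob lg_iso_inv[OF M.unital_l_group_Xi lg_iso_Xi_code]])
  then have "lg_state (Xi_ob M) H (v.extension \<circ> ?d)"
    using v.extension_state[OF assms(2)] by (rule lg_state_comp)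
  then have "lg_state (Xi_ob M) H ?t"
    by (subst lg_state_cong[OF unital_l_group_Xi_ob]) auto
  moreover have "?t (Xi_ob_embed M a) = v a" if "a \<in> carrier M" for a
    using that Xi_ob_embed_closed[OF that]
    by (simp add: Xi_ob_embed_def Xi_code_inj v.extension_embed)
  ultimately show ?thesis
    using that by blast
qed

end

section \<open>The equivalence\<close>

lemma As_simps [simp]:
  "G \<in> Ob As \<longleftrightarrow> unital_l_group G"
  "s \<in> Hom As G H \<longleftrightarrow> lg_state G H s \<and> s \<in> extensional (carrier G)"
  "Id As G = (\<lambda>x\<in>carrier G. x)" "Comp As G H K t s = compose (carrier G) t s"
  by (auto simp: As_def)

lemma MVs_simps [simp]:
  "M \<in> Ob MVs \<longleftrightarrow> mv_algebra M"
  "s \<in> Hom MVs M N \<longleftrightarrow> mv_state M N s \<and> s \<in> extensional (carrier M)"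
  "Id MVs M = (\<lambda>x\<in>carrier M. x)" "Comp MVs M N P t s = compose (carrier M) t s"
  by (auto simp: MVs_def)

lemma functor_simps [simp]:
  "fob Gamma_functor = Gamma" "farr Gamma_functor G H s = restrict s (carrier (Gamma G))"
  "fob Xi_functor = Xi_ob" "farr Xi_functor = Xi_arr"
  by (simp_all add: Gamma_functor_def Xi_functor_def)

lemma lg_state_closed: "lg_state G H s \<Longrightarrow> x \<in> carrier G \<Longrightarrow> s x \<in> carrier H"
  by (auto simp: lg_state_def hom_def)

lemma mv_state_closed: "mv_state M N s \<Longrightarrow> x \<in> carrier M \<Longrightarrow> s x \<in> carrier N"
  by (auto simp: mv_state_def)

lemma lg_state_funcset: "lg_state G H s \<Longrightarrow> s \<in> carrier G \<rightarrow> carrier H"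
  by (auto simp: lg_state_def hom_def)

lemma mv_state_funcset: "mv_state M N s \<Longrightarrow> s \<in> carrier M \<rightarrow> carrier N"
  by (auto simp: mv_state_def)

lemma lg_state_compose:
  "unital_l_group G \<Longrightarrow> lg_state G H s \<Longrightarrow> lg_state H K t \<Longrightarrow> lg_state G K (compose (carrier G) t s)"
  using lg_state_cong[of G "compose (carrier G) t s" "t \<circ> s" K]
  by (simp add: compose_def lg_state_comp)

lemma lg_state_id: "unital_l_group G \<Longrightarrow> lg_state G G (\<lambda>x\<in>carrier G. x)"
  using lg_state_cong[of G "\<lambda>x\<in>carrier G. x" "\<lambda>x. x" G] by (simp add: lg_state_def hom_def)

lemma mv_state_compose:
  assumes "mv_algebra M" "mv_algebra N" "mv_algebra P" "mv_state M N s" "mv_state N P t"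
  shows "mv_state M P (compose (carrier M) t s)"
proof -
  interpret M: mv_algebra M by fact
  show ?thesis
    using assms(4,5) unfolding mv_state_iff[OF assms(1,2)] mv_state_iff[OF assms(2,3)]
      mv_state_iff[OF assms(1,3)]
    by (auto simp: compose_def Pi_iff)
qed

lemma mv_state_id:
  assumes "mv_algebra M"
  shows "mv_state M M (\<lambda>x\<in>carrier M. x)"
proof -
  interpret M: mv_algebra M by fact
  show ?thesis
    unfolding mv_state_iff[OF assms assms] by auto
qed

section \<open>The two categories and the restriction functor\<close>

lemma is_category_As: "is_category As"
  unfolding is_category_def
  by (auto simp: lg_state_compose lg_state_id
      intro: compose_assoc[OF lg_state_funcset] compose_Id[OF lg_state_funcset]
        Id_compose[OF lg_state_funcset])

lemma is_category_MVs: "is_category MVs"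
  unfolding is_category_def
  by (auto simp: mv_state_compose mv_state_id
      intro: compose_assoc[OF mv_state_funcset] compose_Id[OF mv_state_funcset]
        Id_compose[OF mv_state_funcset])

lemma mv_state_restrict:
  assumes "unital_l_group G" "unital_l_group H" "lg_state G H s"
  shows "mv_state (Gamma G) (Gamma H) (restrict s (carrier (Gamma G)))"
proof -
  interpret G: unital_l_group G by fact
  interpret H: unital_l_group H by fact
  have s: "s \<in> hom G H" "s (ounit G) = ounit H"
    and pos: "\<And>x. x \<in> carrier G \<Longrightarrow> lg_le G \<one>\<^bsub>G\<^esub> x \<Longrightarrow> lg_le H \<one>\<^bsub>H\<^esub> (s x)"
    using assms(3) by (auto simp: lg_state_def)
  interpret s: group_hom G H s by unfold_locales (rule s)
  \<comment> \<open>The upper bound is positivity of \<open>s\<close> at the unit minus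
    \<open>x\<close>.\<close>
  have "lg_le H (s x) (ounit H)" if "x \<in> carrier G" "lg_le G x (ounit G)" for x
    using pos[of "ounit G \<otimes>\<^bsub>G\<^esub> inv\<^bsub>G\<^esub> x"] that by (simp add: G.le_diff_iff H.le_diff_iff s(2))
  then show ?thesis
    unfolding mv_state_Gamma_iff[OF assms(1,2)]
    using pos by (auto simp: G.carrier_Gamma H.carrier_Gamma s(2))
qed

lemma is_functor_Gamma: "is_functor As MVs Gamma_functor"
proof -
  have comp: "restrict (compose (carrier G) t s) (carrier (Gamma G)) =
      compose (carrier (Gamma G)) (restrict t (carrier (Gamma H))) (restrict s (carrier (Gamma G)))"
    if "unital_l_group G" "unital_l_group H" "lg_state G H s" for G H :: "'u ulgroup" and s t :: "'u \<Rightarrow> 'u"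
  proof -
    interpret G: unital_l_group G by fact
    have "s x \<in> carrier (Gamma H)" if "x \<in> carrier (Gamma G)" for x
      using mv_state_closed[OF mv_state_restrict[OF \<open>unital_l_group G\<close> \<open>unital_l_group H\<close> \<open>lg_state G H s\<close>] that] that
      by simp
    then show ?thesis
      by (auto simp: compose_def G.carrier_Gamma fun_eq_iff restrict_def)
  qed
  have id: "carrier G \<inter> carrier (Gamma G) = carrier (Gamma G)"
    if "unital_l_group G" for G :: "'u ulgroup"
    using unital_l_group.carrier_Gamma[OF that] by auto
  show ?thesis
    unfolding is_functor_def
    by (simp add: unital_l_group.mv_algebra_Gamma mv_state_restrict comp id)
qed

section \<open>The extension functor\<close>

lemma positive_valuation_state:
  assumes "mv_algebra M" "mv_algebra N" "mv_state M N s"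
  shows "positive_valuation M (Xi_ob (N :: 'u::infinite mv)) (\<lambda>a. Xi_ob_embed N (s a))"
proof -
  interpret M: mv_algebra M by fact
  interpret N: mv_algebra N by fact
  interpret Xo: unital_l_group "Xi_ob N" by (rule unital_l_group_Xi_ob[OF assms(2)])
  have s: "s a \<in> carrier N" if "a \<in> carrier M" for a
    using mv_state_closed[OF assms(3) that] .
  have emb: "Xi_ob_embed N (s a) \<in> carrier (Gamma (Xi_ob N))" if "a \<in> carrier M" for a
    using Xi_ob_embed_image[OF assms(2)] s[OF that] by auto
  show ?thesis
  proof (intro positive_valuation.intro positive_valuation_axioms.intro)
    fix a b assume "a \<in> carrier M" "b \<in> carrier M" "mv_times M a b = mv_zero M"
    then have "mv_times N (s a) (s b) = mv_zero N" "s (mv_plus M a b) = mv_plus N (s a) (s b)"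
      using assms(3) by (auto simp: mv_state_iff[OF assms(1,2)])
    then show "Xi_ob_embed N (s (mv_plus M a b)) = Xi_ob_embed N (s a) \<otimes>\<^bsub>Xi_ob N\<^esub> Xi_ob_embed N (s b)"
      using Xi_ob_embed_plus[OF assms(2)] s \<open>a \<in> carrier M\<close> \<open>b \<in> carrier M\<close> by simp
  qed (use emb in \<open>auto simp: Xo.carrier_Gamma M.mv_algebra_axioms Xo.unital_l_group_axioms\<close>)
qed

text \<open>Embedded elements generate the group, so arrows out of it are compared on them.
  Uniqueness in \<open>Xi_arr\<close> and both functor laws for \<open>Xi_functor\<close> rest on
  this.\<close>

lemma Xi_ob_arrow_eqI:
  fixes M :: "'u::infinite mv"
  assumes "mv_algebra M" "unital_l_group H" "lg_state (Xi_ob M) H s" "lg_state (Xi_ob M) H t"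
    and "s \<in> extensional (carrier (Xi_ob M))" "t \<in> extensional (carrier (Xi_ob M))"
    and "\<And>a. a \<in> carrier M \<Longrightarrow> s (Xi_ob_embed M a) = t (Xi_ob_embed M a)"
  shows "s = t"
proof (rule extensionalityI[OF assms(5,6)])
  fix x assume x: "x \<in> carrier (Xi_ob M)"
  show "s x = t x"
    by (rule Xi_ob_state_unique[OF assms(1) unital_l_group.comm_group[OF assms(2)]])
      (use assms(3,4,7) x in \<open>simp_all add: lg_state_def\<close>)
qed

text \<open>Existence and uniqueness make the description in \<open>Xi_arr_def\<close> denote;
  afterwards only these three properties are used.\<close>

lemma Xi_arr:
  fixes M N :: "'u::infinite mv"
  assumes M: "mv_algebra M" and N: "mv_algebra N" and s: "mv_state M N s"
  shows Xi_arr_state: "lg_state (Xi_ob M) (Xi_ob N) (Xi_arr M N s)"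
    and Xi_arr_extensional: "Xi_arr M N s \<in> extensional (carrier (Xi_ob M))"
    and Xi_arr_embed: "\<And>a. a \<in> carrier M \<Longrightarrow> Xi_arr M N s (Xi_ob_embed M a) = Xi_ob_embed N (s a)"
proof -
  let ?P = "\<lambda>t. t \<in> Hom As (Xi_ob M) (Xi_ob N) \<and>
     (\<forall>a\<in>carrier M. t (Xi_ob_embed M a) = Xi_ob_embed N (s a))"
  have unit: "Xi_ob_embed N (s (mv_one M)) = ounit (Xi_ob N)"
    using s by (simp add: mv_state_def Xi_ob_embed_one[OF N])
  obtain t where "lg_state (Xi_ob M) (Xi_ob N) t" "t \<in> extensional (carrier (Xi_ob M))"
    "\<And>a. a \<in> carrier M \<Longrightarrow> t (Xi_ob_embed M a) = Xi_ob_embed N (s a)"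
    using Xi_ob_state_exists[OF M positive_valuation_state[OF M N s] unit] by blast
  then have t: "?P t" by simp
  have "t' = t" if "?P t'" for t'
    by (rule Xi_ob_arrow_eqI[OF M unital_l_group_Xi_ob[OF N]]) (use that t in simp_all)
  with t have "?P (Xi_arr M N s)"
    unfolding Xi_arr_def by (rule theI)
  then show "lg_state (Xi_ob M) (Xi_ob N) (Xi_arr M N s)"
    "Xi_arr M N s \<in> extensional (carrier (Xi_ob M))"
    "\<And>a. a \<in> carrier M \<Longrightarrow> Xi_arr M N s (Xi_ob_embed M a) = Xi_ob_embed N (s a)"
    by auto
qed

lemma is_functor_Xi: "is_functor MVs As (Xi_functor :: ('u::infinite mv, 'u \<Rightarrow> 'u, 'u ulgroup, 'u \<Rightarrow> 'u) func)"
proof -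
  have id: "Xi_arr M M (\<lambda>x\<in>carrier M. x) = (\<lambda>x\<in>carrier (Xi_ob M). x)"
    if M: "mv_algebra M" for M :: "'u mv"
    by (rule Xi_ob_arrow_eqI[OF M unital_l_group_Xi_ob[OF M]])
      (auto simp: M Xi_arr_state Xi_arr_extensional Xi_arr_embed mv_state_id lg_state_id
        unital_l_group_Xi_ob Xi_ob_embed_closed)
  have comp: "Xi_arr M P (compose (carrier M) t s) =
      compose (carrier (Xi_ob M)) (Xi_arr N P t) (Xi_arr M N s)"
    if MV: "mv_algebra M" "mv_algebra N" "mv_algebra P" and "mv_state M N s" "mv_state N P t"
    for M N P :: "'u mv" and s t :: "'u \<Rightarrow> 'u"
  proof (rule Xi_ob_arrow_eqI[OF MV(1) unital_l_group_Xi_ob[OF MV(3)]])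
    fix a assume "a \<in> carrier M"
    then show "Xi_arr M P (compose (carrier M) t s) (Xi_ob_embed M a) =
        compose (carrier (Xi_ob M)) (Xi_arr N P t) (Xi_arr M N s) (Xi_ob_embed M a)"
      using that mv_state_compose[OF that]
      by (simp add: Xi_arr_embed Xi_ob_embed_closed compose_eq mv_state_closed)
  qed (use that mv_state_compose[OF that] in
      \<open>auto simp: Xi_arr_state Xi_arr_extensional intro!: lg_state_compose[of _ "Xi_ob N"] unital_l_group_Xi_ob\<close>)
  show ?thesis
    unfolding is_functor_def
    by (auto simp: unital_l_group_Xi_ob Xi_arr_state Xi_arr_extensional id comp)
qed

section \<open>The natural isomorphism on groups\<close>

definition Xi_counit :: "'u::infinite ulgroup \<Rightarrow> 'u \<Rightarrow> 'u" where
  "Xi_counit G = unital_l_group.counit G \<circ> inv_into (carrier (Xi (Gamma G))) (Xi_code (Gamma G))"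

lemma Xi_counit:
  assumes G: "unital_l_group G"
  shows lg_iso_Xi_counit: "lg_iso (Xi_ob (Gamma G)) G (Xi_counit G)"
    and Xi_counit_embed: "a \<in> carrier (Gamma G) \<Longrightarrow> Xi_counit G (Xi_ob_embed (Gamma G) a) = a"
proof -
  interpret G: unital_l_group G by fact
  interpret Gam: mv_algebra "Gamma G" by (rule G.mv_algebra_Gamma)
  show "lg_iso (Xi_ob (Gamma G)) G (Xi_counit G)"
    unfolding Xi_counit_def
    by (rule lg_iso_comp[OF lg_iso_inv[OF Gam.unital_l_group_Xi lg_iso_Xi_code[OF G.mv_algebra_Gamma]]
          G.lg_iso_counit])
  show "a \<in> carrier (Gamma G) \<Longrightarrow> Xi_counit G (Xi_ob_embed (Gamma G) a) = a"
    by (simp add: Xi_counit_def Xi_ob_embed_def Xi_code_inj G.counit_embed)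
qed

text \<open>The required transformation starts at the identity functor, opposite to
  \<open>Xi_counit\<close>, hence the inverse; it is restricted because arrows are
  extensional.\<close>

definition unit_As :: "'u::infinite ulgroup \<Rightarrow> 'u \<Rightarrow> 'u" where
  "unit_As G = restrict (inv_into (carrier (Xi_ob (Gamma G))) (Xi_counit G)) (carrier G)"

lemma is_iso_As:
  assumes G: "unital_l_group G" and H: "unital_l_group H" and f: "lg_iso G H f"
  shows "is_iso As G H (restrict f (carrier G))"
proof -
  let ?f = "restrict f (carrier G)" and ?g = "restrict (inv_into (carrier G) f) (carrier H)"
  have bij: "bij_betw f (carrier G) (carrier H)" using f by (simp add: lg_iso_def)
  have "lg_state G H ?f"
    using lg_iso_state[OF G f] by (subst lg_state_cong[OF G, of _ f]) auto
  moreover have "lg_state H G ?g"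
    using lg_iso_state[OF H lg_iso_inv[OF G f]]
    by (subst lg_state_cong[OF H, of _ "inv_into (carrier G) f"]) auto
  moreover have "compose (carrier G) ?g ?f = (\<lambda>x\<in>carrier G. x)"
    using bij by (auto simp: compose_def fun_eq_iff restrict_def bij_betw_def)
  moreover have "compose (carrier H) ?f ?g = (\<lambda>x\<in>carrier H. x)"
    using bij by (auto simp: compose_def fun_eq_iff restrict_def bij_betw_def f_inv_into_f inv_into_into)
  ultimately show ?thesis
    unfolding is_iso_def by auto
qed

text \<open>Both sides are homomorphisms in \<open>x\<close>, and at the embedding of
  \<open>a\<close> both give \<open>f a\<close>, so generation suffices.\<close>

lemma Xi_counit_natural:
  assumes G: "unital_l_group G" and H: "unital_l_group H" and f: "lg_state G H f"
    and x: "x \<in> carrier (Xi_ob (Gamma G))"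
  shows "Xi_counit H (Xi_arr (Gamma G) (Gamma H) (restrict f (carrier (Gamma G))) x) = f (Xi_counit G x)"
proof -
  note MG = unital_l_group.mv_algebra_Gamma[OF G] and MH = unital_l_group.mv_algebra_Gamma[OF H]
  note XG = unital_l_group_Xi_ob[OF MG] and XH = unital_l_group_Xi_ob[OF MH]
  let ?r = "restrict f (carrier (Gamma G))"
  have r: "mv_state (Gamma G) (Gamma H) ?r"
    by (rule mv_state_restrict[OF G H f])
  have "(Xi_counit H \<circ> Xi_arr (Gamma G) (Gamma H) ?r) x = (f \<circ> Xi_counit G) x"
  proof (rule Xi_ob_state_unique[OF MG unital_l_group.comm_group[OF H] _ _ _ x])
    have "lg_state (Xi_ob (Gamma G)) H (Xi_counit H \<circ> Xi_arr (Gamma G) (Gamma H) ?r)"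
      by (rule lg_state_comp[OF Xi_arr_state[OF MG MH r] lg_iso_state[OF XH lg_iso_Xi_counit[OF H]]])
    then show "Xi_counit H \<circ> Xi_arr (Gamma G) (Gamma H) ?r \<in> hom (Xi_ob (Gamma G)) H"
      by (simp add: lg_state_def)
    have "lg_state (Xi_ob (Gamma G)) H (f \<circ> Xi_counit G)"
      by (rule lg_state_comp[OF lg_iso_state[OF XG lg_iso_Xi_counit[OF G]] f])
    then show "f \<circ> Xi_counit G \<in> hom (Xi_ob (Gamma G)) H"
      by (simp add: lg_state_def)
    fix a assume a: "a \<in> carrier (Gamma G)"
    then show "(Xi_counit H \<circ> Xi_arr (Gamma G) (Gamma H) ?r) (Xi_ob_embed (Gamma G) a) =
        (f \<circ> Xi_counit G) (Xi_ob_embed (Gamma G) a)"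
      using mv_state_closed[OF r a]
      by (simp add: Xi_arr_embed[OF MG MH r] Xi_counit_embed[OF G] Xi_counit_embed[OF H])
  qed
  then show ?thesis by simp
qed

lemma is_nat_iso_unit:
  "is_nat_iso As As id_func (comp_func Xi_functor Gamma_functor) (unit_As :: 'u::infinite ulgroup \<Rightarrow> _)"
proof -
  have iso: "is_iso As G (Xi_ob (Gamma G)) (unit_As G)" if G: "unital_l_group G" for G :: "'u ulgroup"
  proof -
    note X = unital_l_group_Xi_ob[OF unital_l_group.mv_algebra_Gamma[OF G]]
    show ?thesis
      unfolding unit_As_def by (rule is_iso_As[OF G X lg_iso_inv[OF X lg_iso_Xi_counit[OF G]]])
  qed
  have nat: "compose (carrier G) (unit_As H) f =
      compose (carrier G) (Xi_arr (Gamma G) (Gamma H) (restrict f (carrier (Gamma G)))) (unit_As G)"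
    if G: "unital_l_group G" and H: "unital_l_group H" and f: "lg_state G H f"
    for G H :: "'u ulgroup" and f :: "'u \<Rightarrow> 'u"
  proof -
    note MG = unital_l_group.mv_algebra_Gamma[OF G] and MH = unital_l_group.mv_algebra_Gamma[OF H]
    let ?t = "Xi_arr (Gamma G) (Gamma H) (restrict f (carrier (Gamma G)))"
    have "unit_As H (f x) = ?t (unit_As G x)" if x: "x \<in> carrier G" for x
    proof -
      have bijG: "bij_betw (Xi_counit G) (carrier (Xi_ob (Gamma G))) (carrier G)"
        and bijH: "bij_betw (Xi_counit H) (carrier (Xi_ob (Gamma H))) (carrier H)"
        using lg_iso_Xi_counit[OF G] lg_iso_Xi_counit[OF H] by (auto simp: lg_iso_def)
      \<comment> \<open>Writing \<open>x\<close> as a value of \<open>Xi_counit G\<close> turns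
        naturality of the inverse into \<open>Xi_counit_natural\<close>.\<close>
      then obtain y where y: "y \<in> carrier (Xi_ob (Gamma G))" "x = Xi_counit G y"
        using x unfolding bij_betw_def by blast
      have ty: "?t y \<in> carrier (Xi_ob (Gamma H))"
        using lg_state_closed[OF Xi_arr_state[OF MG MH mv_state_restrict[OF G H f]] y(1)] .
      have "unit_As G x = y"
        using x y bijG by (simp add: unit_As_def bij_betw_def)
      moreover have "f x = Xi_counit H (?t y)"
        using Xi_counit_natural[OF G H f y(1)] y(2) by simp
      then have "unit_As H (f x) = ?t y"
        using lg_state_closed[OF f x] ty bijH by (simp add: unit_As_def bij_betw_def)
      ultimately show ?thesis by simp
    qed
    then show ?thesis by (auto simp: compose_def fun_eq_iff restrict_def)
  qed
  show ?thesis
    unfolding is_nat_iso_def by (auto simp: id_func_def comp_func_def iso nat)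
qed

section \<open>The natural isomorphism on MV-algebras\<close>

definition counit_MVs :: "'u::infinite mv \<Rightarrow> 'u \<Rightarrow> 'u" where
  "counit_MVs M = restrict (inv_into (carrier M) (Xi_ob_embed M)) (carrier (Gamma (Xi_ob M)))"

lemma counit_MVs_embed:
  assumes M: "mv_algebra M" and a: "a \<in> carrier M"
  shows "counit_MVs M (Xi_ob_embed M a) = a"
proof -
  have "inj_on (Xi_ob_embed M) (carrier M)"
    using Xi_ob_embed_inject[OF M] by (auto simp: inj_on_def)
  then show ?thesis
    using a Xi_ob_embed_image[OF M] by (auto simp: counit_MVs_def)
qed

text \<open>The inverse is the embedding, a state by \<open>Xi_ob_embed_plus\<close>. That
  \<open>counit_MVs M\<close> is a state needs the converse: a sum of embedded elements inside the
  unit interval comes from an orthogonal pair.\<close>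

lemma is_iso_counit_MVs:
  assumes M: "mv_algebra M"
  shows "is_iso MVs (Gamma (Xi_ob M)) M (counit_MVs M)"
proof -
  interpret M: mv_algebra M by fact
  note X = unital_l_group_Xi_ob[OF M]
  interpret X: unital_l_group "Xi_ob M" by (rule X)
  note GX = X.mv_algebra_Gamma
  interpret GX: mv_algebra "Gamma (Xi_ob M)" by (rule GX)
  let ?e = "restrict (Xi_ob_embed M) (carrier M)"
  have e: "mv_state M (Gamma (Xi_ob M)) ?e"
    unfolding mv_state_into_Gamma_iff[OF M X]
    using Xi_ob_embed_image[OF M] by (auto simp: Xi_ob_embed_one[OF M] Xi_ob_embed_plus[OF M])
  have c: "mv_state (Gamma (Xi_ob M)) M (counit_MVs M)"
    unfolding mv_state_iff[OF GX M]
  proof (intro conjI ballI impI)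
    show "counit_MVs M \<in> carrier (Gamma (Xi_ob M)) \<rightarrow> carrier M"
      by (auto simp: Xi_ob_embed_image[OF M, symmetric] counit_MVs_embed[OF M])
    show "counit_MVs M (mv_one (Gamma (Xi_ob M))) = mv_one M"
      using counit_MVs_embed[OF M, of "mv_one M"] by (simp add: Xi_ob_embed_one[OF M])
    fix x y assume xy: "x \<in> carrier (Gamma (Xi_ob M))" "y \<in> carrier (Gamma (Xi_ob M))"
      and "mv_times (Gamma (Xi_ob M)) x y = mv_zero (Gamma (Xi_ob M))"
    then have le: "lg_le (Xi_ob M) (x \<otimes>\<^bsub>Xi_ob M\<^esub> y) (ounit (Xi_ob M))"
      by (simp add: X.Gamma_times_eq_zero_iff)
    then have "x \<otimes>\<^bsub>Xi_ob M\<^esub> y \<in> carrier (Gamma (Xi_ob M))"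
      using xy by (simp add: X.carrier_Gamma X.mult_nonneg)
    moreover obtain a b where ab: "a \<in> carrier M" "x = Xi_ob_embed M a" "b \<in> carrier M" "y = Xi_ob_embed M b"
      using xy by (auto simp: Xi_ob_embed_image[OF M, symmetric])
    ultimately have abz: "mv_times M a b = mv_zero M"
      by (simp add: Xi_ob_embed_plus_closed_iff[OF M])
    have "mv_plus (Gamma (Xi_ob M)) x y = Xi_ob_embed M (mv_plus M a b)"
      using xy le ab abz
      by (simp add: X.Gamma_plus X.meet_absorb Xi_ob_embed_plus[OF M] Xi_ob_embed_closed[OF M])
    then show "counit_MVs M (mv_plus (Gamma (Xi_ob M)) x y) =
        mv_plus M (counit_MVs M x) (counit_MVs M y)"
      using ab by (simp add: counit_MVs_embed[OF M])
    show "mv_times M (counit_MVs M x) (counit_MVs M y) = mv_zero M"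
      using ab abz by (simp add: counit_MVs_embed[OF M])
  qed
  have "compose (carrier (Gamma (Xi_ob M))) ?e (counit_MVs M) = (\<lambda>x\<in>carrier (Gamma (Xi_ob M)). x)"
    by (auto simp: compose_def fun_eq_iff restrict_def Xi_ob_embed_image[OF M, symmetric] counit_MVs_embed[OF M])
  moreover have "compose (carrier M) (counit_MVs M) ?e = (\<lambda>x\<in>carrier M. x)"
    by (auto simp: compose_def fun_eq_iff restrict_def counit_MVs_embed[OF M])
  ultimately show ?thesis
    unfolding is_iso_def using e c by (auto simp: counit_MVs_def)
qed

lemma is_nat_iso_counit:
  "is_nat_iso MVs MVs (comp_func Gamma_functor Xi_functor) id_func (counit_MVs :: 'u::infinite mv \<Rightarrow> _)"
proof -
  \<comment> \<open>Embedded elements exhaust the unit interval, and on them the square is the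
    defining property of \<open>Xi_arr\<close>.\<close>
  have nat: "compose (carrier (Gamma (Xi_ob M))) (counit_MVs N)
        (restrict (Xi_arr M N s) (carrier (Gamma (Xi_ob M)))) =
      compose (carrier (Gamma (Xi_ob M))) s (counit_MVs M)"
    if M: "mv_algebra M" and N: "mv_algebra N" and s: "mv_state M N s"
    for M N :: "'u mv" and s :: "'u \<Rightarrow> 'u"
    by (auto simp: compose_def fun_eq_iff restrict_def Xi_ob_embed_image[OF M, symmetric]
        counit_MVs_embed[OF M] counit_MVs_embed[OF N] Xi_arr_embed[OF M N s] mv_state_closed[OF s])
  show ?thesis
    unfolding is_nat_iso_def by (auto simp: id_func_def comp_func_def is_iso_counit_MVs nat)
qed

theorem theorem2p7:
  shows "equivalence_of_categories
    (As :: ('u::infinite ulgroup, 'u \<Rightarrow> 'u) category) (MVs :: ('u mv, 'u \<Rightarrow> 'u) category)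
    Gamma_functor Xi_functor"
  unfolding equivalence_of_categories_def
  using is_category_As is_category_MVs is_functor_Gamma is_functor_Xi
    is_nat_iso_unit is_nat_iso_counit by blast

end
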